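(* Fix constants $\alpha\in(0,1)$ and $\rho\in(0,1)$, and let $m=\alpha n^2$. Let $\mathcal{T}\subseteq\mathcal{L}_n$ be a property of $n\times n$ Latin squares and let $\mathcal{U}$ be a property of subhypergraphs of $K^{(3)}_{n,n,n}$, such that $\mathcal{U}$ is $(\rho,m)$-inherited from $\mathcal{T}$. Let $\mathbf{L}$ be a uniformly random $n\times n$ Latin square. (1) If $\mathcal{U}$ is monotone decreasing, then \[\Pr[\mathbf{L}\in\mathcal{T}]\le\exp\big(O(n\log^2n)\big)\,\Pr[\mathbf{G}^*\in\mathcal{U}],\] where $\mathbf{G}\sim\mathbb{G}^{(3)}(n,\alpha/n)$ and $\mathbf{G}^*$ is obtained from $\mathbf{G}$ by deleting all hyperedges involved in conflicts. (2) If $\mathcal{U}$ is monotone increasing, then for any constant $\gamma>0$, if $\alpha$ is sufficiently small with respect to $\gamma$, we have \[\Pr[\mathbf{L}\in\mathcal{T}]\le\exp\big(O(n\log^2n)\big)\,\Pr[\mathbf{G}\in\mathcal{U}]+\exp(-\Omega(n^2)),\] where $\mathbf{G}\sim\mathbb{G}^{(3)}(n,(1+\gamma)\alpha/n)$. Here the constants implicit in $O(\cdot),\Omega(\cdot)$ (and the threshold for $n$ being sufficiently large) depend only on $\alpha,\rho$ (and $\gamma$), not on $\mathcal{T},\mathcal{U}$.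
   Context: Convention: floor and ceiling signs are omitted, so $\alpha n^2$ is treated as an integer. $K^{(3)}_{n,n,n}$ is the complete tripartite 3-uniform hypergraph with parts (rows, columns, symbols), each of size $n$. An $n\times n$ Latin square ($n\times n$ array with each of the symbols $1,\dots,n$ exactly once in each row and column) is identified with the subhypergraph of $K^{(3)}_{n,n,n}$ whose hyperedges are the triples $(r,c,s)$ with symbol $s$ in row $r$ and column $c$. $\mathcal{L}_n$ is the set of all $n\times n$ Latin squares. $\mathcal{U}$ is $(\rho,m)$-inherited from $\mathcal{T}$ if for every $L\in\mathcal{T}$, a uniformly random subset of $m$ hyperedges of $L$ belongs to $\mathcal{U}$ with probability at least $\rho$. $\mathcal{U}$ is monotone decreasing if $P\in\mathcal{U}$ and $P'\subseteq P$ imply $P'\in\mathcal{U}$, and monotone increasing if $P\in\mathcal{U}$ and $P\subseteq P'$ imply $P'\in\mathcal{U}$. $\mathbb{G}^{(3)}(n,p)$ is the distribution on subhypergraphs of $K^{(3)}_{n,n,n}$ obtained by including each of the $n^3$ possible hyperedges independently with probability $p$. A conflict is a pair of distinct hyperedges intersecting in more than one vertex. *)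

theory Defs
  imports "HOL-Probability.Probability" "HOL-Probability.Product_PMF"
begin

datatype vertex = Row nat | Col nat | Sym nat

type_synonym hypergraph = "vertex set set"

definition complete_tripartite :: "nat \<Rightarrow> hypergraph" where
  "complete_tripartite n =
     {{Row r, Col c, Sym s} | r c s. r \<in> {1..n} \<and> c \<in> {1..n} \<and> s \<in> {1..n}}"

definition latin_array :: "nat \<Rightarrow> (nat \<Rightarrow> nat \<Rightarrow> nat) \<Rightarrow> bool" where
  "latin_array n A \<longleftrightarrow>
     (\<forall>r\<in>{1..n}. bij_betw (\<lambda>c. A r c) {1..n} {1..n}) \<and>
     (\<forall>c\<in>{1..n}. bij_betw (\<lambda>r. A r c) {1..n} {1..n})"

definition array_hypergraph :: "nat \<Rightarrow> (nat \<Rightarrow> nat \<Rightarrow> nat) \<Rightarrow> hypergraph" where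
  "array_hypergraph n A = {{Row r, Col c, Sym (A r c)} | r c. r \<in> {1..n} \<and> c \<in> {1..n}}"

text \<open>Latin squares are identified with their hypergraphs. The values of an array outside
  \<open>{1..n} \<times> {1..n}\<close> do not matter, so this set has exactly one element per Latin square.\<close>

definition latin_squares :: "nat \<Rightarrow> hypergraph set" where
  "latin_squares n = {array_hypergraph n A | A. latin_array n A}"

text \<open>A Latin square of order \<open>n\<close> has \<open>n\<^sup>2\<close> hyperedges, so for \<open>m \<le> n\<^sup>2\<close> the set of
  \<open>m\<close>-subsets is nonempty and \<open>pmf_of_set\<close> is the uniform distribution on it.\<close>

definition inherited ::
    "real \<Rightarrow> nat \<Rightarrow> hypergraph set \<Rightarrow> hypergraph set \<Rightarrow> bool" where
  "inherited \<rho> m \<U> \<T> \<longleftrightarrow>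
     (\<forall>L\<in>\<T>. measure_pmf.prob (pmf_of_set {S. S \<subseteq> L \<and> card S = m}) \<U> \<ge> \<rho>)"

definition monotone_decreasing :: "hypergraph set \<Rightarrow> bool" where
  "monotone_decreasing \<U> \<longleftrightarrow> (\<forall>P P'. P \<in> \<U> \<and> P' \<subseteq> P \<longrightarrow> P' \<in> \<U>)"

text \<open>The larger hypergraph has to stay inside the complete tripartite one, since only its
  subhypergraphs are considered.\<close>

definition monotone_increasing :: "nat \<Rightarrow> hypergraph set \<Rightarrow> bool" where
  "monotone_increasing n \<U> \<longleftrightarrow>
     (\<forall>P P'. P \<in> \<U> \<and> P \<subseteq> P' \<and> P' \<subseteq> complete_tripartite n \<longrightarrow> P' \<in> \<U>)"

text \<open>Note that \<open>bernoulli_pmf\<close> truncates its parameter to \<open>[0, 1]\<close>.\<close>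

definition random_hypergraph :: "nat \<Rightarrow> real \<Rightarrow> hypergraph pmf" where
  "random_hypergraph n p =
     map_pmf (\<lambda>X. {e \<in> complete_tripartite n. X e})
       (Pi_pmf (complete_tripartite n) False (\<lambda>_. bernoulli_pmf p))"

definition conflict :: "vertex set \<Rightarrow> vertex set \<Rightarrow> bool" where
  "conflict e f \<longleftrightarrow> e \<noteq> f \<and> card (e \<inter> f) > 1"

definition delete_conflicts :: "hypergraph \<Rightarrow> hypergraph" where
  "delete_conflicts G = {e \<in> G. \<not> (\<exists>f\<in>G. conflict e f)}"

end

theory Submission
  imports Defs "HOL-Computational_Algebra.Fundamental_Theorem_Algebra"
    "HOL-Real_Asymp.Real_Asymp"
begin

text \<open>
  Compare everything with the random greedy process, which repeatedly adds a uniformly random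
  hyperedge that causes no conflict. Revealing a random hypergraph edge by edge couples it to this
  process: the hyperedges without conflicts are contained in the outcome of at most as many greedy
  steps (decreasing properties), and for small \<open>\<alpha>\<close> a random hypergraph with slightly more than
  \<open>\<alpha> n\<^sup>2\<close> hyperedges contains the outcome of \<open>\<alpha> n\<^sup>2\<close> greedy steps except with probability
  \<open>exp (-\<Omega>(n\<^sup>2))\<close> (increasing properties).

  It remains to bound from below the probability that \<open>m\<close> greedy steps end in \<open>\<U>\<close>. Continue
  the greedy process by filling the remaining cells row by row, rows and columns in random order,
  with random available symbols. For each \<open>L \<in> \<T>\<close>, inheritance provides many sequences of \<open>m\<close>
  hyperedges of \<open>L\<close> ending in \<open>\<U>\<close>, and by Jensen's inequality the probability that the combined
  process follows such a sequence and then completes it to \<open>L\<close> is at least \<open>exp (-E)\<close>, where \<open>E\<close> is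
  the expected sum of the logarithms of the numbers of choices. These numbers are estimated by a
  second moment computation, and the row by row filling costs only \<open>O(n ln\<^sup>2 n)\<close> more than the ideal
  value, as in Bregman's bound. Comparison with the lower bound \<open>(n / e\<^sup>2)\<close> to the power \<open>n\<^sup>2\<close> for the
  number of Latin squares, which follows from Gurvits' proof of the van der Waerden bound for
  permanents, gives the result.
\<close>

section \<open>A lower bound for the permanent\<close>

text \<open>The leading terms have to cancel exactly. Each square of \<open>\<T>\<close> contributes
  at least \<open>\<rho> * falling (n^2) m\<close> sequences, which offsets
  \<open>ln (falling (n^2) m)\<close> in the total cost; the rest of the main term is
  \<open>n^2 * ln n - 2 * n^2\<close>, the logarithm of the lower bound for the number of Latin
  squares. Everything else must be O(n ln^2 n). The greedy process alone cannot be followed to the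
  end: the count of available hyperedges is precise up to a relative error 1/n only while a constant
  fraction of the cells is open, here \<open>\<delta> = 1 - \<alpha>\<close>. After m steps a
  different continuation takes over, whose order may be random. Then only the mean number of open
  triples at time m enters, and concavity of the logarithm replaces concentration. The sequences
  ending in \<open>\<U>\<close> form only a fraction \<rho> of all sequences of a square. Hence the
  estimates must hold on an arbitrary subfamily of that density, which a second moment provides at
  the price of 1/\<rho>.\<close>

lemma poly_root_factor:
  fixes p :: "complex poly"
  assumes "degree p = Suc k"
  obtains w q where "p = [:-w, 1:] * q" "degree q = k" "q \<noteq> 0"
proof -
  have "\<not> constant (poly p)" using assms by (simp add: constant_degree)
  then obtain w where "poly p w = 0" using fundamental_theorem_of_algebra by blast
  then obtain q where q: "p = [:-w, 1:] * q" unfolding poly_eq_0_iff_dvd by (elim dvdE)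
  moreover have q0: "q \<noteq> 0" using q assms by auto
  moreover have "degree p = 1 + degree q"
    unfolding q by (subst degree_mult_eq) (use q0 in auto)
  ultimately show ?thesis using that assms by simp
qed

text \<open>The quotient is the sum of \<open>1 / (z - w)\<close> over the roots w, and each summand
  has negative imaginary part when z lies above w. Strictness is what excludes critical points above
  all roots.\<close>

lemma Im_log_deriv_above_roots:
  fixes p :: "complex poly"
  assumes "p \<noteq> 0" and "\<And>w. poly p w = 0 \<Longrightarrow> Im w < Im z"
  shows "Im (poly (pderiv p) z / poly p z) \<le> 0 \<and>
    (0 < degree p \<longrightarrow> Im (poly (pderiv p) z / poly p z) < 0)"
  using assms
proof (induction "degree p" arbitrary: p)
  case 0
  then show ?case by (simp flip: pderiv_eq_0_iff)
next
  case (Suc k)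
  obtain w q where q: "p = [:-w, 1:] * q" "degree q = k" "q \<noteq> 0"
    using poly_root_factor Suc(2) by metis
  have r: "Im w < Im z" "\<And>u. poly q u = 0 \<Longrightarrow> Im u < Im z"
    using Suc(4) unfolding q by auto
  have IH: "Im (poly (pderiv q) z / poly q z) \<le> 0" using Suc(1)[of q] q r by simp
  have nz: "poly q z \<noteq> 0" "z - w \<noteq> 0" using r by force+
  have "poly (pderiv p) z / poly p z = 1 / (z - w) + poly (pderiv q) z / poly q z"
  proof -
    have "pderiv [:-w, 1:] = 1" by (simp add: pderiv_pCons)
    then have "poly (pderiv p) z = poly q z + (z - w) * poly (pderiv q) z" "poly p z = (z - w) * poly q z"
      unfolding q pderiv_mult by (simp_all add: algebra_simps)
    then show ?thesis using nz by (simp only: add_divide_distrib) simp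
  qed
  moreover have "Im (1 / (z - w)) < 0" 
    using r nz by (auto simp: Im_divide divide_simps complex_eq_iff sum_power2_gt_zero_iff)
  ultimately show ?case using IH by simp
qed

lemma pderiv_nonzero_above_roots:
  fixes p :: "complex poly"
  assumes "0 < degree p" and "\<And>w. poly p w = 0 \<Longrightarrow> Im w < Im z"
  shows "poly (pderiv p) z \<noteq> 0"
proof -
  have "Im (poly (pderiv p) z / poly p z) < 0"
    using Im_log_deriv_above_roots[of p z] assms by fastforce
  then show ?thesis by auto
qed

text \<open>Up to the constant \<open>poly p 0\<close> the polynomial is a product of factors
  \<open>1 + t / s\<close> over the roots \<open>-s\<close>, each at most
  \<open>exp (t / s)\<close>. The number \<sigma> is the sum of the \<open>1 / s\<close>, which is
  also the logarithmic derivative at 0.\<close>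

lemma negative_roots_growth:
  fixes p :: "complex poly"
  assumes "p \<noteq> 0" and "\<And>w. poly p w = 0 \<Longrightarrow> Im w = 0 \<and> Re w < 0"
  shows "\<exists>\<sigma>\<ge>0. poly (pderiv p) 0 = of_real \<sigma> * poly p 0 \<and>
    (\<forall>t\<ge>0. norm (poly p (of_real t)) \<le> norm (poly p 0) * exp (\<sigma> * t))"
  using assms
proof (induction "degree p" arbitrary: p)
  case 0
  then have "pderiv p = 0" by (simp add: pderiv_eq_0_iff)
  moreover obtain c where "p = [:c:]" using 0 by (metis degree_eq_zeroE)
  ultimately show ?case by (intro exI[of _ 0]) auto
next
  case (Suc k)
  obtain w q where q: "p = [:-w, 1:] * q" "degree q = k" "q \<noteq> 0"
    using poly_root_factor Suc(2) by metis
  have r: "Im w = 0" "Re w < 0" "\<And>u. poly q u = 0 \<Longrightarrow> Im u = 0 \<and> Re u < 0"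
    using Suc(4) unfolding q by auto
  define s where "s = - Re w"
  have s: "s > 0" "w = - of_real s" using r by (auto simp: s_def complex_eq_iff)
  obtain \<sigma> where \<sigma>: "\<sigma> \<ge> 0" "poly (pderiv q) 0 = of_real \<sigma> * poly q 0"
    "\<And>t. t \<ge> 0 \<Longrightarrow> norm (poly q (of_real t)) \<le> norm (poly q 0) * exp (\<sigma> * t)"
    using Suc(1)[of q] q r by auto
  show ?case
  proof (intro exI[of _ "\<sigma> + 1 / s"] conjI allI impI)
    show "0 \<le> \<sigma> + 1 / s" using \<sigma> s by simp
    show "poly (pderiv p) 0 = of_real (\<sigma> + 1 / s) * poly p 0"
    proof -
      have "pderiv [:-w, 1:] = 1" by (simp add: pderiv_pCons)
      then have "poly (pderiv p) 0 = poly q 0 + of_real s * poly (pderiv q) 0" "poly p 0 = of_real s * poly q 0"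
        unfolding q pderiv_mult s(2) by (simp_all add: algebra_simps)
      then show ?thesis using s(1) \<sigma>(2) by (simp add: field_simps)
    qed
    fix t :: real assume t: "t \<ge> 0"
    have "norm (poly p (of_real t)) = norm (of_real (s + t) :: complex) * norm (poly q (of_real t))"
      unfolding q s by (simp add: norm_mult flip: distrib_right)
    also have "\<dots> = (s + t) * norm (poly q (of_real t))"
      unfolding norm_of_real using s t by simp
    also have "\<dots> \<le> (s * exp (t / s)) * (norm (poly q 0) * exp (\<sigma> * t))"
    proof (intro mult_mono \<sigma>)
      have "s + t = s * (1 + t / s)" using s by (simp add: field_simps)
      also have "\<dots> \<le> s * exp (t / s)" using s by (intro mult_left_mono) auto
      finally show "s + t \<le> s * exp (t / s)" .
    qed (use s t in auto)
    also have "\<dots> = norm (poly p 0) * exp ((\<sigma> + 1 / s) * t)"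
      unfolding q s using s by (simp add: norm_mult algebra_simps exp_add)
    finally show "norm (poly p (of_real t)) \<le> norm (poly p 0) * exp ((\<sigma> + 1 / s) * t)" .
  qed
qed

text \<open>\<open>mixed_deriv a n [j\<^sub>1, \<dots>, j\<^sub>k] R\<close> is the partial derivative in the variables
  \<open>z j\<^sub>1, \<dots>, z j\<^sub>k\<close> of the product of the linear forms \<open>\<Sum>j<n. a i j * z j\<close> with \<open>i \<in> R\<close>. For
  \<open>k = card R\<close> it is a permanent.\<close>

primrec mixed_deriv ::
    "(nat \<Rightarrow> nat \<Rightarrow> real) \<Rightarrow> nat \<Rightarrow> nat list \<Rightarrow> nat set \<Rightarrow> (nat \<Rightarrow> 'a::real_normed_field) \<Rightarrow> 'a" where
  "mixed_deriv a n [] R z = (\<Prod>i\<in>R. \<Sum>j<n. of_real (a i j) * z j)"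
| "mixed_deriv a n (j # J) R z = (\<Sum>i\<in>R. of_real (a i j) * mixed_deriv a n J (R - {i}) z)"

section \<open>Products of linear forms, differentiated in one variable at a time\<close>

lemma linear_form_upd:
  fixes z :: "nat \<Rightarrow> 'a::real_normed_field"
  assumes "j < n"
  shows "(\<Sum>k<n. of_real (a i k) * (z(j := t)) k) =
    (\<Sum>k\<in>{..<n}-{j}. of_real (a i k) * z k) + of_real (a i j) * t"
proof -
  have "(\<Sum>k<n. of_real (a i k) * (z(j := t)) k) =
    of_real (a i j) * t + (\<Sum>k\<in>{..<n}-{j}. of_real (a i k) * (z(j := t)) k)"
    using assms by (subst sum.remove[of _ j]) auto
  also have "(\<Sum>k\<in>{..<n}-{j}. of_real (a i k) * (z(j := t)) k) =
    (\<Sum>k\<in>{..<n}-{j}. of_real (a i k) * z k)" by (intro sum.cong) auto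
  finally show ?thesis by simp
qed

text \<open>The new index is appended at the end: the recursion peels off the first index as the
  outermost sum, whereas differentiation acts on the product at the bottom. This is why the
  inductions for stability and capacity run from the end of the list.\<close>

lemma mixed_deriv_has_derivative:
  fixes z :: "nat \<Rightarrow> 'a::real_normed_field"
  assumes "j < n"
  shows "((\<lambda>t. mixed_deriv a n J R (z(j := t))) has_field_derivative
    mixed_deriv a n (J @ [j]) R (z(j := t))) (at t)"
proof (induction J arbitrary: R)
  case Nil
  have "((\<lambda>t. \<Prod>i\<in>R. \<Sum>k<n. of_real (a i k) * (z(j := t)) k) has_field_derivative
    (\<Sum>i\<in>R. of_real (a i j) * (\<Prod>i\<in>R-{i}. \<Sum>k<n. of_real (a i k) * (z(j := t)) k))) (at t)"
    by (rule has_field_derivative_prod, unfold linear_form_upd[OF assms])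
       (auto intro!: derivative_eq_intros)
  then show ?case by simp
next
  case (Cons k J)
  show ?case unfolding append_Cons mixed_deriv.simps by (intro derivative_intros DERIV_cmult Cons)
qed

text \<open>The positive coefficient shows that the degree is exactly
  \<open>card R - length J\<close>. So the polynomial is nonzero, and nonconstant as long as a
  further derivative is to be taken.\<close>

lemma mixed_deriv_univariate:
  fixes z :: "nat \<Rightarrow> complex"
  assumes "j < n" and "\<And>i k. 0 < a i k" and "finite R" and "length J \<le> card R"
  shows "\<exists>p c. (\<forall>t. poly p t = mixed_deriv a n J R (z(j := t))) \<and>
    degree p \<le> card R - length J \<and> 0 < c \<and> coeff p (card R - length J) = complex_of_real c"
  using assms(3,4)
proof (induction J arbitrary: R)
  case Nil
  define l where "l i = (\<Sum>k\<in>{..<n}-{j}. of_real (a i k) * z k)" for i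
  define p where "p = (\<Prod>i\<in>R. [:l i, complex_of_real (a i j):])"
  have nz: "complex_of_real (a i j) \<noteq> 0" for i using assms(2)[of i j] by simp
  have "degree p = (\<Sum>i\<in>R. degree [:l i, complex_of_real (a i j):])"
    unfolding p_def by (rule degree_prod_sum_eq) (use nz in auto)
  then have deg: "degree p = card R" using nz by simp
  have "lead_coeff p = (\<Prod>i\<in>R. complex_of_real (a i j))"
    unfolding p_def lead_coeff_prod using nz by simp
  then have "coeff p (card R) = complex_of_real (\<Prod>i\<in>R. a i j)" using deg by simp
  moreover have "(\<Prod>i\<in>R. a i j) > 0" by (intro prod_pos) (use assms in auto)
  moreover have "poly p t = mixed_deriv a n [] R (z(j := t))" for t
    unfolding mixed_deriv.simps linear_form_upd[OF assms(1)] p_def l_def poly_prod by (simp add: mult.commute)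
  ultimately show ?case using deg by (intro exI[of _ p] exI[of _ "\<Prod>i\<in>R. a i j"]) auto
next
  case (Cons k J)
  define d where "d = card R - length (k # J)"
  have "\<exists>p c. (\<forall>t. poly p t = mixed_deriv a n J (R - {i}) (z(j := t))) \<and>
    degree p \<le> d \<and> 0 < c \<and> coeff p d = complex_of_real c" if "i \<in> R" for i
    using Cons(1)[of "R - {i}"] Cons(2,3) that by (simp add: d_def del: fun_upd_apply)
  then obtain p c where pc: "\<And>i t. i \<in> R \<Longrightarrow> poly (p i) t = mixed_deriv a n J (R - {i}) (z(j := t))"
    "\<And>i. i \<in> R \<Longrightarrow> degree (p i) \<le> d" "\<And>i. i \<in> R \<Longrightarrow> 0 < c i"
    "\<And>i. i \<in> R \<Longrightarrow> coeff (p i) d = complex_of_real (c i)" by metis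
  define q where "q = (\<Sum>i\<in>R. smult (of_real (a i k)) (p i))"
  have "R \<noteq> {}" using Cons.prems(2) by auto
  then have "(\<Sum>i\<in>R. a i k * c i) > 0" using Cons(2) pc(3) assms(2) by (intro sum_pos) auto
  moreover have "coeff q d = complex_of_real (\<Sum>i\<in>R. a i k * c i)"
    unfolding q_def by (simp add: coeff_sum pc)
  moreover have "degree q \<le> d" unfolding q_def
    by (intro degree_sum_le order.trans[OF degree_smult_le] Cons pc)
  moreover have "poly q t = mixed_deriv a n (k # J) R (z(j := t))" for t
    unfolding q_def by (simp add: poly_sum pc)
  ultimately show ?case unfolding d_def[symmetric] by blast
qed

lemma mixed_deriv_cnj: "mixed_deriv a n J R (\<lambda>j. cnj (z j)) = cnj (mixed_deriv a n J R z)"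
  by (induction J arbitrary: R) simp_all

lemma mixed_deriv_of_real:
  "mixed_deriv a n J R (\<lambda>j. of_real (z j)) = (of_real (mixed_deriv a n J R z) :: 'a::real_normed_field)"
  by (induction J arbitrary: R) simp_all

lemma weighted_sum_pos:
  fixes w z :: "nat \<Rightarrow> real"
  assumes "\<And>k. 0 < w k" "\<And>k. 0 \<le> z k" "k < n" "0 < z k"
  shows "0 < (\<Sum>j<n. w j * z j)"
proof (rule sum_pos2)
  show "0 < w k * z k" using assms by (intro mult_pos_pos)
  show "0 \<le> w j * z j" for j using less_imp_le[OF assms(1)] assms(2) by (intro mult_nonneg_nonneg)
qed (use assms(3) in auto)

lemma mixed_deriv_pos:
  fixes z :: "nat \<Rightarrow> real"
  assumes a: "\<And>i k. 0 < a i k" and z: "\<And>k. 0 \<le> z k" "k < n" "0 < z k"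
    and R: "finite R" "length J \<le> card R"
  shows "0 < mixed_deriv a n J R z"
  using R
proof (induction J arbitrary: R)
  case Nil
  have "0 < (\<Sum>j<n. a i j * z j)" for i
    by (rule weighted_sum_pos[where k = k and w = "a i" and z = z]) (use a z in auto)
  then show ?case by (simp add: prod_pos)
next
  case (Cons j J)
  have "R \<noteq> {}" using Cons.prems(2) by auto
  moreover have "0 < mixed_deriv a n J (R - {i}) z" if "i \<in> R" for i
    by (rule Cons.IH) (use Cons.prems that in auto)
  ultimately show ?case using Cons(2) unfolding mixed_deriv.simps of_real_eq_id id_apply
    by (intro sum_pos mult_pos_pos a)
qed

text \<open>The Gauss--Lucas argument shows that differentiation preserves this form of stability.\<close>

lemma mixed_deriv_stable:
  fixes z :: "nat \<Rightarrow> complex"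
  assumes "\<And>i k. 0 < a i k" "finite R" "length J \<le> card R" "set J \<subseteq> {..<n}"
    and "\<And>k. 0 \<le> Im (z k)" and "k < n" "0 < Im (z k)"
  shows "mixed_deriv a n J R z \<noteq> 0"
  using assms(3-)
proof (induction J arbitrary: z k rule: rev_induct)
  case Nil
  have "(\<Sum>j<n. of_real (a i j) * z j) \<noteq> 0" for i
  proof -
    have "0 < (\<Sum>j<n. a i j * Im (z j))"
      by (rule weighted_sum_pos[where k = k and w = "a i"]) (use assms(1) Nil in auto)
    also have "\<dots> = Im (\<Sum>j<n. of_real (a i j) * z j)" by simp
    finally show ?thesis by (metis less_irrefl zero_complex.sel(2))
  qed
  then show ?case using assms(2) by simp
next
  case (snoc j J)
  have j: "j < n" using snoc by simp
  obtain p c where p: "\<And>t. poly p t = mixed_deriv a n J R (z(j := t))"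
    "0 < c" "coeff p (card R - length J) = complex_of_real c"
    using mixed_deriv_univariate[where z = z and J = J, OF j assms(1,2)] snoc(2) by fastforce
  have deg: "0 < degree p" using p(2,3) snoc(2) le_degree[of p "card R - length J"] by auto
  \<comment> \<open>A root at or above \<open>z j\<close> could replace \<open>z j\<close> without
    leaving the closed upper half-plane, and coordinate k would keep positive imaginary part,
    contradicting stability for J.\<close>
  have "Im w < Im (z j)" if "poly p w = 0" for w
  proof (rule ccontr)
    assume w: "\<not> Im w < Im (z j)"
    have "mixed_deriv a n J R (z(j := w)) \<noteq> 0"
      by (rule snoc.IH[of _ k]) (use snoc.prems w order.trans in \<open>auto simp: not_less\<close>)
    then show False using that p(1) by simp
  qed
  then have "poly (pderiv p) (z j) \<noteq> 0" by (intro pderiv_nonzero_above_roots deg)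
  moreover have "poly (pderiv p) (z j) = mixed_deriv a n (J @ [j]) R (z(j := z j))"
    by (rule DERIV_unique[OF poly_DERIV]) (unfold p(1), rule mixed_deriv_has_derivative[OF j])
  ultimately show ?case by simp
qed

text \<open>Start of the capacity induction. Concavity of ln compares every row with a weighted mean
  of the \<open>ln (x k)\<close>, and the column sums collect the weights of each
  \<open>ln (x k)\<close> to 1.\<close>

lemma linear_forms_ge_prod:
  fixes x :: "nat \<Rightarrow> real"
  assumes "\<And>i k. 0 < a i k" "\<And>i. i < n \<Longrightarrow> (\<Sum>k<n. a i k) = 1" "\<And>k. k < n \<Longrightarrow> (\<Sum>i<n. a i k) = 1"
    and "\<And>k. k < n \<Longrightarrow> 0 < x k" "0 < n"
  shows "(\<Prod>k<n. x k) \<le> (\<Prod>i<n. \<Sum>k<n. a i k * x k)"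
proof -
  have pos: "0 < (\<Sum>k<n. a i k * x k)" for i
    using assms by (intro sum_pos mult_pos_pos) auto
  have "ln (\<Prod>k<n. x k) = (\<Sum>k<n. ln (x k))" using assms(4) by (subst ln_prod) fastforce+
  also have "\<dots> = (\<Sum>k<n. (\<Sum>i<n. a i k) * ln (x k))" using assms(3) by (intro sum.cong) auto
  also have "\<dots> = (\<Sum>i<n. \<Sum>k<n. a i k * ln (x k))"
    unfolding sum_distrib_right by (rule sum.swap)
  also have "\<dots> \<le> (\<Sum>i<n. ln (\<Sum>k<n. a i k *\<^sub>R x k))"
    using assms less_imp_le[OF assms(1)] by (intro sum_mono concave_on_sum[OF _ _ ln_concave]) auto
  also have "\<dots> = ln (\<Prod>i<n. \<Sum>k<n. a i k * x k)" using pos by (subst ln_prod) (auto simp: less_imp_neq[symmetric])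
  finally show ?thesis using pos assms(4) by (subst (asm) ln_le_cancel_iff) (auto intro!: prod_pos)
qed

text \<open>As a polynomial in \<open>x j\<close> the mixed derivative has only negative real roots:
  stability excludes the upper half-plane, conjugation the lower one, and positivity the ray from 0
  on. The other variable \<open>x k\<close> keeps the value at \<open>x j = 0\<close>
  positive.\<close>

lemma mixed_deriv_growth:
  fixes x :: "nat \<Rightarrow> real"
  assumes a: "\<And>i k. 0 < a i k" and R: "finite R" "length J < card R" and J: "set J \<subseteq> {..<n}" "j < n"
    and x: "\<And>k. 0 \<le> x k" "k < n" "k \<noteq> j" "0 < x k"
  shows "\<exists>\<sigma>. mixed_deriv a n (J @ [j]) R (x(j := 0)) = \<sigma> * mixed_deriv a n J R (x(j := 0)) \<and>
    (\<forall>t\<ge>0. mixed_deriv a n J R (x(j := t)) \<le> mixed_deriv a n J R (x(j := 0)) * exp (\<sigma> * t))"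
proof -
  define z where "z k = complex_of_real (x k)" for k
  obtain p c where p: "\<And>t. poly p t = mixed_deriv a n J R (z(j := t))"
    "0 < c" "coeff p (card R - length J) = complex_of_real c"
    using mixed_deriv_univariate[where z = z and J = J, OF J(2) a R(1)] R(2) by fastforce
  have zr: "z(j := complex_of_real t) = (\<lambda>k. complex_of_real ((x(j := t)) k))" for t
    by (auto simp: z_def)
  have pr: "poly p (complex_of_real t) = complex_of_real (mixed_deriv a n J R (x(j := t)))" for t
    unfolding p(1) zr by (rule mixed_deriv_of_real)
  have pos: "0 < mixed_deriv a n J R (x(j := t))" if "t \<ge> 0" for t
    by (rule mixed_deriv_pos[where k = k]) (use a R x that in auto)
  have upper: "poly p w \<noteq> 0" if "0 < Im w" for w
    unfolding p(1) by (rule mixed_deriv_stable[where k = j]) (use a R J that in \<open>auto simp: z_def\<close>)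
  have "Im w = 0 \<and> Re w < 0" if w: "poly p w = 0" for w
  proof -
    have "cnj \<circ> z(j := w) = z(j := cnj w)" by (auto simp: z_def)
    then have "poly p (cnj w) = cnj (poly p w)"
      unfolding p(1) mixed_deriv_cnj[symmetric] by (simp add: comp_def)
    then have "\<not> 0 < Im w" "\<not> 0 < Im (cnj w)" using upper w by auto
    then have "Im w = 0" by simp
    moreover from this have "w = complex_of_real (Re w)" by (simp add: complex_eq_iff)
    then have "mixed_deriv a n J R (x(j := Re w)) = 0" using w pr[of "Re w"] by simp
    ultimately show ?thesis using pos[of "Re w"] by fastforce
  qed
  moreover have "p \<noteq> 0" using p(2,3) by auto
  ultimately obtain \<sigma> where \<sigma>: "poly (pderiv p) 0 = of_real \<sigma> * poly p 0"
    "\<And>t. t \<ge> 0 \<Longrightarrow> norm (poly p (of_real t)) \<le> norm (poly p 0) * exp (\<sigma> * t)"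
    using negative_roots_growth by blast
  have "poly (pderiv p) 0 = mixed_deriv a n (J @ [j]) R (z(j := 0))"
    by (rule DERIV_unique[OF poly_DERIV]) (unfold p(1), rule mixed_deriv_has_derivative[OF J(2)])
  also have "\<dots> = complex_of_real (mixed_deriv a n (J @ [j]) R (x(j := 0)))"
    using zr[of 0] by (simp only: of_real_0 mixed_deriv_of_real)
  finally have "complex_of_real (mixed_deriv a n (J @ [j]) R (x(j := 0))) =
    complex_of_real (\<sigma> * mixed_deriv a n J R (x(j := 0)))"
    using \<sigma>(1) pr[of 0] by simp
  then have "mixed_deriv a n (J @ [j]) R (x(j := 0)) = \<sigma> * mixed_deriv a n J R (x(j := 0))"
    by (simp only: of_real_eq_iff)
  moreover have "mixed_deriv a n J R (x(j := t)) \<le> mixed_deriv a n J R (x(j := 0)) * exp (\<sigma> * t)"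
    if "t \<ge> 0" for t
    using \<sigma>(2)[OF that] pr[of t] pr[of 0] pos[OF that] pos[of 0] by simp
  ultimately show ?thesis by blast
qed

text \<open>Gurvits' capacity argument: eliminating one variable loses a factor of at most \<open>exp 1\<close>,
  since \<open>R t / t \<le> exp 1 * R' 0\<close> at \<open>t = R 0 / R' 0\<close>.\<close>

lemma mixed_deriv_capacity:
  fixes x :: "nat \<Rightarrow> real"
  assumes a: "\<And>i k. 0 < a i k" "\<And>i. i < n \<Longrightarrow> (\<Sum>k<n. a i k) = 1" "\<And>k. k < n \<Longrightarrow> (\<Sum>i<n. a i k) = 1"
    and "distinct J" "set J \<subseteq> {..<n}" "length J < n"
    and "\<And>k. k \<in> set J \<Longrightarrow> x k = 0" "\<And>k. k \<notin> set J \<Longrightarrow> 0 < x k"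
  shows "exp (- real (length J)) * (\<Prod>k\<in>{..<n} - set J. x k) \<le> mixed_deriv a n J {..<n} x"
  using assms(4-)
proof (induction J arbitrary: x rule: rev_induct)
  case Nil
  then show ?case using linear_forms_ge_prod[where a = a and n = n and x = x] a by simp
next
  case (snoc j J)
  \<comment> \<open>One more variable must stay outside the list to keep all values positive; hence
    the last variable is treated separately later.\<close>
  have "card (set (J @ [j])) < card {..<n}" using snoc.prems distinct_card by fastforce
  then obtain k where k: "k < n" "k \<notin> set (J @ [j])" 
    by (metis card_mono finite_set lessThan_iff not_le subsetI)
  have x0: "x(j := 0) = x" using snoc.prems(4)[of j] by auto
  have nonneg: "0 \<le> x i" for i using snoc.prems(4,5)[of i] by (cases "i \<in> set (J @ [j])") auto
  obtain \<sigma> where \<sigma>: "mixed_deriv a n (J @ [j]) {..<n} x = \<sigma> * mixed_deriv a n J {..<n} x"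
    "\<And>t. t \<ge> 0 \<Longrightarrow> mixed_deriv a n J {..<n} (x(j := t)) \<le> mixed_deriv a n J {..<n} x * exp (\<sigma> * t)"
    using mixed_deriv_growth[where a = a and n = n and R = "{..<n}" and J = J and j = j and k = k and x = x]
      a(1) snoc.prems k nonneg
    by (auto simp: x0)
  have "0 < mixed_deriv a n J {..<n} x" "0 < mixed_deriv a n (J @ [j]) {..<n} x"
    by (rule mixed_deriv_pos[where k = k]; use a snoc.prems k nonneg in auto)+
  then have pos: "0 < \<sigma>" unfolding \<sigma>(1) by (simp add: zero_less_mult_iff)
  define P where "P = (\<Prod>i\<in>{..<n} - set (J @ [j]). x i)"
  have "exp (- real (length J)) * (\<Prod>i\<in>{..<n} - set J. (x(j := 1 / \<sigma>)) i)
    \<le> mixed_deriv a n J {..<n} (x(j := 1 / \<sigma>))"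
    by (rule snoc.IH) (use snoc.prems pos in auto)
  also have "\<dots> \<le> mixed_deriv a n J {..<n} x * exp 1" using \<sigma>(2)[of "1 / \<sigma>"] pos by simp
  also have "(\<Prod>i\<in>{..<n} - set J. (x(j := 1 / \<sigma>)) i) = 1 / \<sigma> * P"
  proof -
    have "{..<n} - set J - {j} = {..<n} - set (J @ [j])" by auto
    then show ?thesis unfolding P_def using snoc.prems
      by (subst prod.remove[of _ j]) (auto intro!: prod.cong)
  qed
  finally have "exp (- real (length J)) * P / exp 1 \<le> \<sigma> * mixed_deriv a n J {..<n} x"
    using pos by (simp add: field_simps)
  then show ?case unfolding \<sigma>(1) P_def[symmetric] by (simp add: exp_diff exp_minus field_simps exp_add)
qed

section \<open>Permanents of doubly stochastic matrices, and matchings\<close>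

lemma mixed_deriv_last:
  assumes "finite R" "card R = Suc (length J)" "j < n"
  shows "mixed_deriv a n (J @ [j]) R z = mixed_deriv a n J R ((\<lambda>_. 0)(j := 1 :: 'a::real_normed_field))"
  using assms
proof (induction J arbitrary: R)
  case Nil
  then obtain i where "R = {i}" using card_1_singletonE by auto
  then show ?case using assms(3) linear_form_upd[of j n a i "\<lambda>_. 0 :: 'a" 1] by simp
next
  case (Cons k J)
  then show ?case by (simp cong: sum.cong)
qed

text \<open>After n differentiations no linear form is left, so the value is the same at every point
  and \<open>\<lambda>_. 0\<close> is a placeholder.\<close>

definition permanent :: "nat \<Rightarrow> (nat \<Rightarrow> nat \<Rightarrow> real) \<Rightarrow> real" where
  "permanent n a = mixed_deriv a n [0..<n] {..<n} (\<lambda>_. 0)"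

lemma permanent_ge_positive:
  assumes "\<And>i k. 0 < a i k" "\<And>i. i < n \<Longrightarrow> (\<Sum>k<n. a i k) = 1" "\<And>k. k < n \<Longrightarrow> (\<Sum>i<n. a i k) = 1"
  shows "exp (- real n) \<le> permanent n a"
proof (cases n)
  case (Suc m)
  \<comment> \<open>Only variable m survives the first m differentiations; the value 1 beyond it
    serves the positivity hypothesis for all indices outside the list.\<close>
  define x where "x = (\<lambda>k. if k < m then 0 else 1 :: real)"
  have "exp (- real (length [0..<m])) * (\<Prod>k\<in>{..<n} - set [0..<m]. x k) \<le> mixed_deriv a n [0..<m] {..<n} x"
    by (rule mixed_deriv_capacity) (use assms Suc in \<open>auto simp: x_def\<close>)
  moreover have "{..<n} - set [0..<m] = {m}" using Suc by auto
  ultimately have "exp (- real m) \<le> mixed_deriv a n [0..<m] {..<n} x" by (simp add: x_def)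
  also have "mixed_deriv a n [0..<m] {..<n} x = mixed_deriv a n [0..<m] {..<n} ((\<lambda>_. 0)(m := 1))"
  proof -
    have "mixed_deriv a n J R x = mixed_deriv a n J R ((\<lambda>_. 0)(m := 1))" for J R
      by (induction J arbitrary: R) (auto simp: x_def Suc intro!: prod.cong sum.cong)
    then show ?thesis .
  qed
  \<comment> \<open>What is left is linear in the last variable, so its derivative equals its value
    at the unit vector.\<close>
  also have "\<dots> = permanent n a"
    unfolding permanent_def by (subst mixed_deriv_last[symmetric]) (use Suc in auto)
  finally have "exp (- real m) \<le> permanent n a" .
  then show ?thesis using Suc by (smt (verit) exp_le_cancel_iff of_nat_Suc)
qed (simp add: permanent_def)

text \<open>Stability needs positive entries. Mixing the matrix with the constant matrix
  \<open>1 / n\<close> keeps row and column sums 1, and the permanent is continuous in the mixing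
  parameter \<epsilon>.\<close>

lemma permanent_ge:
  assumes "\<And>i k. 0 \<le> a i k" "\<And>i. i < n \<Longrightarrow> (\<Sum>k<n. a i k) = 1" "\<And>k. k < n \<Longrightarrow> (\<Sum>i<n. a i k) = 1"
  shows "exp (- real n) \<le> permanent n a"
proof (cases "n = 0")
  case False
  define b where "b \<epsilon> i k = (1 - \<epsilon>) * a i k + \<epsilon> / real n" for \<epsilon> i k
  have "continuous_on UNIV (\<lambda>\<epsilon>. mixed_deriv (b \<epsilon>) n J R (\<lambda>_. 0 :: real))" for J R
    unfolding b_def using False by (induction J arbitrary: R) (auto intro!: continuous_intros)
  then have "isCont (\<lambda>\<epsilon>. permanent n (b \<epsilon>)) 0"
    unfolding permanent_def using continuous_on_eq_continuous_at by blast
  then have "((\<lambda>\<epsilon>. permanent n (b \<epsilon>)) \<longlongrightarrow> permanent n (b 0)) (at_right 0)"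
    unfolding isCont_def by (rule filterlim_at_split[THEN iffD1, THEN conjunct2])
  moreover have "b 0 = a" by (intro ext) (simp add: b_def)
  moreover have "eventually (\<lambda>\<epsilon>. exp (- real n) \<le> permanent n (b \<epsilon>)) (at_right 0)"
  proof -
    have "exp (- real n) \<le> permanent n (b \<epsilon>)" if "0 < \<epsilon>" "\<epsilon> < 1" for \<epsilon>
    proof (rule permanent_ge_positive)
      show "0 < b \<epsilon> i k" for i k unfolding b_def using that assms(1) False
        by (intro add_nonneg_pos mult_nonneg_nonneg divide_pos_pos) auto
      show "(\<Sum>k<n. b \<epsilon> i k) = 1" if "i < n" for i
        using assms(2)[OF that] False unfolding b_def by (simp add: sum.distrib flip: sum_distrib_left)
      show "(\<Sum>i<n. b \<epsilon> i k) = 1" if "k < n" for k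
        using assms(3)[OF that] False unfolding b_def by (simp add: sum.distrib flip: sum_distrib_left)
    qed
    then show ?thesis unfolding eventually_at_right_field by (intro exI[of _ 1]) auto
  qed
  ultimately show ?thesis by (intro tendsto_lowerbound[of _ _ "at_right 0"]) auto
qed (simp add: permanent_def)

lemma permanent_scale: "permanent n (\<lambda>i k. c * a i k) = c ^ n * permanent n a"
proof -
  have "mixed_deriv (\<lambda>i k. c * a i k) n J R z = c ^ length J * mixed_deriv a n J R z"
    if "finite R" "card R = length J" for J R and z :: "nat \<Rightarrow> real"
    using that
  proof (induction J arbitrary: R)
    case (Cons j J)
    then show ?case by (simp add: sum_distrib_left mult_ac cong: sum.cong)
  qed simp
  then show ?thesis by (simp add: permanent_def)
qed

lemma permanent_regular_ge:
  assumes "\<And>i k. 0 \<le> a i k" "\<And>i. i < n \<Longrightarrow> (\<Sum>k<n. a i k) = d" "\<And>k. k < n \<Longrightarrow> (\<Sum>i<n. a i k) = d" "0 < d"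
  shows "(d / exp 1) ^ n \<le> permanent n a"
proof -
  have "exp (- real n) \<le> permanent n (\<lambda>i k. 1 / d * a i k)"
    by (rule permanent_ge) (use assms in \<open>auto simp flip: sum_divide_distrib\<close>)
  also have "\<dots> = permanent n a / d ^ n" unfolding permanent_scale by (simp add: field_simps)
  finally show ?thesis using assms(4) by (simp add: field_simps exp_minus exp_of_nat_mult[of n 1, simplified])
qed

text \<open>Choosing the partner i of the first index leaves \<open>R - {i}\<close> for the others,
  which is the recursion of \<open>mixed_deriv\<close> for a 0/1 matrix.\<close>

lemma card_matchings:
  assumes "finite R" "card R = length J"
  shows "real (card {xs. length xs = length J \<and> distinct xs \<and> set xs \<subseteq> R \<and> list_all2 P xs J}) =
    mixed_deriv (\<lambda>i j. of_bool (P i j)) n J R z"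
  using assms
proof (induction J arbitrary: R)
  case Nil
  then have "{xs. length xs = length [] \<and> distinct xs \<and> set xs \<subseteq> R \<and> list_all2 P xs []} = {[]}" by auto
  with Nil show ?case by simp
next
  case (Cons j J)
  let ?M = "\<lambda>J R. {xs. length xs = length J \<and> distinct xs \<and> set xs \<subseteq> R \<and> list_all2 P xs J}"
  have "finite (?M J R)" if "finite R" for J R
    by (rule finite_subset[OF _ finite_lists_length_eq[OF that, of "length J"]]) auto
  note fin = this
  have "?M (j # J) R = (\<Union>i\<in>{i\<in>R. P i j}. (#) i ` ?M J (R - {i}))"
    by (fastforce simp: length_Suc_conv image_iff)
  also have "card \<dots> = (\<Sum>i\<in>{i\<in>R. P i j}. card ((#) i ` ?M J (R - {i})))"
    by (rule card_UN_disjoint) (use Cons fin in auto)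
  also have "\<dots> = (\<Sum>i\<in>{i\<in>R. P i j}. card (?M J (R - {i})))"
    by (intro sum.cong refl card_image) auto
  finally have "real (card (?M (j # J) R)) = (\<Sum>i\<in>{i\<in>R. P i j}. real (card (?M J (R - {i}))))" by simp
  also have "\<dots> = (\<Sum>i\<in>{i\<in>R. P i j}. mixed_deriv (\<lambda>i j. of_bool (P i j)) n J (R - {i}) z)"
    by (intro sum.cong refl Cons.IH) (use Cons.prems in auto)
  also have "\<dots> = mixed_deriv (\<lambda>i j. of_bool (P i j)) n (j # J) R z"
    unfolding sum.inter_filter[OF Cons.prems(1)] mixed_deriv.simps by (rule sum.cong) simp_all
  finally show ?case .
qed

section \<open>Counting Latin squares\<close>

lemma ln_fact_lower: "real n * ln (real n) - real n \<le> ln (fact n)"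
proof (induction n)
  case (Suc n)
  show ?case
  proof (cases "n = 0")
    case False
    have "ln (1 + 1 / real n) \<le> 1 / real n" by (rule ln_add_one_self_le_self) simp
    moreover have "1 + 1 / real n = real (Suc n) / real n" using False by (simp add: field_simps)
    ultimately have "real n * (ln (real (Suc n)) - ln (real n)) \<le> 1"
      using False by (simp add: ln_div field_simps)
    moreover have "ln (fact (Suc n) :: real) = ln (real (Suc n)) + ln (fact n)"
      unfolding fact_Suc of_nat_mult by (subst ln_mult) auto
    ultimately show ?thesis using Suc by (simp add: algebra_simps)
  qed simp
qed simp

lemma ln_fact_upper: "1 \<le> n \<Longrightarrow> ln (fact n) \<le> real n * ln (real n) - real n + ln (real n) + 1"
proof (induction n rule: dec_induct)
  case (step n)
  have "ln (real n / real (Suc n)) \<le> real n / real (Suc n) - 1"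
    using step by (intro ln_le_minus_one) simp
  also have "\<dots> = - 1 / real (Suc n)" by (simp add: field_simps)
  finally have "1 \<le> real (Suc n) * (ln (real (Suc n)) - ln (real n))"
    using step by (simp add: ln_div field_simps)
  moreover have "ln (fact (Suc n) :: real) = ln (real (Suc n)) + ln (fact n)"
    unfolding fact_Suc of_nat_mult by (subst ln_mult) auto
  ultimately show ?case using step by (simp add: algebra_simps)
qed simp

text \<open>Rows are lists with entries and positions counted from 0, so that adding a row is
  appending a list and the columns match the index list \<open>[0..<n]\<close> of the
  permanent.\<close>

definition latin_rectangles :: "nat \<Rightarrow> nat \<Rightarrow> nat list list set" where
  "latin_rectangles n k = {rs. length rs = k \<and>
     (\<forall>i<k. length (rs ! i) = n \<and> distinct (rs ! i) \<and> set (rs ! i) \<subseteq> {..<n}) \<and>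
     (\<forall>i<k. \<forall>j<k. i \<noteq> j \<longrightarrow> (\<forall>c<n. rs ! i ! c \<noteq> rs ! j ! c))}"

lemma finite_latin_rectangles: "finite (latin_rectangles n k)"
proof (rule finite_subset)
  show "latin_rectangles n k \<subseteq> {rs. set rs \<subseteq> {xs. set xs \<subseteq> {..<n} \<and> length xs = n} \<and> length rs = k}"
    by (auto simp: latin_rectangles_def set_conv_nth)
  show "finite \<dots>" by (intro finite_lists_length_eq) auto
qed

lemma permutation_list_set:
  assumes "length xs = n" "distinct xs" "set xs \<subseteq> {..<n}"
  shows "set xs = {..<n}"
  using assms by (intro card_subset_eq) (auto simp: distinct_card)

text \<open>A new row is a perfect matching between symbols and columns. The admissible pairs form
  an (n - k)-regular graph: a column has lost k different symbols, and a symbol occurs once in each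
  earlier row, always in a new column.\<close>

lemma card_row_extensions:
  assumes rs: "rs \<in> latin_rectangles n k" and "k < n"
  shows "(real (n - k) / exp 1) ^ n \<le> real (card {xs. rs @ [xs] \<in> latin_rectangles n (Suc k)})"
proof -
  define P where "P s c \<longleftrightarrow> s \<notin> (\<lambda>i. rs ! i ! c) ` {..<k}" for s c
  have len: "length rs = k" and row: "\<And>i. i < k \<Longrightarrow> length (rs ! i) = n" "\<And>i. i < k \<Longrightarrow> distinct (rs ! i)"
    "\<And>i. i < k \<Longrightarrow> set (rs ! i) = {..<n}"
    and ne: "\<And>i j c. i < k \<Longrightarrow> j < k \<Longrightarrow> i \<noteq> j \<Longrightarrow> c < n \<Longrightarrow> rs ! i ! c \<noteq> rs ! j ! c"
    using rs permutation_list_set unfolding latin_rectangles_def by blast+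
  have "{xs. rs @ [xs] \<in> latin_rectangles n (Suc k)} =
    {xs. length xs = length [0..<n] \<and> distinct xs \<and> set xs \<subseteq> {..<n} \<and> list_all2 P xs [0..<n]}" (is "?L = ?R")
  proof (intro equalityI subsetI; clarify)
    fix xs assume xs: "rs @ [xs] \<in> latin_rectangles n (Suc k)"
    then have "length ((rs @ [xs]) ! k) = n \<and> distinct ((rs @ [xs]) ! k) \<and> set ((rs @ [xs]) ! k) \<subseteq> {..<n}"
      unfolding latin_rectangles_def by blast
    moreover have "xs ! c \<noteq> rs ! i ! c" if "i < k" "c < n" for i c
    proof -
      have "\<forall>i<Suc k. \<forall>j<Suc k. i \<noteq> j \<longrightarrow> (\<forall>c<n. (rs @ [xs]) ! i ! c \<noteq> (rs @ [xs]) ! j ! c)"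
        using xs unfolding latin_rectangles_def by blast
      from this[rule_format, of i k c] show ?thesis using that len by (auto simp: nth_append)
    qed
    ultimately show "length xs = length [0..<n] \<and> distinct xs \<and> set xs \<subseteq> {..<n} \<and> list_all2 P xs [0..<n]"
      using len by (auto simp: P_def list_all2_conv_all_nth nth_append)
  next
    fix xs assume xs: "length xs = length [0..<n]" "distinct xs" "set xs \<subseteq> {..<n}" "list_all2 P xs [0..<n]"
    have new: "xs ! c \<noteq> rs ! i ! c" if "i < k" "c < n" for i c
      using xs that by (auto simp: P_def list_all2_conv_all_nth)
    show "rs @ [xs] \<in> latin_rectangles n (Suc k)"
      unfolding latin_rectangles_def
    proof (intro CollectI conjI allI impI)
      fix i assume "i < Suc k"
      then show "length ((rs @ [xs]) ! i) = n" "distinct ((rs @ [xs]) ! i)" "set ((rs @ [xs]) ! i) \<subseteq> {..<n}"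
        using len row xs by (auto simp: nth_append less_Suc_eq)
    next
      fix i j c assume "i < Suc k" "j < Suc k" "i \<noteq> j" "c < n"
      then show "(rs @ [xs]) ! i ! c \<noteq> (rs @ [xs]) ! j ! c"
        using len ne new new[symmetric] by (auto simp: nth_append less_Suc_eq)
    qed (simp add: len)
  qed
  then have "real (card {xs. rs @ [xs] \<in> latin_rectangles n (Suc k)}) = permanent n (\<lambda>s c. of_bool (P s c))"
    unfolding permanent_def by (subst card_matchings[symmetric]) auto
  moreover have "(real (n - k) / exp 1) ^ n \<le> permanent n (\<lambda>s c. of_bool (P s c))"
  proof (rule permanent_regular_ge)
    fix s assume s: "s < n"
    have one: "card {c. c < n \<and> rs ! i ! c = s} = 1" if i: "i < k" for i
    proof -
      have "s \<in> set (rs ! i)" using s row(3)[OF i] by blast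
      then obtain c where c: "c < n" "rs ! i ! c = s" using row(1)[OF i] by (metis in_set_conv_nth)
      then have "{c. c < n \<and> rs ! i ! c = s} = {c}" using row(1,2)[OF i] by (auto simp: nth_eq_iff_index_eq)
      then show ?thesis by simp
    qed
    have "(\<Sum>c<n. of_bool (P s c) :: real) = real (card {c\<in>{..<n}. P s c})" by (simp add: Int_def)
    also have "{c\<in>{..<n}. P s c} = {..<n} - (\<Union>i<k. {c. c < n \<and> rs ! i ! c = s})" by (auto simp: P_def)
    also have "card \<dots> = n - card (\<Union>i<k. {c. c < n \<and> rs ! i ! c = s})"
      by (subst card_Diff_subset) auto
    also have "card (\<Union>i<k. {c. c < n \<and> rs ! i ! c = s}) = (\<Sum>i<k. card {c. c < n \<and> rs ! i ! c = s})"
      by (intro card_UN_disjoint) (use ne in auto)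
    also have "\<dots> = k" using one by simp
    finally show "(\<Sum>c<n. of_bool (P s c) :: real) = real (n - k)" .
  next
    fix c assume c: "c < n"
    have "(\<Sum>s<n. of_bool (P s c) :: real) = real (card {s\<in>{..<n}. P s c})" by (simp add: Int_def)
    also have "{s\<in>{..<n}. P s c} = {..<n} - (\<lambda>i. rs ! i ! c) ` {..<k}" by (auto simp: P_def)
    also have "card \<dots> = n - card ((\<lambda>i. rs ! i ! c) ` {..<k})"
      using row c by (subst card_Diff_subset) (auto, metis lessThan_iff nth_mem)
    also have "card ((\<lambda>i. rs ! i ! c) ` {..<k}) = k"
      using ne c by (subst card_image) (auto intro!: inj_onI)
    finally show "(\<Sum>s<n. of_bool (P s c) :: real) = real (n - k)" .
  qed (use assms(2) in auto)
  ultimately show ?thesis by simp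
qed

lemma card_latin_rectangles_ge:
  "k \<le> n \<Longrightarrow> (\<Prod>i<k. (real (n - i) / exp 1) ^ n) \<le> real (card (latin_rectangles n k))"
proof (induction k)
  case 0
  have "latin_rectangles n 0 = {[]}" by (auto simp: latin_rectangles_def)
  then show ?case by simp
next
  case (Suc k)
  define E where "E rs = {xs. rs @ [xs] \<in> latin_rectangles n (Suc k)}" for rs
  let ?f = "\<lambda>(rs, xs). rs @ [xs]"
  have fin: "finite (E rs)" for rs
  proof -
    have "(\<lambda>xs. rs @ [xs]) ` E rs \<subseteq> latin_rectangles n (Suc k)" by (auto simp: E_def)
    then show ?thesis by (rule finite_imageD[OF finite_subset[OF _ finite_latin_rectangles]]) (auto intro: inj_onI)
  qed
  have "(\<Prod>i<Suc k. (real (n - i) / exp 1) ^ n) \<le> real (card (latin_rectangles n k)) * (real (n - k) / exp 1) ^ n"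
    using Suc by (simp add: mult_right_mono)
  also have "\<dots> \<le> (\<Sum>rs\<in>latin_rectangles n k. real (card (E rs)))"
    unfolding E_def using Suc by (subst sum_constant[symmetric]) (intro sum_mono card_row_extensions, auto)
  also have "\<dots> = real (card (SIGMA rs:latin_rectangles n k. E rs))"
    using finite_latin_rectangles fin by (subst card_SigmaI) auto
  also have "\<dots> = real (card (?f ` (SIGMA rs:latin_rectangles n k. E rs)))"
    by (subst card_image) (auto intro!: inj_onI)
  also have "\<dots> \<le> real (card (latin_rectangles n (Suc k)))"
    unfolding of_nat_le_iff by (rule card_mono[OF finite_latin_rectangles]) (auto simp: E_def)
  finally show ?case .
qed

section \<open>Latin squares as hypergraphs\<close>

lemma triple_eq_iff:
  "{Row r, Col c, Sym s} = {Row r', Col c', Sym s'} \<longleftrightarrow> r = r' \<and> c = c' \<and> s = s'"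
  by (auto simp: set_eq_iff)

lemma array_hypergraph_eqD:
  assumes "array_hypergraph n A = array_hypergraph n B" "r \<in> {1..n}" "c \<in> {1..n}"
  shows "A r c = B r c"
proof -
  have "{Row r, Col c, Sym (A r c)} \<in> array_hypergraph n B"
    using assms unfolding array_hypergraph_def by blast
  then show ?thesis by (auto simp: array_hypergraph_def triple_eq_iff)
qed

lemma complete_tripartite_eq:
  "complete_tripartite n = (\<lambda>(r, c, s). {Row r, Col c, Sym s}) ` ({1..n} \<times> {1..n} \<times> {1..n})"
proof (intro equalityI subsetI)
  fix e assume "e \<in> complete_tripartite n"
  then obtain r c s where "e = {Row r, Col c, Sym s}" "r \<in> {1..n}" "c \<in> {1..n}" "s \<in> {1..n}"
    unfolding complete_tripartite_def by blast
  then show "e \<in> (\<lambda>(r, c, s). {Row r, Col c, Sym s}) ` ({1..n} \<times> {1..n} \<times> {1..n})"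
    by (intro image_eqI[of _ _ "(r, c, s)"]) auto
next
  fix e assume "e \<in> (\<lambda>(r, c, s). {Row r, Col c, Sym s}) ` ({1..n} \<times> {1..n} \<times> {1..n})"
  then obtain r c s where "e = {Row r, Col c, Sym s}" "r \<in> {1..n}" "c \<in> {1..n}" "s \<in> {1..n}" by auto
  then show "e \<in> complete_tripartite n" unfolding complete_tripartite_def by blast
qed

lemma finite_complete_tripartite: "finite (complete_tripartite n)"
  unfolding complete_tripartite_eq by simp

lemma array_hypergraph_subset:
  assumes "latin_array n A"
  shows "array_hypergraph n A \<subseteq> complete_tripartite n"
  using assms unfolding latin_array_def array_hypergraph_def complete_tripartite_def bij_betw_def by blast

lemma finite_latin_squares: "finite (latin_squares n)"
  by (rule finite_subset[of _ "Pow (complete_tripartite n)"])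
     (use array_hypergraph_subset in \<open>auto simp: latin_squares_def finite_complete_tripartite\<close>)

lemma card_latin_squares_ge_rectangles: "card (latin_rectangles n n) \<le> card (latin_squares n)"
proof -
  define A where "A rs r c = Suc (rs ! (r - 1) ! (c - 1))" for rs :: "nat list list" and r c
  have "inj_on (\<lambda>rs. array_hypergraph n (A rs)) (latin_rectangles n n)"
  proof (rule inj_onI)
    fix R S assume R: "R \<in> latin_rectangles n n" and S: "S \<in> latin_rectangles n n"
      and eq: "array_hypergraph n (A R) = array_hypergraph n (A S)"
    have len: "length R = n" "length S = n" "\<And>i. i < n \<Longrightarrow> length (R ! i) = n \<and> length (S ! i) = n"
      using R S unfolding latin_rectangles_def by blast+
    have "R ! i ! j = S ! i ! j" if "i < n" "j < n" for i j
      using array_hypergraph_eqD[OF eq, of "Suc i" "Suc j"] that by (simp add: A_def)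
    then show "R = S" using len by (auto intro!: nth_equalityI)
  qed
  moreover have "array_hypergraph n (A R) \<in> latin_squares n" if R: "R \<in> latin_rectangles n n" for R
  proof -
    have row: "\<And>i. i < n \<Longrightarrow> length (R ! i) = n" "\<And>i. i < n \<Longrightarrow> distinct (R ! i)"
      "\<And>i. i < n \<Longrightarrow> set (R ! i) \<subseteq> {..<n}"
      and ne: "\<And>i j c. i < n \<Longrightarrow> j < n \<Longrightarrow> i \<noteq> j \<Longrightarrow> c < n \<Longrightarrow> R ! i ! c \<noteq> R ! j ! c"
      using R unfolding latin_rectangles_def by blast+
    have val: "A R r c \<in> {1..n}" if "r \<in> {1..n}" "c \<in> {1..n}" for r c
    proof -
      have "R ! (r - 1) ! (c - 1) \<in> set (R ! (r - 1))" using that row(1)[of "r - 1"] by (intro nth_mem) auto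
      moreover have "set (R ! (r - 1)) \<subseteq> {..<n}" using that by (intro row(3)) auto
      ultimately show ?thesis unfolding A_def by auto
    qed
    have bij: "bij_betw f {1..n} {1..n}" if "inj_on f {1..n}" "\<And>x. x \<in> {1..n} \<Longrightarrow> f x \<in> {1..n}" for f :: "nat \<Rightarrow> nat"
      using that endo_inj_surj[of "{1..n}" f] unfolding bij_betw_def by blast
    have "latin_array n (A R)"
      unfolding latin_array_def
    proof (intro conjI ballI bij val inj_onI)
      fix r c c' assume "r \<in> {1..n}" "c \<in> {1..n}" "c' \<in> {1..n}" "A R r c = A R r c'"
      moreover from this have "r - 1 < n" "c - 1 < n" "c' - 1 < n" by auto
      ultimately have "c - 1 = c' - 1" using row[of "r - 1"] unfolding A_def
        by (auto simp: nth_eq_iff_index_eq)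
      then show "c = c'" using \<open>c \<in> {1..n}\<close> \<open>c' \<in> {1..n}\<close> by auto
    next
      fix c r r' assume "c \<in> {1..n}" "r \<in> {1..n}" "r' \<in> {1..n}" "A R r c = A R r' c"
      moreover from this have "r - 1 < n" "r' - 1 < n" "c - 1 < n" by auto
      ultimately show "r = r'" using ne[of "r - 1" "r' - 1" "c - 1"] unfolding A_def by force
    qed auto
    then show ?thesis unfolding latin_squares_def by blast
  qed
  ultimately show ?thesis using finite_latin_squares by (intro card_inj_on_le) auto
qed

text \<open>The rows contribute \<open>(fact n / exp n) ^ n\<close> in total. One factor e per cell
  is lost in the permanent bound, the other in \<open>fact n \<ge> (n / e) ^ n\<close>; together
  they give the term \<open>- 2 * n^2\<close>.\<close>

lemma ln_card_latin_squares_ge: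
  assumes "1 \<le> n"
  shows "real n ^ 2 * ln (real n) - 2 * real n ^ 2 \<le> ln (real (card (latin_squares n)))"
    and "0 < card (latin_squares n)"
proof -
  have "(\<Prod>i<n. real (n - i)) = fact n"
    unfolding fact_prod_rev by (simp add: atLeast0LessThan)
  then have eq: "(\<Prod>i<n. (real (n - i) / exp 1) ^ n) = (fact n / exp (real n)) ^ n"
    unfolding power_one_over prod_power_distrib[symmetric] prod_dividef
    by (simp add: exp_of_nat_mult[of n 1, simplified])
  have le: "(fact n / exp (real n)) ^ n \<le> real (card (latin_squares n))"
    using card_latin_rectangles_ge[of n n] card_latin_squares_ge_rectangles[of n] unfolding eq
    by (meson le_refl of_nat_mono order_trans)
  moreover have pos: "(0::real) < (fact n / exp (real n)) ^ n" by simp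
  ultimately have pos': "0 < real (card (latin_squares n))" by linarith
  then show "0 < card (latin_squares n)" by simp
  have "real n * (ln (fact n) - real n) = ln ((fact n / exp (real n)) ^ n)"
    by (simp add: ln_realpow ln_div)
  also have "\<dots> \<le> ln (real (card (latin_squares n)))" using le pos pos' by simp
  finally have "real n * (ln (fact n) - real n) \<le> ln (real (card (latin_squares n)))" .
  moreover have "real n * ((real n * ln (real n) - real n) - real n) \<le> real n * (ln (fact n) - real n)"
    using ln_fact_lower[of n] by (intro mult_left_mono) auto
  ultimately show "real n ^ 2 * ln (real n) - 2 * real n ^ 2 \<le> ln (real (card (latin_squares n)))"
    by (simp add: power2_eq_square algebra_simps)
qed

section \<open>The random greedy process and the random hypergraph\<close>

definition available :: "hypergraph \<Rightarrow> hypergraph \<Rightarrow> hypergraph" where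
  "available E Q = {e \<in> E. e \<notin> Q \<and> (\<forall>f\<in>Q. \<not> conflict e f)}"

text \<open>The probability that the random greedy process, started at \<open>Q\<close>, survives \<open>k\<close> steps and ends in
  \<open>U\<close>; if no edge is available, the division by zero correctly yields \<open>0\<close>.\<close>

primrec greedy_prob :: "hypergraph \<Rightarrow> hypergraph set \<Rightarrow> nat \<Rightarrow> hypergraph \<Rightarrow> real" where
  "greedy_prob E U 0 Q = of_bool (Q \<in> U)"
| "greedy_prob E U (Suc k) Q =
     (\<Sum>e\<in>available E Q. greedy_prob E U k (insert e Q)) / real (card (available E Q))"

text \<open>Expected value of f after j further elements of E have been added to G in random order.
  The recursion has the same shape as \<open>greedy_prob\<close>, so both can be compared step by
  step.\<close>

primrec expose :: "'a set \<Rightarrow> ('a set \<Rightarrow> real) \<Rightarrow> nat \<Rightarrow> 'a set \<Rightarrow> real" where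
  "expose E f 0 G = f G"
| "expose E f (Suc j) G = (\<Sum>e\<in>E - G. expose E f j (insert e G)) / real (card (E - G))"

text \<open>All supersets with the right number of new elements are equally likely: in the induction
  step a set S arises once from each of its \<open>Suc j\<close> elements outside G.\<close>

lemma expose_eq:
  assumes "finite E" "G \<subseteq> E" "card G + j \<le> card E"
  shows "expose E f j G * real (card (E - G) choose j) =
    (\<Sum>S | G \<subseteq> S \<and> S \<subseteq> E \<and> card S = card G + j. f S)"
  using assms(2,3)
proof (induction j arbitrary: G)
  case 0
  have "S = G" if "G \<subseteq> S" "S \<subseteq> E" "card S = card G" for S
    using card_subset_eq[of S G] that assms(1) finite_subset by metis
  then have "{S. G \<subseteq> S \<and> S \<subseteq> E \<and> card S = card G + 0} = {G}" using 0 by auto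
  then show ?case by simp
next
  case (Suc j)
  define d where "d = card (E - G)"
  have fG: "finite G" using Suc.prems assms(1) finite_subset by blast
  have d: "d = card E - card G" unfolding d_def using Suc.prems fG by (simp add: card_Diff_subset)
  have fin: "finite {S. X \<subseteq> S \<and> S \<subseteq> E \<and> card S = k}" for X k
    by (rule finite_subset[of _ "Pow E"]) (use assms(1) in auto)
  define F where "F = {S. G \<subseteq> S \<and> S \<subseteq> E \<and> card S = card G + Suc j}"
  have step: "expose E f j (insert e G) * real (d - 1 choose j) = (\<Sum>S | S \<in> F \<and> e \<in> S. f S)"
    if e: "e \<in> E - G" for e
  proof -
    have "card (insert e G) = Suc (card G)" using e fG by simp
    moreover have "card (E - insert e G) = d - 1"
      unfolding d_def using e assms(1) by (metis Diff_insert card_Diff_singleton)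
    moreover have "{S. insert e G \<subseteq> S \<and> S \<subseteq> E \<and> card S = Suc (card G) + j} = {S. S \<in> F \<and> e \<in> S}"
      by (auto simp: F_def)
    ultimately show ?thesis using Suc.IH[of "insert e G"] Suc.prems e by simp
  qed
  have "d > 0" using d Suc.prems by simp
  then have "expose E f (Suc j) G * real (d choose Suc j) =
      (\<Sum>e\<in>E - G. expose E f j (insert e G)) * (real (d choose Suc j) / real d)"
    by (simp add: d_def)
  also have "real (d choose Suc j) / real d = real (d - 1 choose j) / real (Suc j)"
  proof -
    have "Suc j * (d choose Suc j) = d * (d - 1 choose j)"
      using Suc_times_binomial_eq[of "d - 1" j] \<open>d > 0\<close> by (simp add: mult.commute)
    then have "real (Suc j) * real (d choose Suc j) = real d * real (d - 1 choose j)"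
      by (metis of_nat_mult)
    then show ?thesis using \<open>d > 0\<close> by (simp add: field_simps del: of_nat_Suc)
  qed
  also have "(\<Sum>e\<in>E - G. expose E f j (insert e G)) * (real (d - 1 choose j) / real (Suc j)) =
      (\<Sum>e\<in>E - G. \<Sum>S | S \<in> F \<and> e \<in> S. f S) / real (Suc j)"
    by (simp add: step sum_distrib_right sum_divide_distrib del: of_nat_Suc flip: step)
  also have "(\<Sum>e\<in>E - G. \<Sum>S | S \<in> F \<and> e \<in> S. f S) = (\<Sum>S\<in>F. \<Sum>e | e \<in> E - G \<and> e \<in> S. f S)"
    by (rule sum.swap_restrict) (use assms(1) fin in \<open>auto simp: F_def\<close>)
  also have "\<dots> = (\<Sum>S\<in>F. real (Suc j) * f S)"
  proof (rule sum.cong[OF refl])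
    fix S assume S: "S \<in> F"
    then have "{e. e \<in> E - G \<and> e \<in> S} = S - G" by (auto simp: F_def)
    moreover have "card (S - G) = Suc j" using S fG by (simp add: F_def card_Diff_subset)
    ultimately show "(\<Sum>e | e \<in> E - G \<and> e \<in> S. f S) = real (Suc j) * f S" by simp
  qed
  also have "\<dots> / real (Suc j) = (\<Sum>S\<in>F. f S)" by (simp del: of_nat_Suc flip: sum_distrib_left)
  finally show ?case unfolding F_def d_def .
qed

section \<open>The random hypergraph as a binomial mixture of exposures\<close>

lemma pmf_random_hypergraph:
  assumes "G \<subseteq> complete_tripartite n" "0 \<le> p" "p \<le> 1"
  shows "pmf (random_hypergraph n p) G =
    p ^ card G * (1 - p) ^ (card (complete_tripartite n) - card G)"
proof -
  let ?E = "complete_tripartite n"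
  have fin: "finite ?E" "finite G" using finite_complete_tripartite assms(1) finite_subset by blast+
  have "(\<lambda>X. {e \<in> ?E. X e}) -` {G} = Pi ?E (\<lambda>e. {e \<in> G})"
    using assms(1) by (auto simp: Pi_def)
  then have "pmf (random_hypergraph n p) G =
      measure_pmf.prob (Pi_pmf ?E False (\<lambda>_. bernoulli_pmf p)) (Pi ?E (\<lambda>e. {e \<in> G}))"
    unfolding random_hypergraph_def pmf_map by simp
  also have "\<dots> = (\<Prod>e\<in>?E. pmf (bernoulli_pmf p) (e \<in> G))"
    unfolding pmf.rep_eq[symmetric] by (subst measure_Pi_pmf_Pi) (use fin in \<open>auto simp: measure_pmf_single\<close>)
  also have "\<dots> = (\<Prod>e\<in>?E. if e \<in> G then p else 1 - p)"
    using assms by (intro prod.cong) auto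
  also have "\<dots> = (\<Prod>e\<in>G. p) * (\<Prod>e\<in>?E - G. 1 - p)"
    using fin assms(1) by (subst prod.subset_diff[of G]) (auto intro!: arg_cong2[of _ _ _ _ "(*)"] prod.cong)
  also have "\<dots> = p ^ card G * (1 - p) ^ (card ?E - card G)"
    using fin assms(1) by (simp add: card_Diff_subset)
  finally show ?thesis .
qed

text \<open>Given its number j of hyperedges, the random hypergraph is uniform, so it arises by
  exposing j hyperedges in random order.\<close>

lemma prob_random_hypergraph:
  fixes n :: nat
  assumes "0 \<le> p" "p \<le> 1"
  defines "M \<equiv> card (complete_tripartite n)"
  shows "measure_pmf.prob (random_hypergraph n p) {G. P G} =
    (\<Sum>j\<le>M. real (M choose j) * p ^ j * (1 - p) ^ (M - j) *
      expose (complete_tripartite n) (\<lambda>G. of_bool (P G)) j {})"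
proof -
  let ?E = "complete_tripartite n" and ?R = "random_hypergraph n p"
  note fin = finite_complete_tripartite[of n]
  have sub: "set_pmf ?R \<subseteq> Pow ?E" unfolding random_hypergraph_def by auto
  have "measure_pmf.prob ?R {G. P G} = measure_pmf.prob ?R {G \<in> Pow ?E. P G}"
    by (rule measure_prob_cong_0) (use sub in \<open>auto simp: set_pmf_iff\<close>)
  also have "\<dots> = (\<Sum>G\<in>{G \<in> Pow ?E. P G}. pmf ?R G)"
    by (rule measure_measure_pmf_finite) (use fin in simp)
  also have "\<dots> = (\<Sum>G\<in>Pow ?E. of_bool (P G) * pmf ?R G)"
    unfolding sum.inter_filter[OF finite_Pow_iff[THEN iffD2, OF fin]] by (rule sum.cong) simp_all
  also have "\<dots> = (\<Sum>G\<in>Pow ?E. of_bool (P G) * (p ^ card G * (1 - p) ^ (M - card G)))"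
    using assms by (intro sum.cong) (auto simp: pmf_random_hypergraph)
  also have "\<dots> = (\<Sum>j\<le>M. \<Sum>G | G \<in> Pow ?E \<and> card G = j. of_bool (P G) * (p ^ card G * (1 - p) ^ (M - card G)))"
    by (rule sum.group[symmetric]) (use fin in \<open>auto simp: M_def card_mono\<close>)
  also have "\<dots> = (\<Sum>j\<le>M. real (M choose j) * p ^ j * (1 - p) ^ (M - j) * expose ?E (\<lambda>G. of_bool (P G)) j {})"
  proof (rule sum.cong[OF refl])
    fix j assume j: "j \<in> {..M}"
    have "(\<Sum>G | G \<in> Pow ?E \<and> card G = j. of_bool (P G) * (p ^ card G * (1 - p) ^ (M - card G))) =
      (\<Sum>G | G \<in> Pow ?E \<and> card G = j. of_bool (P G)) * (p ^ j * (1 - p) ^ (M - j))"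
      unfolding sum_distrib_right by (intro sum.cong) auto
    also have "(\<Sum>G | G \<in> Pow ?E \<and> card G = j. of_bool (P G)) =
      expose ?E (\<lambda>G. of_bool (P G)) j {} * real (M choose j)"
      using expose_eq[OF fin, of "{}" j "\<lambda>G. of_bool (P G)"] j by (simp add: M_def)
    finally show "(\<Sum>G | G \<in> Pow ?E \<and> card G = j. of_bool (P G) * (p ^ card G * (1 - p) ^ (M - card G))) =
      real (M choose j) * p ^ j * (1 - p) ^ (M - j) * expose ?E (\<lambda>G. of_bool (P G)) j {}"
      by (simp add: mult_ac)
  qed
  finally show ?thesis .
qed

lemma expose_nonneg: "(\<And>G. 0 \<le> f G) \<Longrightarrow> 0 \<le> expose E f j G"
  by (induction j arbitrary: G) (auto intro!: divide_nonneg_nonneg sum_nonneg)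

lemma greedy_prob_nonneg: "0 \<le> greedy_prob E U k Q"
  by (induction k arbitrary: Q) (auto intro!: divide_nonneg_nonneg sum_nonneg)

lemma greedy_prob_le_1: "greedy_prob E U k Q \<le> 1"
proof (induction k arbitrary: Q)
  case (Suc k)
  have "(\<Sum>e\<in>available E Q. greedy_prob E U k (insert e Q)) \<le> (\<Sum>e\<in>available E Q. 1)"
    by (intro sum_mono Suc)
  then show ?case by (cases "card (available E Q) = 0") simp_all
qed simp

lemma greedy_prob_eq_0: "(\<And>P. Q \<subseteq> P \<Longrightarrow> P \<notin> U) \<Longrightarrow> greedy_prob E U k Q = 0"
proof (induction k arbitrary: Q)
  case (Suc k)
  have "greedy_prob E U k (insert e Q) = 0" for e by (rule Suc.IH) (use Suc.prems in blast)
  then show ?case by simp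
qed simp

text \<open>Expose the edges of \<open>G\<close> one by one in random order and let \<open>Q\<close> collect the edges that are
  available at their arrival; then \<open>Q\<close> evolves like the greedy process.\<close>

lemma greedy_prob_le_expose_decreasing:
  assumes E: "finite E" and U: "monotone_decreasing U"
    and "Q \<subseteq> G" "G \<subseteq> E" "delete_conflicts G \<subseteq> Q" "G \<inter> available E Q = {}"
    and "j \<le> k" "card G + j \<le> card E"
  shows "greedy_prob E U k Q \<le> expose E (\<lambda>G. of_bool (delete_conflicts G \<in> U)) j G"
  using assms(3-)
proof (induction j arbitrary: k Q G)
  case 0
  show ?case
  proof (cases "delete_conflicts G \<in> U")
    case False
    \<comment> \<open>Every later greedy state contains Q and with it
      \<open>delete_conflicts G\<close>; since U is decreasing, none of them belongs to U.\<close>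
    then have "greedy_prob E U k Q = 0"
      using U 0 unfolding monotone_decreasing_def by (intro greedy_prob_eq_0) (metis order_trans)
    then show ?thesis by simp
  qed (simp add: greedy_prob_le_1)
next
  case (Suc j)
  obtain l where k: "k = Suc l" using Suc.prems by (cases k) auto
  let ?A = "available E Q" and ?f = "\<lambda>G. of_bool (delete_conflicts G \<in> U) :: real"
  have fin: "finite G" "finite Q" "finite ?A"
    using E Suc.prems(1,2) finite_subset[of _ E] by (auto simp: available_def)
  have A: "?A \<subseteq> E - G" using Suc.prems unfolding available_def by blast
  have card: "card (E - G) > 0" using Suc.prems fin by (simp add: card_Diff_subset)
  have taken: "greedy_prob E U l (insert e Q) \<le> expose E ?f j (insert e G)" if e: "e \<in> ?A" for e
  proof (rule Suc.IH)
    show "delete_conflicts (insert e G) \<subseteq> insert e Q"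
      using Suc.prems(3) unfolding delete_conflicts_def by blast
    show "insert e G \<inter> available E (insert e Q) = {}"
      using Suc.prems(4) unfolding available_def by blast
  qed (use Suc.prems e A k fin in auto)
  have skipped: "greedy_prob E U k Q \<le> expose E ?f j (insert e G)" if e: "e \<in> E - G - ?A" for e
  proof (rule Suc.IH)
    have "e \<notin> Q" using e Suc.prems by blast
    then obtain f where "f \<in> Q" "conflict e f" using e unfolding available_def by blast
    \<comment> \<open>The partner f in Q may lose its place among the conflict-free edges as well,
      which is harmless: Q only has to contain them.\<close>
    then have "e \<notin> delete_conflicts (insert e G)"
      using Suc.prems(1) unfolding delete_conflicts_def by blast
    then show "delete_conflicts (insert e G) \<subseteq> Q"
      using Suc.prems(3) unfolding delete_conflicts_def by blast
  qed (use Suc.prems e fin in auto)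
  have "real (card (E - G)) * greedy_prob E U k Q =
    real (card ?A) * greedy_prob E U k Q + real (card (E - G - ?A)) * greedy_prob E U k Q"
    using A fin E by (simp add: card_Diff_subset card_mono of_nat_diff algebra_simps)
  also have "real (card ?A) * greedy_prob E U k Q = (\<Sum>e\<in>?A. greedy_prob E U l (insert e Q))"
    using fin unfolding k by (cases "?A = {}") auto
  also have "\<dots> + real (card (E - G - ?A)) * greedy_prob E U k Q \<le>
    (\<Sum>e\<in>?A. expose E ?f j (insert e G)) + (\<Sum>e\<in>E - G - ?A. expose E ?f j (insert e G))"
    using skipped by (intro add_mono sum_mono taken) (auto intro!: sum_bounded_below)
  also have "\<dots> = (\<Sum>e\<in>E - G. expose E ?f j (insert e G))"
    using A E by (subst add.commute, subst sum.subset_diff[symmetric]) auto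
  finally show ?case using card by (simp add: field_simps)
qed

text \<open>The error term is a supermartingale bound: each exposed edge is available with probability at
  least \<open>b\<close>, and \<open>exp l\<close> to the number of missing edges decreases on average by the factor \<open>r\<close>.\<close>

lemma greedy_prob_le_expose_increasing:
  assumes U: "monotone_increasing n U" and "E = complete_tripartite n"
    and b: "\<And>Q. Q \<subseteq> E \<Longrightarrow> card Q < m \<Longrightarrow> b * real (card E) \<le> real (card (available E Q))"
    and "0 \<le> b" "b \<le> 1" "0 \<le> l" and r: "r = b * exp (- l) + 1 - b"
    and "Q \<subseteq> G" "G \<subseteq> E" "G \<inter> available E Q = {}"
    and "card Q + k \<le> m" "card G + j \<le> card E"
  shows "greedy_prob E U k Q \<le> expose E (\<lambda>G. of_bool (G \<in> U)) j G + exp (l * real k) * r ^ j"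
  using assms(8-)
proof (induction j arbitrary: k Q G)
  case 0
  show ?case
  proof (cases k)
    case 0
    have "Q \<in> U \<Longrightarrow> G \<in> U" using U \<open>Q \<subseteq> G\<close> \<open>G \<subseteq> E\<close> assms(2) unfolding monotone_increasing_def by blast
    then show ?thesis using 0 by auto
  next
    case (Suc i)
    \<comment> \<open>The exposure is over with edges still missing, and here the error term alone
      is at least 1.\<close>
    have "1 \<le> exp (l * real k)" "0 \<le> (of_bool (G \<in> U) :: real)" using assms(6) by simp_all
    then have "greedy_prob E U k Q \<le> of_bool (G \<in> U) + exp (l * real k)"
      using greedy_prob_le_1[of E U k Q] by linarith
    then show ?thesis by simp
  qed
next
  case (Suc j)
  let ?A = "available E Q" and ?f = "\<lambda>G. of_bool (G \<in> U) :: real"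
  have E: "finite E" using assms(2) finite_complete_tripartite by simp
  have fin: "finite G" "finite Q" "finite ?A"
    using E Suc.prems(1,2) finite_subset[of _ E] by (auto simp: available_def)
  have A: "?A \<subseteq> E - G" using Suc.prems unfolding available_def by blast
  have card: "card (E - G) > 0" using Suc.prems fin by (simp add: card_Diff_subset)
  have "0 \<le> b * exp (- l)" using assms(4) by simp
  then have r0: "0 \<le> r" using assms(5) r by simp
  define F where "F i = exp (l * real i) * r ^ j" for i
  show ?case
  proof (cases k)
    case 0
    have "greedy_prob E U k Q \<le> expose E ?f (Suc j) G"
    proof (cases "Q \<in> U")
      case True
      \<comment> \<open>No edge is missing any more, so every extension of Q inside the complete
        hypergraph lies in U and the exposure succeeds with certainty.\<close>
      have "1 \<le> expose E ?f i H" if "Q \<subseteq> H" "H \<subseteq> E" "card H + i \<le> card E" for i H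
        using that
      proof (induction i arbitrary: H)
        case 0
        then show ?case using U True assms(2) unfolding monotone_increasing_def by auto
      next
        case (Suc i)
        have fH: "finite H" using E Suc.prems finite_subset by blast
        have "(\<Sum>e\<in>E - H. 1) \<le> (\<Sum>e\<in>E - H. expose E ?f i (insert e H))"
          by (intro sum_mono Suc.IH) (use Suc.prems fH in auto)
        moreover have "card (E - H) > 0" using Suc.prems fH by (simp add: card_Diff_subset)
        ultimately show ?case by simp
      qed
      from this[of G "Suc j"] show ?thesis using Suc.prems 0 by simp
    qed (use 0 expose_nonneg[of ?f E "Suc j" G] in simp)
    moreover have "0 \<le> exp (l * real k) * r ^ Suc j" using r0 by simp
    ultimately show ?thesis by linarith
  next
    case k: (Suc i)
    have taken: "greedy_prob E U i (insert e Q) - F i \<le> expose E ?f j (insert e G)" if e: "e \<in> ?A" for e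
    proof -
      have "greedy_prob E U i (insert e Q) \<le> expose E ?f j (insert e G) + exp (l * real i) * r ^ j"
      proof (rule Suc.IH)
        show "insert e G \<inter> available E (insert e Q) = {}"
          using Suc.prems(3) unfolding available_def by blast
        have "e \<notin> Q" using e by (simp add: available_def)
        then show "card (insert e Q) + i \<le> m" using Suc.prems fin k by simp
      qed (use Suc.prems e A k fin in auto)
      then show ?thesis by (simp add: F_def)
    qed
    have skipped: "greedy_prob E U k Q - F k \<le> expose E ?f j (insert e G)" if e: "e \<in> E - G - ?A" for e
    proof -
      have "greedy_prob E U k Q \<le> expose E ?f j (insert e G) + exp (l * real k) * r ^ j"
        by (rule Suc.IH) (use Suc.prems e fin in auto)
      then show ?thesis by (simp add: F_def)
    qed
    define a where "a = real (card ?A)"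
    define d where "d = real (card (E - G))"
    have d: "d > 0" "d \<le> real (card E)" using card E by (auto simp: d_def intro!: card_mono)
    \<comment> \<open>The bound b refers to all of E, but the next edge comes from the smaller set
      \<open>E - G\<close>, which contains every available edge. So its chance \<open>a / d\<close>
      to be available is at least b.\<close>
    have ab: "b * d \<le> a"
    proof -
      have "b * d \<le> b * real (card E)" using d assms(4) by (intro mult_left_mono)
      also have "\<dots> \<le> a" unfolding a_def by (rule b) (use Suc.prems k in auto)
      finally show ?thesis .
    qed
    have ad: "real (card (E - G - ?A)) = d - a"
      using A fin E by (simp add: a_def d_def card_Diff_subset card_mono of_nat_diff)
    have "(d - a) * greedy_prob E U k Q + a * greedy_prob E U k Q - (a * F i + (d - a) * F k) =
      (\<Sum>e\<in>?A. greedy_prob E U i (insert e Q) - F i) + (\<Sum>e\<in>E - G - ?A. greedy_prob E U k Q - F k)"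
      using fin ad unfolding a_def k
      by (cases "?A = {}") (auto simp: sum_subtractf algebra_simps)
    also have "\<dots> \<le> (\<Sum>e\<in>?A. expose E ?f j (insert e G)) + (\<Sum>e\<in>E - G - ?A. expose E ?f j (insert e G))"
      by (intro add_mono sum_mono taken skipped)
    also have "\<dots> = (\<Sum>e\<in>E - G. expose E ?f j (insert e G))"
      using A E by (subst add.commute, subst sum.subset_diff[symmetric]) auto
    finally have "d * greedy_prob E U k Q - (a * F i + (d - a) * F k) \<le> d * expose E ?f (Suc j) G"
      using d by (simp add: d_def algebra_simps)
    \<comment> \<open>As \<open>F i \<le> F k\<close>, lowering the chance \<open>a / d\<close> to b
      only raises the average error; with chance b the average is exactly the error before this
      step, by the choice of r.\<close>
    moreover have "a * F i + (d - a) * F k \<le> d * (exp (l * real k) * r ^ Suc j)"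
    proof -
      have "F i \<le> F k" unfolding F_def k using r0 assms(6) by (intro mult_right_mono) (auto intro!: mult_left_mono)
      then have "b * d * (F k - F i) \<le> a * (F k - F i)" using ab by (intro mult_right_mono) auto
      then have "a * F i + (d - a) * F k \<le> d * (b * F i + (1 - b) * F k)" by (simp add: algebra_simps)
      also have "b * F i + (1 - b) * F k = exp (l * real k) * r ^ Suc j"
      proof -
        have "exp (l * real i) = exp (l * real k) * exp (- l)" unfolding k by (simp add: exp_add[symmetric] algebra_simps)
        then show ?thesis unfolding F_def r by (simp add: algebra_simps)
      qed
      finally show ?thesis .
    qed
    ultimately have "d * greedy_prob E U k Q \<le> d * (expose E ?f (Suc j) G + exp (l * real k) * r ^ Suc j)"
      by (simp add: algebra_simps)
    then show ?thesis using d by simp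
  qed
qed

section \<open>Counting available hyperedges and fixing the parameters\<close>

lemma card_complete_tripartite: "card (complete_tripartite n) = n ^ 3"
proof -
  have "inj_on (\<lambda>(r, c, s). {Row r, Col c, Sym s}) ({1..n} \<times> {1..n} \<times> {1..n})"
    by (rule inj_onI) (auto simp: triple_eq_iff)
  then show ?thesis by (simp add: complete_tripartite_eq card_image card_cartesian_product power3_eq_cube)
qed

lemma conflict_iff:
  "conflict {Row r, Col c, Sym s} {Row r', Col c', Sym s'} \<longleftrightarrow>
    (r, c, s) \<noteq> (r', c', s') \<and> (r = r' \<and> c = c' \<or> r = r' \<and> s = s' \<or> c = c' \<and> s = s')"
proof -
  have "{Row r, Col c, Sym s} \<inter> {Row r', Col c', Sym s'} =
    (if r = r' then {Row r} else {}) \<union> (if c = c' then {Col c} else {}) \<union> (if s = s' then {Sym s} else {})"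
    by auto
  then have "card ({Row r, Col c, Sym s} \<inter> {Row r', Col c', Sym s'}) =
    of_bool (r = r') + of_bool (c = c') + of_bool (s = s')" by (simp split: if_splits)
  then show ?thesis unfolding conflict_def triple_eq_iff by auto
qed

text \<open>An edge of Q excludes at most 3n hyperedges, itself included: two of its three vertices
  stay and the third one varies.\<close>

lemma card_available_ge:
  assumes "Q \<subseteq> complete_tripartite n"
  shows "real n ^ 3 - 3 * real n * real (card Q) \<le> real (card (available (complete_tripartite n) Q))"
proof -
  let ?E = "complete_tripartite n"
  define B where "B q = {e \<in> ?E. e = q \<or> conflict e q}" for q
  have fin: "finite ?E" "finite Q" using assms finite_complete_tripartite finite_subset by blast+
  have B: "card (B q) \<le> 3 * n" if q: "q \<in> ?E" for q
  proof -
    obtain r c s where q: "q = {Row r, Col c, Sym s}" "r \<in> {1..n}" "c \<in> {1..n}" "s \<in> {1..n}"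
      using q unfolding complete_tripartite_def by blast
    let ?X = "\<lambda>x. {Row x, Col c, Sym s}" and ?Y = "\<lambda>x. {Row r, Col x, Sym s}"
      and ?Z = "\<lambda>x. {Row r, Col c, Sym x}"
    have "B q \<subseteq> ?X ` {1..n} \<union> ?Y ` {1..n} \<union> ?Z ` {1..n}"
    proof
      fix e assume "e \<in> B q"
      then obtain r' c' s' where e: "e = {Row r', Col c', Sym s'}" "r' \<in> {1..n}" "c' \<in> {1..n}" "s' \<in> {1..n}"
        "e = q \<or> conflict e q"
        unfolding B_def complete_tripartite_def by blast
      have "r' = r \<and> c' = c \<or> r' = r \<and> s' = s \<or> c' = c \<and> s' = s"
        using e(5) unfolding e(1) q(1) conflict_iff triple_eq_iff by blast
      then show "e \<in> ?X ` {1..n} \<union> ?Y ` {1..n} \<union> ?Z ` {1..n}" using e by blast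
    qed
    then have "card (B q) \<le> card (?X ` {1..n} \<union> ?Y ` {1..n} \<union> ?Z ` {1..n})"
      by (rule card_mono[rotated]) simp
    also have "\<dots> \<le> card (?X ` {1..n}) + card (?Y ` {1..n}) + card (?Z ` {1..n})"
      using card_Un_le[of "?X ` {1..n} \<union> ?Y ` {1..n}" "?Z ` {1..n}"] card_Un_le[of "?X ` {1..n}" "?Y ` {1..n}"]
      by linarith
    also have "\<dots> \<le> n + n + n" using card_image_le[OF finite_atLeastAtMost, of _ 1 n] by (intro add_mono) simp_all
    finally show ?thesis by simp
  qed
  have "?E \<subseteq> available ?E Q \<union> (\<Union>q\<in>Q. B q)" by (auto simp: available_def B_def)
  then have "card ?E \<le> card (available ?E Q \<union> (\<Union>q\<in>Q. B q))"
    using fin by (intro card_mono) (auto simp: available_def B_def)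
  also have "\<dots> \<le> card (available ?E Q) + card (\<Union>q\<in>Q. B q)" by (rule card_Un_le)
  also have "card (\<Union>q\<in>Q. B q) \<le> (\<Sum>q\<in>Q. card (B q))" using fin by (intro card_UN_le)
  also have "\<dots> \<le> (\<Sum>q\<in>Q. 3 * n)" using B assms by (intro sum_mono) blast
  finally have "n ^ 3 \<le> card (available ?E Q) + card Q * (3 * n)"
    by (simp add: card_complete_tripartite)
  then have "real (n ^ 3) \<le> real (card (available ?E Q) + card Q * (3 * n))" by (rule of_nat_mono)
  then show ?thesis by (simp add: algebra_simps)
qed

text \<open>Exponential moment estimate for the number of available arrivals. Fewer than m greedy
  edges exclude at most a fraction \<open>3 * \<alpha>\<close> of all hyperedges, so each arrival is
  available with chance at least \<open>1 - 3 * \<alpha>\<close>, and \<alpha> is so small that the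
  surplus \<gamma> outweighs this loss.\<close>

lemma greedy_prob_le_increasing:
  fixes \<alpha> \<gamma> :: real
  assumes "0 < \<gamma>" "0 < \<alpha>" "\<alpha> < \<gamma> / (8 * (1 + \<gamma>))" "(1 + \<gamma>) * \<alpha> \<le> real n" "0 < n"
    and m: "real m \<le> \<alpha> * real n ^ 2" and U: "monotone_increasing n U"
  defines "c \<equiv> \<alpha> * (\<gamma> / 4 * (3 * \<gamma> / 8 / (1 + \<gamma> / 4)))"
  shows "greedy_prob (complete_tripartite n) U m {} \<le>
    measure_pmf.prob (random_hypergraph n ((1 + \<gamma>) * \<alpha> / real n)) U + exp (- c * real n ^ 2)"
proof -
  let ?E = "complete_tripartite n"
  define M where "M = card ?E"
  define p where "p = (1 + \<gamma>) * \<alpha> / real n"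
  define b where "b = 1 - 3 * \<alpha>"
  define l where "l = \<gamma> / 4"
  define r where "r = b * exp (- l) + 1 - b"
  have p: "0 \<le> p" "p \<le> 1" using assms unfolding p_def by (auto simp: field_simps)
  have "\<alpha> * (8 * (1 + \<gamma>)) < \<gamma>" using assms by (simp add: pos_less_divide_eq)
  then have \<alpha>\<gamma>: "8 * \<alpha> + 8 * (\<alpha> * \<gamma>) < \<gamma>" by (simp add: algebra_simps)
  then have "8 * \<alpha> * \<gamma> < 1 * \<gamma>" using assms(2) by simp
  then have "8 * \<alpha> < 1" by (rule mult_right_less_imp_less) (use assms(1) in simp)
  then have b: "0 \<le> b" "b \<le> 1" using assms unfolding b_def by auto
  have l: "0 < l" using assms by (simp add: l_def)
  have M: "real M = real n ^ 3" unfolding M_def card_complete_tripartite by simp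
  have ge: "b * real (card ?E) \<le> real (card (available ?E Q))" if "Q \<subseteq> ?E" "card Q < m" for Q
  proof -
    have "real (card Q) \<le> \<alpha> * real n ^ 2" using that m by linarith
    then have "3 * real n * real (card Q) \<le> 3 * real n * (\<alpha> * real n ^ 2)" by (intro mult_left_mono) auto
    then have "b * real n ^ 3 \<le> real n ^ 3 - 3 * real n * real (card Q)"
      unfolding b_def by (simp add: algebra_simps power2_eq_square power3_eq_cube)
    then show ?thesis using card_available_ge[OF that(1)] by (simp add: card_complete_tripartite)
  qed
  define w where "w j = real (M choose j) * p ^ j * (1 - p) ^ (M - j)" for j
  have w: "0 \<le> w j" for j using p unfolding w_def by simp
  \<comment> \<open>Generating function of the binomial weights: at 1 it is the total mass, at r it
    averages the error terms.\<close>
  have wr: "(\<Sum>j\<le>M. w j * x ^ j) = (p * x + (1 - p)) ^ M" for x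
    unfolding binomial_ring w_def by (intro sum.cong) (simp_all add: power_mult_distrib)
  let ?V = "greedy_prob ?E U m {}"
  have le: "?V \<le> expose ?E (\<lambda>G. of_bool (G \<in> U)) j {} + exp (l * real m) * r ^ j" if "j \<le> M" for j
    by (rule greedy_prob_le_expose_increasing[OF U refl ge b _ r_def]) (use that l in \<open>auto simp: M_def\<close>)
  have "?V = (\<Sum>j\<le>M. w j * ?V)" using wr[of 1] by (simp flip: sum_distrib_right)
  also have "\<dots> \<le> (\<Sum>j\<le>M. w j * (expose ?E (\<lambda>G. of_bool (G \<in> U)) j {} + exp (l * real m) * r ^ j))"
    by (intro sum_mono mult_left_mono le w) auto
  also have "\<dots> = (\<Sum>j\<le>M. w j * expose ?E (\<lambda>G. of_bool (G \<in> U)) j {}) + exp (l * real m) * (\<Sum>j\<le>M. w j * r ^ j)"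
    by (simp add: distrib_left sum.distrib sum_distrib_left mult_ac)
  also have "(\<Sum>j\<le>M. w j * expose ?E (\<lambda>G. of_bool (G \<in> U)) j {}) =
    measure_pmf.prob (random_hypergraph n p) U"
    using prob_random_hypergraph[OF p, of n "\<lambda>G. G \<in> U"] by (simp add: w_def M_def)
  finally have V: "?V \<le> measure_pmf.prob (random_hypergraph n p) U + exp (l * real m) * (\<Sum>j\<le>M. w j * r ^ j)" .
  have "(\<Sum>j\<le>M. w j * r ^ j) \<le> exp (- (p * b * (1 - exp (- l)) * real M))"
  proof -
    define y where "y = p * (b * (1 - exp (- l)))"
    have "y \<le> 1" unfolding y_def using p b l by (intro mult_le_one mult_nonneg_nonneg) auto
    moreover have "1 - y \<le> exp (- y)" using exp_ge_add_one_self[of "- y"] by simp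
    ultimately have "(1 - y) ^ M \<le> exp (- y) ^ M" by (intro power_mono) auto
    also have "exp (- y) ^ M = exp (- (p * b * (1 - exp (- l)) * real M))"
      by (simp add: exp_of_nat_mult[symmetric] y_def algebra_simps)
    also have "(1 - y) ^ M = (\<Sum>j\<le>M. w j * r ^ j)"
      unfolding wr r_def y_def by (simp add: algebra_simps)
    finally show ?thesis .
  qed
  then have "exp (l * real m) * (\<Sum>j\<le>M. w j * r ^ j) \<le>
    exp (l * real m) * exp (- (p * b * (1 - exp (- l)) * real M))" by (rule mult_left_mono) simp
  also have "\<dots> \<le> exp (- c * real n ^ 2)"
  proof -
    have "1 + l \<le> exp l" by (rule exp_ge_add_one_self)
    then have "1 / exp l \<le> 1 / (1 + l)" using l by (intro divide_left_mono) auto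
    then have "l / (1 + l) \<le> 1 - exp (- l)" using l by (simp add: exp_minus field_simps)
    \<comment> \<open>The threshold makes \<open>3 * \<alpha> * (1 + \<gamma>)\<close> at most
      \<open>3 * \<gamma> / 8\<close>. As 5/8 = 1/4 + 3/8 and \<open>l = \<gamma> / 4\<close>, the
      first part pays for \<open>exp (l * m)\<close> and the second part yields the rate c.\<close>
    moreover have "1 + 5 / 8 * \<gamma> \<le> (1 + \<gamma>) * b" using \<alpha>\<gamma> assms(1) unfolding b_def by (simp add: algebra_simps)
    ultimately have "(1 + 5 / 8 * \<gamma>) * (l / (1 + l)) \<le> (1 + \<gamma>) * b * (1 - exp (- l))"
      using l b assms(1) by (intro mult_mono) auto
    moreover have "(1 + 5 / 8 * \<gamma>) * (l / (1 + l)) = l + l * (3 * \<gamma> / 8 / (1 + l))"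
      using l unfolding l_def by (simp add: field_simps)
    ultimately have "\<alpha> * (l + l * (3 * \<gamma> / 8 / (1 + l))) \<le> \<alpha> * ((1 + \<gamma>) * b * (1 - exp (- l)))"
      using assms(2) by (intro mult_left_mono) auto
    then have "real n ^ 2 * (l * \<alpha> + c) \<le> real n ^ 2 * (\<alpha> * ((1 + \<gamma>) * b * (1 - exp (- l))))"
      unfolding c_def l_def[symmetric] by (intro mult_left_mono) (auto simp: algebra_simps)
    also have "\<dots> = p * b * (1 - exp (- l)) * real M"
      unfolding p_def M using assms(5) by (simp add: power2_eq_square power3_eq_cube)
    finally have "l * (\<alpha> * real n ^ 2) + c * real n ^ 2 \<le> p * b * (1 - exp (- l)) * real M"
      by (simp add: algebra_simps)
    moreover have "l * real m \<le> l * (\<alpha> * real n ^ 2)" using m l by (intro mult_left_mono) auto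
    ultimately show ?thesis by (simp add: exp_add[symmetric])
  qed
  finally show ?thesis using V unfolding p_def by simp
qed

text \<open>The crude loss \<open>M ^ 2\<close> is affordable, since it is only polynomial in n. The
  two factorials in the denominator cost at most \<open>2 * ln M + 2\<close>, and the rounding of
  the mean costs another 2.\<close>

lemma binomial_point_prob_ge:
  assumes "1 \<le> m" "m < M" "0 < p" "p \<le> 1 / 2" "real m \<le> real M * p" "real M * p \<le> real m + 1"
  shows "exp (- 2 * ln (real M) - 4) \<le> real (M choose m) * p ^ m * (1 - p) ^ (M - m)"
proof -
  define k where "k = M - m"
  have k: "1 \<le> k" "k \<le> M" "real k = real M - real m" using assms unfolding k_def by auto
  have "ln (real (M choose m)) = ln (fact M) - ln (fact m) - ln (fact k)"
    using assms binomial_fact[of m M, where 'a = real] unfolding k_def by (simp add: ln_div ln_mult)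
  also have "\<dots> \<ge> (real M * ln (real M) - real M) - (real m * ln (real m) - real m + ln (real m) + 1)
      - (real k * ln (real k) - real k + ln (real k) + 1)"
    using ln_fact_lower[of M] ln_fact_upper[of m] ln_fact_upper[of k] assms k by linarith
  finally have choose: "real M * ln (real M) - real m * ln (real m) - real k * ln (real k) - ln (real m) - ln (real k) - 2
    \<le> ln (real (M choose m))" using k by linarith
  have lnp: "ln (real m) - ln (real M) \<le> ln p"
  proof -
    have "ln (real m) \<le> ln (real M * p)" using assms by simp
    then show ?thesis using assms by (simp add: ln_mult)
  qed
  have "ln (real k / (real M * (1 - p))) \<le> real k / (real M * (1 - p)) - 1"
    using assms k by (intro ln_le_minus_one) auto
  also have "\<dots> = (real M * p - real m) / (real M * (1 - p))"
    using assms k by (simp add: field_simps)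
  also have "\<dots> \<le> 1 / (real M * (1 - p))" using assms by (intro divide_right_mono) auto
  finally have "real k * (ln (real k) - ln (real M) - ln (1 - p)) \<le> real k * (1 / (real M * (1 - p)))"
    using assms k by (intro mult_left_mono) (auto simp: ln_div ln_mult)
  also have "\<dots> = real k / real M * (1 / (1 - p))" by simp
  also have "\<dots> \<le> 1 * 2" using assms k by (intro mult_mono) (auto simp: field_simps)
  finally have lnq: "real k * ln (real k) - real k * ln (real M) - 2 \<le> real k * ln (1 - p)"
    by (simp add: algebra_simps)
  have "real m * (ln (real m) - ln (real M)) \<le> real m * ln p" using lnp by (intro mult_left_mono) auto
  moreover have "ln (real m) \<le> ln (real M)" "ln (real k) \<le> ln (real M)" using assms k by auto
  moreover have "real M * ln (real M) = real m * ln (real M) + real k * ln (real M)"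
    unfolding k(3) by (simp add: algebra_simps)
  ultimately have "- 2 * ln (real M) - 4 \<le> ln (real (M choose m)) + real m * ln p + real k * ln (1 - p)"
    using choose lnq by (simp add: algebra_simps)
  also have "\<dots> = ln (real (M choose m) * p ^ m * (1 - p) ^ k)"
    using assms by (simp add: ln_mult ln_realpow zero_less_binomial_iff)
  finally show ?thesis unfolding k_def using assms by (subst (asm) ln_ge_iff) auto
qed

text \<open>Only the event that G has exactly m hyperedges is kept; then m exposures face m greedy
  steps. The exponent \<open>6 * ln n\<close> is \<open>2 * ln M\<close> for
  \<open>M = n ^ 3\<close>.\<close>

lemma greedy_prob_le_decreasing:
  fixes \<alpha> :: real
  assumes "0 < \<alpha>" "\<alpha> < 1" "2 \<le> n" "1 \<le> \<alpha> * real n ^ 2" and U: "monotone_decreasing U"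
  defines "m \<equiv> nat \<lfloor>\<alpha> * real n ^ 2\<rfloor>"
  shows "exp (- 6 * ln (real n) - 4) * greedy_prob (complete_tripartite n) U m {} \<le>
    measure_pmf.prob (random_hypergraph n (\<alpha> / real n)) {G. delete_conflicts G \<in> U}"
proof -
  let ?E = "complete_tripartite n"
  define M where "M = card ?E"
  define p where "p = \<alpha> / real n"
  have M: "M = n ^ 3" unfolding M_def by (rule card_complete_tripartite)
  have p: "0 < p" "p \<le> 1 / 2" using assms unfolding p_def by (auto simp: field_simps)
  have Mp: "real M * p = \<alpha> * real n ^ 2" using assms unfolding M p_def by (simp add: power2_eq_square power3_eq_cube)
  have m: "1 \<le> m" "real m \<le> real M * p" "real M * p \<le> real m + 1"
    using assms(4) unfolding m_def Mp by linarith+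
  have mM: "m < M"
  proof -
    have "real M * p \<le> real M * (1 / 2)" using p by (intro mult_left_mono) auto
    moreover have "0 < M" using assms unfolding M by simp
    ultimately have "real m < real M" using m by linarith
    then show ?thesis by simp
  qed
  define w where "w j = real (M choose j) * p ^ j * (1 - p) ^ (M - j)" for j
  let ?f = "\<lambda>G. of_bool (delete_conflicts G \<in> U) :: real"
  have "exp (- 6 * ln (real n) - 4) = exp (- 2 * ln (real M) - 4)"
    using assms(3) unfolding M by (simp add: ln_realpow)
  also have "\<dots> \<le> w m" unfolding w_def by (rule binomial_point_prob_ge) (use m mM p in auto)
  finally have "exp (- 6 * ln (real n) - 4) * greedy_prob ?E U m {} \<le> w m * greedy_prob ?E U m {}"
    by (rule mult_right_mono) (rule greedy_prob_nonneg)
  also have "\<dots> \<le> w m * expose ?E ?f m {}"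
    using p mM by (intro mult_left_mono greedy_prob_le_expose_decreasing U finite_complete_tripartite)
      (auto simp: w_def M_def delete_conflicts_def)
  also have "\<dots> \<le> (\<Sum>j\<le>M. w j * expose ?E ?f j {})"
    using p mM by (intro member_le_sum) (auto simp: w_def intro!: mult_nonneg_nonneg expose_nonneg)
  also have "\<dots> = measure_pmf.prob (random_hypergraph n p) {G. delete_conflicts G \<in> U}"
    using prob_random_hypergraph[of p n "\<lambda>G. delete_conflicts G \<in> U"] p by (simp add: w_def M_def)
  finally show ?thesis unfolding p_def .
qed

section \<open>Random sequences of distinct elements\<close>

definition distinct_lists :: "'a set \<Rightarrow> nat \<Rightarrow> 'a list set" where
  "distinct_lists X k = {xs. length xs = k \<and> distinct xs \<and> set xs \<subseteq> X}"

text \<open>Falling factorial. Truncated subtraction makes it vanish for \<open>k > N\<close>, so it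
  counts sequences of distinct elements for every k.\<close>

definition falling :: "nat \<Rightarrow> nat \<Rightarrow> real" where
  "falling N k = (\<Prod>j<k. real (N - j))"

lemma falling_add: "falling N (a + b) = falling N a * falling (N - a) b"
  by (induction b) (simp_all add: falling_def)

lemma falling_pos: "k \<le> N \<Longrightarrow> 0 < falling N k"
  unfolding falling_def by (intro prod_pos) auto

lemma falling_nonneg: "0 \<le> falling N k"
  unfolding falling_def by (intro prod_nonneg) auto

lemma falling_eq_fact: "k \<le> N \<Longrightarrow> falling N k * fact (N - k) = fact N"
proof (induction k)
  case (Suc k)
  have "fact (N - k) = real (N - k) * fact (N - Suc k)"
    using Suc.prems by (metis Suc_diff_Suc Suc_le_lessD fact_Suc)
  then show ?case using Suc by (simp add: falling_def)
qed (simp add: falling_def)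

lemma finite_distinct_lists: "finite X \<Longrightarrow> finite (distinct_lists X k)"
  by (rule finite_subset[OF _ finite_lists_length_eq[of X k]]) (auto simp: distinct_lists_def)

lemma sum_distinct_lists_Suc:
  assumes "finite X"
  shows "(\<Sum>xs\<in>distinct_lists X (Suc k). g (take k xs)) =
    real (card X - k) * (\<Sum>ys\<in>distinct_lists X k. g ys)"
proof -
  let ?f = "\<lambda>(ys, x). ys @ [x]"
  have "distinct_lists X (Suc k) = ?f ` (SIGMA ys:distinct_lists X k. X - set ys)"
  proof (intro equalityI subsetI)
    fix xs assume xs: "xs \<in> distinct_lists X (Suc k)"
    then obtain ys x where eq: "xs = ys @ [x]" by (cases xs rule: rev_cases) (auto simp: distinct_lists_def)
    then have "ys \<in> distinct_lists X k" "x \<in> X - set ys" using xs by (auto simp: distinct_lists_def)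
    then show "xs \<in> ?f ` (SIGMA ys:distinct_lists X k. X - set ys)"
      unfolding eq by (intro image_eqI[of _ _ "(ys, x)"]) auto
  qed (auto simp: distinct_lists_def)
  then have "(\<Sum>xs\<in>distinct_lists X (Suc k). g (take k xs)) =
    (\<Sum>xs\<in>?f ` (SIGMA ys:distinct_lists X k. X - set ys). g (take k xs))" by simp
  also have "\<dots> = (\<Sum>p\<in>(SIGMA ys:distinct_lists X k. X - set ys). g (take k (?f p)))"
    by (subst sum.reindex) (auto intro!: inj_onI)
  also have "\<dots> = (\<Sum>(ys, x)\<in>(SIGMA ys:distinct_lists X k. X - set ys). g ys)"
    by (rule sum.cong) (auto simp: distinct_lists_def)
  also have "\<dots> = (\<Sum>ys\<in>distinct_lists X k. \<Sum>x\<in>X - set ys. g ys)"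
    using assms finite_distinct_lists by (subst sum.Sigma) auto
  also have "\<dots> = (\<Sum>ys\<in>distinct_lists X k. real (card X - k) * g ys)"
  proof (rule sum.cong[OF refl])
    fix ys assume "ys \<in> distinct_lists X k"
    then have "card (X - set ys) = card X - k"
      by (subst card_Diff_subset) (auto simp: distinct_lists_def distinct_card)
    then show "(\<Sum>x\<in>X - set ys. g ys) = real (card X - k) * g ys" by simp
  qed
  finally show ?thesis by (simp add: sum_distrib_left)
qed

text \<open>A prefix of a uniformly random sequence is again uniform; the factor counts the
  continuations of a prefix.\<close>

lemma sum_distinct_lists_take:
  assumes "finite X" "i \<le> m"
  shows "(\<Sum>xs\<in>distinct_lists X m. g (take i xs)) =
    falling (card X - i) (m - i) * (\<Sum>ys\<in>distinct_lists X i. g ys)"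
  using assms(2)
proof (induction m rule: dec_induct)
  case base
  have "(\<Sum>xs\<in>distinct_lists X i. g (take i xs)) = (\<Sum>xs\<in>distinct_lists X i. g xs)"
    by (rule sum.cong) (auto simp: distinct_lists_def)
  then show ?case by (simp add: falling_def)
next
  case (step m)
  have "(\<Sum>xs\<in>distinct_lists X (Suc m). g (take i xs)) =
    (\<Sum>xs\<in>distinct_lists X (Suc m). g (take i (take m xs)))" using step by (simp add: min_def)
  also have "\<dots> = real (card X - m) * (\<Sum>xs\<in>distinct_lists X m. g (take i xs))"
    by (rule sum_distinct_lists_Suc[OF assms(1)])
  also have "\<dots> = falling (card X - i) (Suc m - i) * (\<Sum>ys\<in>distinct_lists X i. g ys)"
    unfolding step.IH using step(1) by (simp add: falling_def Suc_diff_le)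
  finally show ?case .
qed

lemma card_distinct_lists:
  assumes "finite X"
  shows "real (card (distinct_lists X k)) = falling (card X) k"
proof -
  have "distinct_lists X 0 = {[]}" by (auto simp: distinct_lists_def)
  then show ?thesis using sum_distinct_lists_take[OF assms, of 0 k "\<lambda>_. 1"] by simp
qed

text \<open>Both sides equal \<open>falling (card X) (i + card D)\<close>, cut in two ways. In this
  form the chance to miss D consists of \<open>card D\<close> factors instead of i.\<close>

lemma card_distinct_lists_avoiding:
  assumes "finite X" "D \<subseteq> X"
  shows "real (card {ys \<in> distinct_lists X i. D \<inter> set ys = {}}) * falling (card X) (card D) =
    real (card (distinct_lists X i)) * falling (card X - i) (card D)"
proof -
  have "{ys \<in> distinct_lists X i. D \<inter> set ys = {}} = distinct_lists (X - D) i"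
    by (auto simp: distinct_lists_def)
  moreover have "card (X - D) = card X - card D"
    using assms finite_subset by (subst card_Diff_subset) auto
  ultimately have "real (card {ys \<in> distinct_lists X i. D \<inter> set ys = {}}) = falling (card X - card D) i"
    using assms card_distinct_lists[of "X - D" i] by simp
  then show ?thesis using falling_add[of "card X" i "card D"] falling_add[of "card X" "card D" i]
    unfolding card_distinct_lists[OF assms(1)] by (simp add: add.commute mult.commute)
qed

text \<open>Each factor \<open>(N - i - j) / (N - j)\<close> is at most \<open>(N - i) / N\<close>.
  This is the negative correlation behind the variance bound.\<close>

lemma falling_ratio_upper:
  assumes "d \<le> N"
  shows "falling (N - i) d \<le> (real (N - i) / real N) ^ d * falling N d"
proof (cases "i \<le> N")
  case True
  have "(\<Prod>j<d. real (N - i - j)) \<le> (\<Prod>j<d. real (N - i) / real N * real (N - j))"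
  proof (rule prod_mono)
    fix j assume j: "j \<in> {..<d}"
    have "real N * real (N - i - j) \<le> real (N - i) * real (N - j)"
    proof (cases "i + j \<le> N")
      case True
      then have "real (N - i - j) = real N - real i - real j" by (simp add: of_nat_diff)
      moreover have "real (N - i) = real N - real i" "real (N - j) = real N - real j" using True by auto
      ultimately show ?thesis by (simp add: algebra_simps)
    qed simp
    moreover have "0 < N" using j assms by auto
    ultimately show "0 \<le> real (N - i - j) \<and> real (N - i - j) \<le> real (N - i) / real N * real (N - j)"
      by (simp add: field_simps)
  qed
  then show ?thesis unfolding falling_def prod.distrib by simp
next
  case False
  then show ?thesis by (cases d) (simp_all add: falling_def)
qed

text \<open>Compared with the ideal factor \<open>(N - i) / N\<close>, each of the three actual
  factors loses at most \<open>2 / (N - 2)\<close>, hence at most \<open>4 / N\<close>; this is the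
  source of the 12.\<close>

lemma falling_ratio_lower:
  assumes "4 \<le> N" "i \<le> N"
  shows "((real (N - i) / real N) ^ 3 - 12 / real N) * falling N 3 \<le> falling (N - i) 3"
proof -
  define t where "t = real (N - i) / real N"
  define x where "x j = real (N - i - j) / real (N - j)" for j
  have t: "0 \<le> t" "t \<le> 1" using assms unfolding t_def by auto
  have x: "0 \<le> x j" "x j \<le> 1" "t - x j \<le> 4 / real N" if "j \<le> 2" for j
  proof -
    have N: "2 * real (N - j) \<ge> real N" "real (N - j) > 0" "real (N - j) = real N - real j" using that assms by auto
    show "0 \<le> x j" "x j \<le> 1" using that assms unfolding x_def by auto
    have "real (N - i) - real j \<le> real (N - i - j)" by linarith
    then have "(real (N - i) - real j) / real (N - j) \<le> x j" unfolding x_def by (intro divide_right_mono) auto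
    moreover have "t \<le> real (N - i) / real (N - j)" unfolding t_def using N by (intro divide_left_mono) auto
    ultimately have "t - x j \<le> real j / real (N - j)" by (simp add: diff_divide_distrib)
    also have "\<dots> \<le> 2 / real (N - j)" using that by (intro divide_right_mono) auto
    also have "\<dots> \<le> 4 / real N" using N assms by (simp add: field_simps)
    finally show "t - x j \<le> 4 / real N" .
  qed
  have "t ^ 3 - x 0 * x 1 * x 2 = (t - x 0) * (t * t) + (t - x 1) * (x 0 * t) + (t - x 2) * (x 0 * x 1)"
    by (simp add: power3_eq_cube algebra_simps)
  also have "\<dots> \<le> 4 / real N * 1 + 4 / real N * 1 + 4 / real N * 1"
  proof -
    have "(t - y) * w \<le> 4 / real N * 1" if "t - y \<le> 4 / real N" "0 \<le> w" "w \<le> 1" for y w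
    proof -
      have "(t - y) * w \<le> 4 / real N * w" using that by (intro mult_right_mono)
      also have "\<dots> \<le> 4 / real N * 1" using that by (intro mult_left_mono) auto
      finally show ?thesis .
    qed
    then show ?thesis using t x[of 0] x[of 1] x[of 2] by (intro add_mono) (simp_all add: mult_le_one)
  qed
  finally have "t ^ 3 - 12 / real N \<le> x 0 * x 1 * x 2" by simp
  moreover have "x 0 * x 1 * x 2 * falling N 3 = falling (N - i) 3"
    using assms unfolding x_def falling_def by (simp add: numeral_3_eq_3)
  ultimately show ?thesis using falling_nonneg[of N 3] unfolding t_def[symmetric]
    by (metis mult_right_mono)
qed

section \<open>Second moment of the number of surviving triples\<close>

definition count_avoiding :: "'z set \<Rightarrow> ('z \<Rightarrow> 'a set) \<Rightarrow> 'a set \<Rightarrow> real" where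
  "count_avoiding Z D S = real (card {z \<in> Z. D z \<inter> S = {}})"

text \<open>Disjoint triples are negatively correlated, so only intersecting pairs contribute to the
  variance.\<close>

lemma count_avoiding_second_moment:
  assumes X: "finite X" "6 \<le> card X" and Z: "finite Z"
    and D: "\<And>z. z \<in> Z \<Longrightarrow> D z \<subseteq> X" "\<And>z. z \<in> Z \<Longrightarrow> card (D z) = 3"
    and K: "\<And>x. x \<in> X \<Longrightarrow> card {z \<in> Z. x \<in> D z} \<le> K"
    and i: "i \<le> card X"
  defines "N \<equiv> real (card X)"
  defines "c \<equiv> real (card Z) * ((N - real i) / N) ^ 3"
  shows "(\<Sum>ys\<in>distinct_lists X i. (count_avoiding Z D (set ys) - c)\<^sup>2) \<le>
    real (card (distinct_lists X i)) * (3 * real K * real (card Z) + 24 * (real (card Z))\<^sup>2 / N)"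
proof -
  let ?L = "distinct_lists X i" and ?A = "\<lambda>ys. count_avoiding Z D (set ys)"
  define W where "W = real (card ?L)"
  define t where "t = (N - real i) / N"
  define av where "av D ys = (of_bool (D \<inter> set ys = {}) :: real)" for D :: "'a set" and ys
  have N: "N \<ge> 6" using X(2) unfolding N_def by simp
  have t: "0 \<le> t" "t \<le> 1" "t = real (card X - i) / real (card X)"
    using i N unfolding t_def N_def by (auto simp: of_nat_diff)
  have finL: "finite ?L" using X(1) by (rule finite_distinct_lists)
  have fD: "finite (D z)" if "z \<in> Z" for z using D(1)[OF that] X(1) finite_subset by blast
  have A: "?A ys = (\<Sum>z\<in>Z. av (D z) ys)" for ys
    unfolding count_avoiding_def av_def using Z by (simp add: Int_def)
  have P: "(\<Sum>ys\<in>?L. av D' ys) * falling (card X) (card D') = W * falling (card X - i) (card D')"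
    if "D' \<subseteq> X" for D'
    using card_distinct_lists_avoiding[OF X(1) that, of i] finL
    by (simp add: av_def W_def Int_def)
  have W0: "0 \<le> W" by (simp add: W_def)
  have first: "W * (t ^ 3 - 12 / N) \<le> (\<Sum>ys\<in>?L. av (D z) ys)" if z: "z \<in> Z" for z
  proof -
    have "W * ((t ^ 3 - 12 / N) * falling (card X) 3) \<le> W * falling (card X - i) 3"
      unfolding t(3) N_def using X(2) i W0 by (intro mult_left_mono falling_ratio_lower) auto
    also have "\<dots> = (\<Sum>ys\<in>?L. av (D z) ys) * falling (card X) 3"
      using P[OF D(1)[OF z]] D(2)[OF z] by simp
    finally show ?thesis using falling_pos[of 3 "card X"] X(2) by (simp add: mult.assoc[symmetric])
  qed
  have pair: "(\<Sum>ys\<in>?L. av (D z) ys * av (D z') ys) \<le> W * (t ^ 6 + of_bool (D z \<inter> D z' \<noteq> {}))"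
    if z: "z \<in> Z" "z' \<in> Z" for z z'
  proof (cases "D z \<inter> D z' = {}")
    case True
    then have card: "card (D z \<union> D z') = 6" using fD z D(2) by (simp add: card_Un_disjoint)
    have "(\<Sum>ys\<in>?L. av (D z \<union> D z') ys) * falling (card X) 6 = W * falling (card X - i) 6"
      using P[of "D z \<union> D z'"] D(1) z card by simp
    also have "\<dots> \<le> W * (t ^ 6 * falling (card X) 6)"
      unfolding t(3) using X(2) W0 by (intro mult_left_mono falling_ratio_upper) auto
    finally have "(\<Sum>ys\<in>?L. av (D z \<union> D z') ys) \<le> W * t ^ 6"
      using falling_pos[of 6 "card X"] X(2) by (simp add: mult.assoc[symmetric])
    moreover have "av (D z) ys * av (D z') ys = av (D z \<union> D z') ys" for ys
      by (auto simp: av_def)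
    ultimately show ?thesis using True by simp
  next
    case False
    have "(\<Sum>ys\<in>?L. av (D z) ys * av (D z') ys) \<le> (\<Sum>ys\<in>?L. 1)"
      by (rule sum_mono) (simp add: av_def)
    also have "\<dots> = W * 1" by (simp add: W_def)
    also have "\<dots> \<le> W * (t ^ 6 + 1)" using W0 t by (intro mult_left_mono) auto
    finally show ?thesis using False by simp
  qed
  have meet: "(\<Sum>z'\<in>Z. of_bool (D z \<inter> D z' \<noteq> {}) :: real) \<le> 3 * real K" if z: "z \<in> Z" for z
  proof -
    have "(\<Sum>z'\<in>Z. of_bool (D z \<inter> D z' \<noteq> {}) :: real) = real (card {z' \<in> Z. D z \<inter> D z' \<noteq> {}})"
      using Z by (simp add: Int_def)
    also have "{z' \<in> Z. D z \<inter> D z' \<noteq> {}} = (\<Union>x\<in>D z. {z' \<in> Z. x \<in> D z'})" by auto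
    also have "card \<dots> \<le> (\<Sum>x\<in>D z. card {z' \<in> Z. x \<in> D z'})" by (rule card_UN_le[OF fD[OF z]])
    also have "\<dots> \<le> (\<Sum>x\<in>D z. K)" using D(1)[OF z] K by (intro sum_mono) auto
    finally show ?thesis using D(2)[OF z] by simp
  qed
  define k where "k = real (card Z)"
  have c: "c = k * t ^ 3" unfolding c_def k_def t_def ..
  have k0: "0 \<le> k" unfolding k_def by simp
  have E1: "k * (W * (t ^ 3 - 12 / N)) \<le> (\<Sum>ys\<in>?L. ?A ys)"
  proof -
    have "k * (W * (t ^ 3 - 12 / N)) = (\<Sum>z\<in>Z. W * (t ^ 3 - 12 / N))" by (simp add: k_def)
    also have "\<dots> \<le> (\<Sum>z\<in>Z. \<Sum>ys\<in>?L. av (D z) ys)" by (intro sum_mono first)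
    also have "\<dots> = (\<Sum>ys\<in>?L. ?A ys)" unfolding A by (rule sum.swap)
    finally show ?thesis .
  qed
  have E2: "(\<Sum>ys\<in>?L. (?A ys)\<^sup>2) \<le> W * (k\<^sup>2 * t ^ 6 + 3 * real K * k)"
  proof -
    have "(\<Sum>ys\<in>?L. (?A ys)\<^sup>2) = (\<Sum>ys\<in>?L. \<Sum>z\<in>Z. \<Sum>z'\<in>Z. av (D z) ys * av (D z') ys)"
      unfolding A power2_eq_square sum_product ..
    also have "\<dots> = (\<Sum>z\<in>Z. \<Sum>ys\<in>?L. \<Sum>z'\<in>Z. av (D z) ys * av (D z') ys)" by (rule sum.swap)
    also have "\<dots> = (\<Sum>z\<in>Z. \<Sum>z'\<in>Z. \<Sum>ys\<in>?L. av (D z) ys * av (D z') ys)"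
      by (intro sum.cong refl sum.swap)
    also have "\<dots> \<le> (\<Sum>z\<in>Z. \<Sum>z'\<in>Z. W * (t ^ 6 + of_bool (D z \<inter> D z' \<noteq> {})))"
      by (intro sum_mono pair)
    also have "\<dots> = (\<Sum>z\<in>Z. W * (k * t ^ 6 + (\<Sum>z'\<in>Z. of_bool (D z \<inter> D z' \<noteq> {}))))"
      unfolding sum_distrib_left[symmetric] sum.distrib by (simp add: k_def)
    also have "\<dots> \<le> (\<Sum>z\<in>Z. W * (k * t ^ 6 + 3 * real K))"
      using W0 by (intro sum_mono mult_left_mono add_left_mono meet)
    also have "\<dots> = W * (k\<^sup>2 * t ^ 6 + 3 * real K * k)" by (simp add: k_def power2_eq_square algebra_simps)
    finally show ?thesis .
  qed
  \<comment> \<open>The centre c is only an approximate mean, so the cross term uses the lower bound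
    \<open>E1\<close>. The three terms with \<open>t ^ 6\<close> cancel, and the error
    \<open>12 / N\<close> appears doubled.\<close>
  have "(\<Sum>ys\<in>?L. (?A ys - c)\<^sup>2) = (\<Sum>ys\<in>?L. (?A ys)\<^sup>2) - 2 * c * (\<Sum>ys\<in>?L. ?A ys) + W * c\<^sup>2"
    by (simp add: power2_diff sum.distrib sum_subtractf sum_distrib_left W_def algebra_simps)
  also have "\<dots> \<le> W * (k\<^sup>2 * t ^ 6 + 3 * real K * k) - 2 * c * (k * (W * (t ^ 3 - 12 / N))) + W * c\<^sup>2"
    using E1 E2 k0 t c W0 by (intro add_mono diff_mono mult_left_mono) auto
  also have "\<dots> = W * (3 * real K * k + 24 * (k\<^sup>2 / N) * t ^ 3)"
    unfolding c by (simp add: algebra_simps power2_eq_square power_add[symmetric])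
  also have "\<dots> \<le> W * (3 * real K * k + 24 * (k\<^sup>2 / N) * 1)"
    using W0 t N k0 by (intro mult_left_mono add_left_mono power_le_one) auto
  finally show ?thesis unfolding W_def k_def by simp
qed

text \<open>A family F of density \<rho> may be correlated with the count in any way. Still, the
  squared deviations over F sum to at most their total over all sequences, which costs 1/\<rho> on
  average, and \<open>x \<le> s + x^2 / s\<close> turns squares into a bound for the mean.\<close>

lemma count_avoiding_conditional_mean:
  assumes X: "finite X" "6 \<le> card X" and Z: "finite Z"
    and D: "\<And>z. z \<in> Z \<Longrightarrow> D z \<subseteq> X" "\<And>z. z \<in> Z \<Longrightarrow> card (D z) = 3"
    and K: "\<And>x. x \<in> X \<Longrightarrow> card {z \<in> Z. x \<in> D z} \<le> K"
    and i: "i \<le> m" "m \<le> card X"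
    and F: "F \<subseteq> distinct_lists X m" "\<rho> * real (card (distinct_lists X m)) \<le> real (card F)" "0 < \<rho>"
    and s: "0 < s" "3 * real K * real (card Z) + 24 * (real (card Z))\<^sup>2 / real (card X) \<le> v * s\<^sup>2"
  shows "(\<Sum>xs\<in>F. count_avoiding Z D (set (take i xs))) \<le>
    real (card F) * (real (card Z) * ((real (card X) - real i) / real (card X)) ^ 3 + (1 + v / \<rho>) * s)"
proof -
  define c where "c = real (card Z) * ((real (card X) - real i) / real (card X)) ^ 3"
  define g where "g ys = (count_avoiding Z D (set ys) - c)\<^sup>2" for ys
  let ?L = "distinct_lists X m" and ?A = "\<lambda>xs. count_avoiding Z D (set (take i xs))"
  have fin: "finite ?L" "finite F" using finite_distinct_lists[OF X(1)] F(1) finite_subset by blast+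
  have "(\<Sum>xs\<in>?L. g (take i xs)) = falling (card X - i) (m - i) * (\<Sum>ys\<in>distinct_lists X i. g ys)"
    by (rule sum_distinct_lists_take[OF X(1) i(1)])
  also have "\<dots> \<le> falling (card X - i) (m - i) * (real (card (distinct_lists X i)) * (v * s\<^sup>2))"
  proof (rule mult_left_mono[OF _ falling_nonneg])
    have "(\<Sum>ys\<in>distinct_lists X i. g ys) \<le> real (card (distinct_lists X i)) *
        (3 * real K * real (card Z) + 24 * (real (card Z))\<^sup>2 / real (card X))"
      unfolding g_def c_def by (rule count_avoiding_second_moment) (use assms in auto)
    also have "\<dots> \<le> real (card (distinct_lists X i)) * (v * s\<^sup>2)" using s by (intro mult_left_mono) auto
    finally show "(\<Sum>ys\<in>distinct_lists X i. g ys) \<le> real (card (distinct_lists X i)) * (v * s\<^sup>2)" .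
  qed
  also have "\<dots> = real (card ?L) * (v * s\<^sup>2)"
    using falling_add[of "card X" i "m - i"] i unfolding card_distinct_lists[OF X(1)] by simp
  finally have V: "(\<Sum>xs\<in>?L. g (take i xs)) \<le> real (card ?L) * (v * s\<^sup>2)" .
  have v0: "0 \<le> v" using s by (smt (verit) divide_nonneg_nonneg mult_nonneg_nonneg of_nat_0_le_iff
      zero_le_power2 mult_neg_pos zero_less_power)
  have pt: "x \<le> s + x\<^sup>2 / s" for x :: real
  proof -
    have "0 \<le> (x - s)\<^sup>2 + x * x + s * s" by simp
    then have "x * s \<le> s * s + x\<^sup>2" by (simp add: power2_eq_square algebra_simps)
    then show ?thesis using s by (simp add: field_simps)
  qed
  have "(\<Sum>xs\<in>F. ?A xs) - real (card F) * c = (\<Sum>xs\<in>F. ?A xs - c)"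
    by (simp add: sum_subtractf)
  also have "\<dots> \<le> (\<Sum>xs\<in>F. s + g (take i xs) / s)" unfolding g_def by (intro sum_mono pt)
  also have "\<dots> = real (card F) * s + (\<Sum>xs\<in>F. g (take i xs)) / s"
    by (simp add: sum.distrib sum_divide_distrib)
  also have "(\<Sum>xs\<in>F. g (take i xs)) \<le> (\<Sum>xs\<in>?L. g (take i xs))"
    using fin F(1) by (intro sum_mono2) (auto simp: g_def)
  also have "\<dots> \<le> real (card F) / \<rho> * (v * s\<^sup>2)"
  proof -
    have "real (card ?L) \<le> real (card F) / \<rho>" using F by (simp add: field_simps)
    then show ?thesis using V v0 by (meson mult_right_mono order_trans zero_le_mult_iff zero_le_power2)
  qed
  also have "\<dots> / s = real (card F) * (v / \<rho> * s)" using s by (simp add: power2_eq_square)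
  finally show ?thesis using s unfolding c_def[symmetric] by (simp add: algebra_simps divide_right_mono)
qed

section \<open>Greedy steps and completions of a Latin square\<close>

definition cells :: "nat \<Rightarrow> (nat \<times> nat) set" where
  "cells n = {1..n} \<times> {1..n}"

definition cell_edge :: "(nat \<Rightarrow> nat \<Rightarrow> nat) \<Rightarrow> nat \<times> nat \<Rightarrow> vertex set" where
  "cell_edge A x = {Row (fst x), Col (snd x), Sym (A (fst x) (snd x))}"

definition symbol_row :: "nat \<Rightarrow> (nat \<Rightarrow> nat \<Rightarrow> nat) \<Rightarrow> nat \<Rightarrow> nat \<Rightarrow> nat" where
  "symbol_row n A c s = (THE r. r \<in> {1..n} \<and> A r c = s)"

text \<open>A triple \<open>(r, c, c')\<close> with \<open>c \<noteq> c'\<close> stands for the hyperedge \<open>(r, c, A r c')\<close> outside the Latin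
  square; \<open>blockers\<close> are the three cells whose hyperedges conflict with it.\<close>

definition triples :: "nat \<Rightarrow> (nat \<times> nat \<times> nat) set" where
  "triples n = {(r, c, c'). r \<in> {1..n} \<and> c \<in> {1..n} \<and> c' \<in> {1..n} \<and> c \<noteq> c'}"

definition blockers :: "nat \<Rightarrow> (nat \<Rightarrow> nat \<Rightarrow> nat) \<Rightarrow> nat \<times> nat \<times> nat \<Rightarrow> (nat \<times> nat) set" where
  "blockers n A = (\<lambda>(r, c, c'). {(r, c), (r, c'), (symbol_row n A c (A r c'), c)})"

abbreviation open_triples :: "nat \<Rightarrow> (nat \<Rightarrow> nat \<Rightarrow> nat) \<Rightarrow> (nat \<times> nat) set \<Rightarrow> real" where
  "open_triples n A \<equiv> count_avoiding (triples n) (blockers n A)"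

section \<open>Cells, triples and conflicts inside a Latin square\<close>

lemma finite_cells: "finite (cells n)" and card_cells: "card (cells n) = n\<^sup>2"
  by (simp_all add: cells_def power2_eq_square)

lemma finite_triples: "finite (triples n)"
  by (rule finite_subset[of _ "{1..n} \<times> {1..n} \<times> {1..n}"]) (auto simp: triples_def)

lemma card_triples: "card (triples n) = n\<^sup>2 * (n - 1)"
proof -
  have "triples n = (SIGMA r:{1..n}. SIGMA c:{1..n}. {1..n} - {c})" by (auto simp: triples_def)
  then show ?thesis by (simp add: card_SigmaI power2_eq_square)
qed

lemma latin_array_range: "latin_array n A \<Longrightarrow> r \<in> {1..n} \<Longrightarrow> c \<in> {1..n} \<Longrightarrow> A r c \<in> {1..n}"
  unfolding latin_array_def bij_betw_def by blast

lemma latin_array_row_inj: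
  assumes "latin_array n A" "r \<in> {1..n}" "c \<in> {1..n}" "c' \<in> {1..n}" "A r c = A r c'"
  shows "c = c'"
proof -
  have "inj_on (\<lambda>c. A r c) {1..n}" using assms(1,2) unfolding latin_array_def bij_betw_def by blast
  then show ?thesis by (rule inj_onD[OF _ assms(5,3,4)])
qed

lemma latin_array_col_inj:
  assumes "latin_array n A" "c \<in> {1..n}" "r \<in> {1..n}" "r' \<in> {1..n}" "A r c = A r' c"
  shows "r = r'"
proof -
  have "inj_on (\<lambda>r. A r c) {1..n}" using assms(1,2) unfolding latin_array_def bij_betw_def by blast
  then show ?thesis by (rule inj_onD[OF _ assms(5,3,4)])
qed

lemma latin_array_row_surj:
  assumes "latin_array n A" "r \<in> {1..n}" "s \<in> {1..n}"
  obtains c where "c \<in> {1..n}" "A r c = s"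
proof -
  have "(\<lambda>c. A r c) ` {1..n} = {1..n}" using assms(1,2) unfolding latin_array_def bij_betw_def by blast
  then show ?thesis using that assms(3) by (metis imageE)
qed

lemma symbol_row:
  assumes "latin_array n A" "c \<in> {1..n}" "s \<in> {1..n}"
  shows "symbol_row n A c s \<in> {1..n}" "A (symbol_row n A c s) c = s"
proof -
  have "(\<lambda>r. A r c) ` {1..n} = {1..n}" using assms(1,2) unfolding latin_array_def bij_betw_def by blast
  then obtain r where r: "r \<in> {1..n}" "A r c = s" using assms(3) by (metis imageE)
  have "symbol_row n A c s \<in> {1..n} \<and> A (symbol_row n A c s) c = s"
    unfolding symbol_row_def
    by (rule theI[of _ r]) (use r latin_array_col_inj[OF assms(1,2)] in blast)+
  then show "symbol_row n A c s \<in> {1..n}" "A (symbol_row n A c s) c = s" by auto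
qed

lemma symbol_row_neq:
  assumes "latin_array n A" "r \<in> {1..n}" "c \<in> {1..n}" "c' \<in> {1..n}" "c \<noteq> c'"
  shows "symbol_row n A c (A r c') \<noteq> r"
  using symbol_row(2)[OF assms(1,3) latin_array_range[OF assms(1,2,4)]]
    latin_array_row_inj[OF assms(1,2,3,4)] assms(5) by metis

lemma blockers_subset:
  assumes "latin_array n A" "z \<in> triples n"
  shows "blockers n A z \<subseteq> cells n" "card (blockers n A z) = 3"
proof -
  obtain r c c' where z: "z = (r, c, c')" "r \<in> {1..n}" "c \<in> {1..n}" "c' \<in> {1..n}" "c \<noteq> c'"
    using assms(2) unfolding triples_def by blast
  show "blockers n A z \<subseteq> cells n"
    using z symbol_row(1)[OF assms(1) z(3) latin_array_range[OF assms(1) z(2,4)]]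
    by (simp add: blockers_def cells_def)
  show "card (blockers n A z) = 3"
    using z symbol_row_neq[OF assms(1) z(2-5)] by (auto simp: blockers_def)
qed

text \<open>The cell can be each of the three blockers of a triple; in every case one coordinate of
  the triple stays free. In the third case the row is free and \<open>c'\<close> is the column of
  the symbol \<open>A u v\<close> in that row.\<close>

lemma card_blocked_by_cell:
  assumes "latin_array n A" "x \<in> cells n"
  shows "card {z \<in> triples n. x \<in> blockers n A z} \<le> 3 * n"
proof -
  obtain u v where x: "x = (u, v)" "u \<in> {1..n}" "v \<in> {1..n}" using assms(2) by (auto simp: cells_def)
  let ?B1 = "(\<lambda>c. (u, v, c)) ` {1..n}" and ?B2 = "(\<lambda>c. (u, c, v)) ` {1..n}"
  let ?B3 = "(\<lambda>r. (r, v, THE c. c \<in> {1..n} \<and> A r c = A u v)) ` {1..n}"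
  have "{z \<in> triples n. x \<in> blockers n A z} \<subseteq> ?B1 \<union> ?B2 \<union> ?B3"
  proof
    fix z assume "z \<in> {z \<in> triples n. x \<in> blockers n A z}"
    then obtain r c c' where z: "z = (r, c, c')" "r \<in> {1..n}" "c \<in> {1..n}" "c' \<in> {1..n}"
      "(u, v) \<in> {(r, c), (r, c'), (symbol_row n A c (A r c'), c)}"
      unfolding triples_def blockers_def x by auto
    then consider "u = r" "v = c" | "u = r" "v = c'" | "u = symbol_row n A c (A r c')" "v = c" by auto
    then show "z \<in> ?B1 \<union> ?B2 \<union> ?B3"
    proof cases
      case 3
      have uv: "A u v = A r c'" using 3 symbol_row(2)[OF assms(1) z(3) latin_array_range[OF assms(1) z(2,4)]] by simp
      have "(THE c. c \<in> {1..n} \<and> A r c = A u v) = c'"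
      proof (rule the_equality)
        show "c' \<in> {1..n} \<and> A r c' = A u v" using z(4) uv by simp
        show "d = c'" if "d \<in> {1..n} \<and> A r d = A u v" for d
          using that uv latin_array_row_inj[OF assms(1) z(2) _ z(4), of d] by simp
      qed
      then show ?thesis using z 3 by auto
    qed (use z in auto)
  qed
  then have "card {z \<in> triples n. x \<in> blockers n A z} \<le> card (?B1 \<union> ?B2 \<union> ?B3)"
    by (rule card_mono[rotated]) simp
  also have "\<dots> \<le> card ?B1 + card ?B2 + card ?B3"
    using card_Un_le[of "?B1 \<union> ?B2" ?B3] card_Un_le[of ?B1 ?B2] by linarith
  also have "\<dots> \<le> n + n + n" using card_image_le[OF finite_atLeastAtMost, of _ 1 n] by (intro add_mono) simp_all
  finally show ?thesis by simp
qed

lemma array_hypergraph_eq: "array_hypergraph n A = cell_edge A ` cells n"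
proof (intro equalityI subsetI)
  fix e assume "e \<in> array_hypergraph n A"
  then obtain r c where "e = {Row r, Col c, Sym (A r c)}" "r \<in> {1..n}" "c \<in> {1..n}"
    unfolding array_hypergraph_def by blast
  then have "e = cell_edge A (r, c)" "(r, c) \<in> cells n" by (simp_all add: cell_edge_def cells_def)
  then show "e \<in> cell_edge A ` cells n" by blast
next
  fix e assume "e \<in> cell_edge A ` cells n"
  then obtain r c where "e = {Row r, Col c, Sym (A r c)}" "r \<in> {1..n}" "c \<in> {1..n}"
    unfolding cell_edge_def cells_def by auto
  then show "e \<in> array_hypergraph n A" unfolding array_hypergraph_def by blast
qed

lemma cell_edge_eq_iff: "cell_edge A x = cell_edge A y \<longleftrightarrow> x = y"
  by (auto simp: cell_edge_def triple_eq_iff prod_eq_iff)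

lemma cell_edge_in_image: "cell_edge A x \<in> cell_edge A ` Y \<longleftrightarrow> x \<in> Y"
  by (auto simp: cell_edge_eq_iff)

lemma cell_edge_no_conflict:
  assumes "latin_array n A" "x \<in> cells n" "y \<in> cells n"
  shows "\<not> conflict (cell_edge A x) (cell_edge A y)"
proof -
  obtain r c r' c' where x: "x = (r, c)" "r \<in> {1..n}" "c \<in> {1..n}"
    and y: "y = (r', c')" "r' \<in> {1..n}" "c' \<in> {1..n}" using assms(2,3) by (auto simp: cells_def)
  show ?thesis unfolding cell_edge_def conflict_iff x y fst_conv snd_conv
    using latin_array_row_inj[OF assms(1) x(2,3) y(3)] latin_array_col_inj[OF assms(1) x(3,2) y(2)] by auto
qed

lemma cell_edge_available:
  assumes "latin_array n A" "Y \<subseteq> cells n" "x \<in> cells n" "x \<notin> Y"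
  shows "cell_edge A x \<in> available (complete_tripartite n) (cell_edge A ` Y)"
proof -
  have "cell_edge A x \<in> complete_tripartite n"
    using array_hypergraph_subset[OF assms(1)] assms(3) array_hypergraph_eq by blast
  then show ?thesis using cell_edge_no_conflict[OF assms(1,3)] assms(2,4)
    by (auto simp: available_def cell_edge_in_image)
qed

text \<open>The symbol s stands in row r at exactly one column \<open>c'\<close>. For
  \<open>c' = c\<close> the hyperedge belongs to the square; otherwise the hyperedges of the square
  in conflict with it are those of the three cells in \<open>blockers\<close>.\<close>

lemma available_cases:
  assumes A: "latin_array n A" and Y: "Y \<subseteq> cells n"
    and e: "{Row r, Col c, Sym s} \<in> available (complete_tripartite n) (cell_edge A ` Y)"
  shows "(r, c) \<in> cells n - Y" "A r c = s \<or> (\<exists>c'. (r, c, c') \<in> triples n \<and> s = A r c' \<and> blockers n A (r, c, c') \<inter> Y = {})"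
proof -
  have rcs: "r \<in> {1..n}" "c \<in> {1..n}" "s \<in> {1..n}"
    using e unfolding available_def complete_tripartite_def by (auto simp: triple_eq_iff)
  have free: "(r', c') \<notin> Y" if "r = r' \<and> c = c' \<or> r = r' \<and> s = A r' c' \<or> c = c' \<and> s = A r' c'" for r' c'
  proof
    assume "(r', c') \<in> Y"
    then have "{Row r', Col c', Sym (A r' c')} \<in> cell_edge A ` Y" by (force simp: cell_edge_def)
    then have "{Row r, Col c, Sym s} \<noteq> {Row r', Col c', Sym (A r' c')}"
      "\<not> conflict {Row r, Col c, Sym s} {Row r', Col c', Sym (A r' c')}"
      using e unfolding available_def by blast+
    then show False using that unfolding conflict_iff triple_eq_iff by auto
  qed
  show "(r, c) \<in> cells n - Y" using rcs free by (auto simp: cells_def)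
  obtain c' where c': "c' \<in> {1..n}" "A r c' = s" using latin_array_row_surj[OF A rcs(1,3)] .
  have "A (symbol_row n A c s) c = s" by (rule symbol_row(2)[OF A rcs(2,3)])
  then have "blockers n A (r, c, c') \<inter> Y = {}"
    using free[of r c] free[of r c'] free[of "symbol_row n A c s" c] c' by (auto simp: blockers_def)
  then show "A r c = s \<or> (\<exists>c'. (r, c, c') \<in> triples n \<and> s = A r c' \<and> blockers n A (r, c, c') \<inter> Y = {})"
    using c' rcs by (cases "c = c'") (auto simp: triples_def)
qed

lemma card_available_le:
  assumes A: "latin_array n A" and Y: "Y \<subseteq> cells n"
  shows "real (card (available (complete_tripartite n) (cell_edge A ` Y))) \<le>
    real (n\<^sup>2 - card Y) + open_triples n A Y"
proof -
  let ?Z = "{z \<in> triples n. blockers n A z \<inter> Y = {}}"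
  let ?f = "\<lambda>(r, c, c'). {Row r, Col c, Sym (A r c')}"
  have "available (complete_tripartite n) (cell_edge A ` Y) \<subseteq> cell_edge A ` (cells n - Y) \<union> ?f ` ?Z"
  proof
    fix e assume e: "e \<in> available (complete_tripartite n) (cell_edge A ` Y)"
    then obtain r c s where rcs: "e = {Row r, Col c, Sym s}"
      unfolding available_def complete_tripartite_def by blast
    note cases = available_cases[OF A Y e[unfolded rcs]]
    from cases(2) show "e \<in> cell_edge A ` (cells n - Y) \<union> ?f ` ?Z"
    proof
      assume "A r c = s"
      then have "e = cell_edge A (r, c)" by (simp add: rcs cell_edge_def)
      then show ?thesis using cases(1) by blast
    next
      assume "\<exists>c'. (r, c, c') \<in> triples n \<and> s = A r c' \<and> blockers n A (r, c, c') \<inter> Y = {}"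
      then obtain c' where c': "(r, c, c') \<in> ?Z" "s = A r c'" by auto
      then have "e = ?f (r, c, c')" by (simp add: rcs)
      then show ?thesis using c'(1) by blast
    qed
  qed
  then have "card (available (complete_tripartite n) (cell_edge A ` Y)) \<le> card (cell_edge A ` (cells n - Y) \<union> ?f ` ?Z)"
    by (rule card_mono[rotated]) (simp add: finite_cells finite_triples)
  also have "\<dots> \<le> card (cell_edge A ` (cells n - Y)) + card (?f ` ?Z)" by (rule card_Un_le)
  also have "\<dots> \<le> card (cells n - Y) + card ?Z"
    by (intro add_mono card_image_le) (simp_all add: finite_cells finite_triples)
  also have "card (cells n - Y) = n\<^sup>2 - card Y"
    using Y finite_cells[of n] finite_subset by (subst card_Diff_subset) (auto simp: card_cells)
  finally show ?thesis unfolding count_avoiding_def of_nat_add[symmetric] by (rule of_nat_mono)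
qed

section \<open>Filling the remaining cells\<close>

definition choices :: "nat \<Rightarrow> hypergraph \<Rightarrow> nat \<times> nat \<Rightarrow> hypergraph" where
  "choices n S x = {e \<in> available (complete_tripartite n) S. Row (fst x) \<in> e \<and> Col (snd x) \<in> e}"

text \<open>The summand 1 stands for the square's own symbol, so the logarithm of the bound is never
  negative.\<close>

definition choice_bound :: "nat \<Rightarrow> (nat \<Rightarrow> nat \<Rightarrow> nat) \<Rightarrow> (nat \<times> nat) set \<Rightarrow> nat \<times> nat \<Rightarrow> real" where
  "choice_bound n A Y x =
     1 + real (card {c'. (fst x, snd x, c') \<in> triples n \<and> blockers n A (fst x, snd x, c') \<inter> Y = {}})"

lemma card_choices_le:
  assumes A: "latin_array n A" and Y: "Y \<subseteq> cells n"
  shows "real (card (choices n (cell_edge A ` Y) x)) \<le> choice_bound n A Y x"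
proof -
  obtain r c where x: "x = (r, c)" by (cases x)
  let ?C = "{c'. (r, c, c') \<in> triples n \<and> blockers n A (r, c, c') \<inter> Y = {}}"
  have fin: "finite ?C" by (rule finite_subset[of _ "{1..n}"]) (auto simp: triples_def)
  have "choices n (cell_edge A ` Y) x \<subseteq> insert (cell_edge A x) ((\<lambda>c'. {Row r, Col c, Sym (A r c')}) ` ?C)"
  proof
    fix e assume e: "e \<in> choices n (cell_edge A ` Y) x"
    then obtain r' c' s where e': "e = {Row r', Col c', Sym s}"
      unfolding choices_def available_def complete_tripartite_def by blast
    then have rc: "r' = r" "c' = c" using e unfolding choices_def x by auto
    have "{Row r, Col c, Sym s} \<in> available (complete_tripartite n) (cell_edge A ` Y)"
      using e unfolding choices_def e' rc by blast
    from available_cases(2)[OF A Y this] show "e \<in> insert (cell_edge A x) ((\<lambda>c'. {Row r, Col c, Sym (A r c')}) ` ?C)"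
    proof
      assume "A r c = s"
      then have "e = cell_edge A x" by (simp add: e' rc x cell_edge_def)
      then show ?thesis by simp
    next
      assume "\<exists>c'. (r, c, c') \<in> triples n \<and> s = A r c' \<and> blockers n A (r, c, c') \<inter> Y = {}"
      then obtain c' where "c' \<in> ?C" "e = {Row r, Col c, Sym (A r c')}" unfolding e' rc by blast
      then show ?thesis by blast
    qed
  qed
  then have "card (choices n (cell_edge A ` Y) x) \<le> card (insert (cell_edge A x) ((\<lambda>c'. {Row r, Col c, Sym (A r c')}) ` ?C))"
    by (rule card_mono[rotated]) (simp add: fin)
  also have "\<dots> \<le> Suc (card ?C)"
    using card_image_le[OF fin, of "\<lambda>c'. {Row r, Col c, Sym (A r c')}"] fin by (simp add: card_insert_if)
  finally show ?thesis unfolding choice_bound_def x by simp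
qed

lemma choice_bound_ge_1: "1 \<le> choice_bound n A Y x"
  by (simp add: choice_bound_def)

text \<open>The probability that filling the empty cells of \<open>S\<close> in the given order, each with a uniformly
  chosen available symbol, produces the array \<open>A\<close>.\<close>

primrec fill_prob :: "nat \<Rightarrow> (nat \<Rightarrow> nat \<Rightarrow> nat) \<Rightarrow> (nat \<times> nat) list \<Rightarrow> hypergraph \<Rightarrow> real" where
  "fill_prob n A [] S = 1"
| "fill_prob n A (x # xs) S =
     (if cell_edge A x \<in> S then fill_prob n A xs S
      else fill_prob n A xs (insert (cell_edge A x) S) / real (card (choices n S x)))"

lemma fill_prob_nonneg: "0 \<le> fill_prob n A xs S"
  by (induction xs arbitrary: S) auto

text \<open>\<open>choices\<close> depends only on the partial square S. The values for different
  squares are therefore probabilities of disjoint outcomes of one filling process.\<close>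

lemma sum_fill_prob_le_1:
  assumes "finite F" and arr: "\<And>L. L \<in> F \<Longrightarrow> latin_array n (arr L) \<and> L = array_hypergraph n (arr L)"
    and "\<And>L. L \<in> F \<Longrightarrow> S \<subseteq> L" "set xs \<subseteq> cells n"
    and "\<And>L x. L \<in> F \<Longrightarrow> x \<in> cells n - set xs \<Longrightarrow> cell_edge (arr L) x \<in> S"
  shows "(\<Sum>L\<in>F. fill_prob n (arr L) xs S) \<le> 1"
  using assms
proof (induction xs arbitrary: S F)
  case Nil
  have "L = S" if "L \<in> F" for L
  proof -
    have "cell_edge (arr L) ` cells n \<subseteq> S" using Nil(5)[OF that] by auto
    moreover have "L = cell_edge (arr L) ` cells n" using Nil(2)[OF that] array_hypergraph_eq by simp
    ultimately show ?thesis using Nil(3)[OF that] by simp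
  qed
  then have "F \<subseteq> {S}" by blast
  then have "card F \<le> 1" using card_mono[of "{S}" F] by simp
  then show ?case by simp
next
  case (Cons x xs)
  have x: "x \<in> cells n" using Cons.prems(4) by simp
  show ?case
  proof (cases "\<exists>L\<in>F. cell_edge (arr L) x \<in> S")
    case True
    then obtain L0 where L0: "L0 \<in> F" "cell_edge (arr L0) x \<in> S" by blast
    \<comment> \<open>All squares of F contain S, so they agree on the cell x as soon as one of them
      has its hyperedge in S.\<close>
    have covered: "cell_edge (arr L) x \<in> S" if L: "L \<in> F" for L
    proof -
      have "cell_edge (arr L0) x \<in> array_hypergraph n (arr L)" using L0(2) Cons.prems(2,3)[OF L] by blast
      then obtain y where y: "cell_edge (arr L0) x = cell_edge (arr L) y" unfolding array_hypergraph_eq by blast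
      then have "x = y" by (auto simp: cell_edge_def triple_eq_iff prod_eq_iff)
      then show ?thesis using y L0(2) by simp
    qed
    then have "(\<Sum>L\<in>F. fill_prob n (arr L) (x # xs) S) = (\<Sum>L\<in>F. fill_prob n (arr L) xs S)" by simp
    also have "\<dots> \<le> 1"
    proof (rule Cons.IH)
      show "cell_edge (arr L) y \<in> S" if "L \<in> F" "y \<in> cells n - set xs" for L y
        using that covered Cons.prems(5)[of L y] by (cases "y = x") auto
    qed (use Cons.prems in auto)
    finally show ?thesis .
  next
    case False
    let ?e = "\<lambda>L. cell_edge (arr L) x" and ?C = "choices n S x"
    have finC: "finite ?C" unfolding choices_def available_def using finite_complete_tripartite by simp
    have in_C: "?e L \<in> ?C" if L: "L \<in> F" for L
    proof -
      have "S \<subseteq> cell_edge (arr L) ` cells n" using Cons.prems(2,3)[OF L] array_hypergraph_eq by metis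
      then obtain Y where Y: "Y \<subseteq> cells n" "S = cell_edge (arr L) ` Y" by (metis subset_imageE)
      have "?e L \<in> available (complete_tripartite n) S"
        unfolding Y(2) by (rule cell_edge_available) (use Cons.prems(2)[OF L] Y x False L in auto)
      then show ?thesis unfolding choices_def by (simp add: cell_edge_def)
    qed
    have "(\<Sum>L\<in>F. fill_prob n (arr L) (x # xs) S) =
      (\<Sum>L\<in>F. fill_prob n (arr L) xs (insert (?e L) S)) / real (card ?C)"
      using False by (simp add: sum_divide_distrib)
    also have "(\<Sum>L\<in>F. fill_prob n (arr L) xs (insert (?e L) S)) =
      (\<Sum>e\<in>?C. \<Sum>L | L \<in> F \<and> ?e L = e. fill_prob n (arr L) xs (insert (?e L) S))"
      using in_C finC Cons.prems(1) by (intro sum.group[symmetric]) auto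
    also have "\<dots> = (\<Sum>e\<in>?C. \<Sum>L | L \<in> F \<and> ?e L = e. fill_prob n (arr L) xs (insert e S))"
      by (intro sum.cong) auto
    also have "\<dots> \<le> (\<Sum>e\<in>?C. 1)"
    proof (intro sum_mono Cons.IH)
      fix e L assume L: "L \<in> {L. L \<in> F \<and> ?e L = e}"
      have "?e L \<in> L" using Cons.prems(2)[of L] L x array_hypergraph_eq by blast
      then show "insert e S \<subseteq> L" using L Cons.prems(3) by blast
      show "cell_edge (arr L) y \<in> insert e S" if "y \<in> cells n - set xs" for y
        using that L Cons.prems(5)[of L y] by (cases "y = x") auto
    qed (use Cons.prems in auto)
    finally show ?thesis by (cases "card ?C = 0") (auto simp: divide_right_mono)
  qed
qed

text \<open>If \<open>R\<close> is the order in which the cells are listed, then \<open>{y \<in> set xs. R y x}\<close> consists of the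
  cells filled before \<open>x\<close>.\<close>

lemma fill_prob_ge:
  assumes A: "latin_array n A" and R: "\<And>x y. R x y \<Longrightarrow> \<not> R y x"
  shows "Y \<subseteq> cells n \<Longrightarrow> set xs \<subseteq> cells n \<Longrightarrow> distinct xs \<Longrightarrow> sorted_wrt R xs \<Longrightarrow>
    exp (- (\<Sum>x\<in>set xs - Y. ln (choice_bound n A (Y \<union> {y \<in> set xs. R y x}) x))) \<le>
    fill_prob n A xs (cell_edge A ` Y)"
proof (induction xs arbitrary: Y)
  case (Cons x xs)
  let ?g = "\<lambda>Y u. ln (choice_bound n A (Y \<union> {y \<in> set (x # xs). R y u}) u)"
  have first: "{y \<in> set (x # xs). R y x} = {}"
  proof -
    have "\<not> R y x" if "y \<in> set (x # xs)" for y
    proof -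
      have "y = x \<or> R x y" using that Cons.prems(4) by auto
      then show ?thesis using R by blast
    qed
    then show ?thesis by blast
  qed
  have later: "insert x Y \<union> {y \<in> set xs. R y u} = Y \<union> {y \<in> set (x # xs). R y u}" if "u \<in> set xs" for u
    using Cons.prems(4) that by auto
  show ?case
  proof (cases "x \<in> Y")
    case True
    have "(\<Sum>u\<in>set (x # xs) - Y. ?g Y u) = (\<Sum>u\<in>set xs - Y. ln (choice_bound n A (Y \<union> {y \<in> set xs. R y u}) u))"
    proof (rule sum.cong)
      fix u assume "u \<in> set xs - Y"
      then have "Y \<union> {y \<in> set (x # xs). R y u} = Y \<union> {y \<in> set xs. R y u}" using True by auto
      then show "?g Y u = ln (choice_bound n A (Y \<union> {y \<in> set xs. R y u}) u)" by simp
    qed (use True in auto)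
    then show ?thesis using Cons.IH[of Y] Cons.prems True by (simp add: cell_edge_in_image)
  next
    case False
    let ?Y = "insert x Y"
    have "set (x # xs) - Y = insert x (set xs - ?Y)" "x \<notin> set xs - ?Y"
      using False Cons.prems(3) by auto
    then have "(\<Sum>u\<in>set (x # xs) - Y. ?g Y u) = ?g Y x + (\<Sum>u\<in>set xs - ?Y. ?g Y u)" by simp
    also have "(\<Sum>u\<in>set xs - ?Y. ?g Y u) =
      (\<Sum>u\<in>set xs - ?Y. ln (choice_bound n A (?Y \<union> {y \<in> set xs. R y u}) u))"
      using later by (intro sum.cong) auto
    also have "?g Y x = ln (choice_bound n A Y x)" unfolding first by simp
    finally have "exp (- (\<Sum>u\<in>set (x # xs) - Y. ?g Y u)) =
      exp (- (\<Sum>u\<in>set xs - ?Y. ln (choice_bound n A (?Y \<union> {y \<in> set xs. R y u}) u))) / choice_bound n A Y x"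
      using choice_bound_ge_1[of n A Y x] by (simp add: exp_diff exp_minus exp_add field_simps)
    also have "\<dots> \<le> fill_prob n A xs (cell_edge A ` ?Y) / choice_bound n A Y x"
      using Cons.IH[of ?Y] Cons.prems choice_bound_ge_1[of n A Y x] by (intro divide_right_mono) auto
    also have "\<dots> \<le> fill_prob n A xs (cell_edge A ` ?Y) / real (card (choices n (cell_edge A ` Y) x))"
    proof (rule divide_left_mono[OF card_choices_le[OF A Cons.prems(1)] fill_prob_nonneg])
      have "cell_edge A x \<in> choices n (cell_edge A ` Y) x"
        using cell_edge_available[OF A Cons.prems(1) _ False] Cons.prems(2)
        by (simp add: choices_def cell_edge_def)
      moreover have "finite (choices n (cell_edge A ` Y) x)"
        unfolding choices_def available_def using finite_complete_tripartite by simp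
      ultimately have "0 < card (choices n (cell_edge A ` Y) x)" by (auto simp: card_gt_0_iff)
      then show "0 < choice_bound n A Y x * real (card (choices n (cell_edge A ` Y) x))"
        using choice_bound_ge_1[of n A Y x] by simp
    qed
    finally show ?thesis using False by (simp add: cell_edge_in_image)
  qed
qed simp

section \<open>Random filling orders\<close>

abbreviation perms :: "nat \<Rightarrow> (nat \<Rightarrow> nat) set" where
  "perms n \<equiv> {\<sigma>. \<sigma> permutes {1..n}}"

lemma finite_perms: "finite (perms n)" by (rule finite_permutations) simp

lemma card_perms: "card (perms n) = fact n" by (rule card_permutations) auto

text \<open>Composing with a permutation q that moves r to u and \<open>r'\<close> to
  \<open>u'\<close> is injective. After the first transposition has moved r, the element
  \<open>r'\<close> sits at w, which the second one sends to \<open>u'\<close>.\<close>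

lemma card_perms_pair_le:
  assumes "r \<in> S" "r' \<in> S" "r \<noteq> r'" "u \<in> S" "u' \<in> S" "u \<noteq> u'" "finite S"
  shows "card {\<sigma>. \<sigma> permutes S \<and> \<sigma> a = r \<and> \<sigma> a' = r'} \<le> card {\<sigma>. \<sigma> permutes S \<and> \<sigma> a = u \<and> \<sigma> a' = u'}"
proof (rule card_inj_on_le)
  define w where "w = Transposition.transpose r u r'"
  define q where "q = Transposition.transpose w u' \<circ> Transposition.transpose r u"
  have w: "w \<in> S" "w \<noteq> u" using assms unfolding w_def by (auto simp: Transposition.transpose_def)
  have q: "q permutes S" unfolding q_def using assms w by (intro permutes_compose permutes_swap_id)
  have "q r = u" "q r' = u'" using assms w unfolding q_def by (auto simp: w_def[symmetric])
  then show "(\<lambda>\<sigma>. q \<circ> \<sigma>) ` {\<sigma>. \<sigma> permutes S \<and> \<sigma> a = r \<and> \<sigma> a' = r'} \<subseteq> {\<sigma>. \<sigma> permutes S \<and> \<sigma> a = u \<and> \<sigma> a' = u'}"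
    using q permutes_compose by auto
  show "inj_on (\<lambda>\<sigma>. q \<circ> \<sigma>) {\<sigma>. \<sigma> permutes S \<and> \<sigma> a = r \<and> \<sigma> a' = r'}"
    using permutes_inj[OF q] by (intro inj_onI) (auto simp: fun_eq_iff inj_eq)
  show "finite {\<sigma>. \<sigma> permutes S \<and> \<sigma> a = u \<and> \<sigma> a' = u'}"
    using finite_permutations[OF assms(7)] by simp
qed

lemma card_perms_pair:
  assumes "a \<in> {1..n}" "a' \<in> {1..n}" "a \<noteq> a'" "r \<in> {1..n}" "r' \<in> {1..n}" "r \<noteq> r'"
  shows "card {\<sigma> \<in> perms n. \<sigma> a = r \<and> \<sigma> a' = r'} * (n * (n - 1)) = card (perms n)"
proof -
  define Q where "Q = (SIGMA u:{1..n}. {1..n} - {u})"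
  define C where "C = (\<lambda>(u, u'). {\<sigma> \<in> perms n. \<sigma> a = u \<and> \<sigma> a' = u'})"
  have "card (C p) = card (C (r, r'))" if "p \<in> Q" for p
    using that assms unfolding Q_def C_def by (auto intro!: le_antisym card_perms_pair_le)
  then have "card (C (r, r')) * card Q = (\<Sum>p\<in>Q. card (C p))" by simp
  also have "\<dots> = card (\<Union>p\<in>Q. C p)"
    using finite_perms[of n] by (intro card_UN_disjoint[symmetric]) (auto simp: Q_def C_def)
  also have "(\<Union>p\<in>Q. C p) = perms n"
  proof -
    have "(\<sigma> a, \<sigma> a') \<in> Q" if "\<sigma> permutes {1..n}" for \<sigma>
      using permutes_in_image[OF that] assms permutes_inj[OF that] unfolding Q_def by (auto simp: inj_eq)
    then show ?thesis unfolding C_def by auto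
  qed
  finally show ?thesis unfolding C_def Q_def by (simp add: card_SigmaI)
qed

lemma card_perms_after:
  assumes "2 \<le> n" "a \<in> {1..n}" "r \<in> {1..n}" "r' \<in> {1..n}" "r \<noteq> r'"
  shows "real (card {\<sigma> \<in> perms n. \<sigma> a = r \<and> a < inv \<sigma> r'}) =
    real (card (perms n)) * real (n - a) / (real n * real (n - 1))"
proof -
  have inv: "\<sigma> a' = r' \<longleftrightarrow> a' = inv \<sigma> r'" if "\<sigma> permutes {1..n}" for \<sigma> a'
    using permutes_inverses[OF that] by metis
  have inv': "inv \<sigma> (\<sigma> a') = a'" if "\<sigma> permutes {1..n}" for \<sigma> a'
    using permutes_inverses[OF that] by simp
  have "{\<sigma> \<in> perms n. \<sigma> a = r \<and> a < inv \<sigma> r'} = (\<Union>a'\<in>{a<..n}. {\<sigma> \<in> perms n. \<sigma> a = r \<and> \<sigma> a' = r'})"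
  proof (intro equalityI subsetI)
    fix \<sigma> assume s: "\<sigma> \<in> {\<sigma> \<in> perms n. \<sigma> a = r \<and> a < inv \<sigma> r'}"
    then have "inv \<sigma> r' \<in> {1..n}" using permutes_in_image[OF permutes_inv, of \<sigma>] assms(4) by blast
    then show "\<sigma> \<in> (\<Union>a'\<in>{a<..n}. {\<sigma> \<in> perms n. \<sigma> a = r \<and> \<sigma> a' = r'})"
      using s inv[of \<sigma> "inv \<sigma> r'"] by (intro UN_I[of "inv \<sigma> r'"]) auto
  qed (use inv' in auto)
  also have "card \<dots> = (\<Sum>a'\<in>{a<..n}. card {\<sigma> \<in> perms n. \<sigma> a = r \<and> \<sigma> a' = r'})"
  proof (intro card_UN_disjoint ballI impI)
    fix a1 a2 :: nat assume "a1 \<noteq> a2"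
    moreover have "a1 = a2" if "\<sigma> \<in> perms n" "\<sigma> a1 = r'" "\<sigma> a2 = r'" for \<sigma>
      using inv'[of \<sigma> a1] inv'[of \<sigma> a2] that by simp
    ultimately show "{\<sigma> \<in> perms n. \<sigma> a = r \<and> \<sigma> a1 = r'} \<inter> {\<sigma> \<in> perms n. \<sigma> a = r \<and> \<sigma> a2 = r'} = {}"
      by blast
  qed (use finite_perms[of n] in auto)
  finally have "real (card {\<sigma> \<in> perms n. \<sigma> a = r \<and> a < inv \<sigma> r'}) =
    (\<Sum>a'\<in>{a<..n}. real (card {\<sigma> \<in> perms n. \<sigma> a = r \<and> \<sigma> a' = r'}))" by simp
  also have "\<dots> = (\<Sum>a'\<in>{a<..n}. real (card (perms n)) / (real n * real (n - 1)))"
  proof (rule sum.cong[OF refl])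
    fix a' assume a': "a' \<in> {a<..n}"
    have "real (card {\<sigma> \<in> perms n. \<sigma> a = r \<and> \<sigma> a' = r'}) * (real n * real (n - 1)) = real (card (perms n))"
      unfolding of_nat_mult[symmetric] by (subst card_perms_pair) (use a' assms in auto)
    then show "real (card {\<sigma> \<in> perms n. \<sigma> a = r \<and> \<sigma> a' = r'}) = real (card (perms n)) / (real n * real (n - 1))"
      using assms(1) by (simp add: field_simps)
  qed
  finally show ?thesis unfolding sum_constant card_greaterThanAtMost
    by (simp only: times_divide_eq_right mult.commute[of "real (n - a)"])
qed

lemma card_perms_point:
  assumes "2 \<le> n" "a \<in> {1..n}" "r \<in> {1..n}"
  shows "real (card {\<sigma> \<in> perms n. \<sigma> a = r}) = real (card (perms n)) / real n"
proof -
  obtain a' where a': "a' \<in> {1..n}" "a \<noteq> a'"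
    using assms by (intro that[of "if a = 1 then 2 else 1"]) auto
  have "{\<sigma> \<in> perms n. \<sigma> a = r} = (\<Union>r'\<in>{1..n}-{r}. {\<sigma> \<in> perms n. \<sigma> a = r \<and> \<sigma> a' = r'})"
  proof -
    have "\<sigma> a' \<in> {1..n}" "\<sigma> a' \<noteq> \<sigma> a" if "\<sigma> permutes {1..n}" for \<sigma>
      using permutes_in_image[OF that] a' permutes_inj[OF that] by (auto simp: inj_eq)
    note a'_mem = this
    show ?thesis
    proof (intro equalityI subsetI)
      fix \<sigma> assume "\<sigma> \<in> {\<sigma> \<in> perms n. \<sigma> a = r}"
      then have p: "\<sigma> \<in> perms n" "\<sigma> a = r" by auto
      then have "\<sigma> permutes {1..n}" by simp
      from a'_mem[OF this] have "\<sigma> a' \<in> {1..n} - {r}" using p(2) by simp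
      then show "\<sigma> \<in> (\<Union>r'\<in>{1..n}-{r}. {\<sigma> \<in> perms n. \<sigma> a = r \<and> \<sigma> a' = r'})"
        using p by blast
    qed blast
  qed
  also have "card \<dots> = (\<Sum>r'\<in>{1..n}-{r}. card {\<sigma> \<in> perms n. \<sigma> a = r \<and> \<sigma> a' = r'})"
    using finite_perms[of n] by (intro card_UN_disjoint) auto
  finally have "card {\<sigma> \<in> perms n. \<sigma> a = r} * (n * (n - 1)) =
    (\<Sum>r'\<in>{1..n}-{r}. card {\<sigma> \<in> perms n. \<sigma> a = r \<and> \<sigma> a' = r'} * (n * (n - 1)))"
    by (simp add: sum_distrib_right)
  also have "\<dots> = (\<Sum>r'\<in>{1..n}-{r}. card (perms n))"
    by (intro sum.cong refl card_perms_pair) (use assms a' in auto)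
  also have "\<dots> = (n - 1) * card (perms n)" using assms(3) by simp
  finally have "card {\<sigma> \<in> perms n. \<sigma> a = r} * n = card (perms n)" using assms(1) by simp
  then have "real (card {\<sigma> \<in> perms n. \<sigma> a = r}) * real n = real (card (perms n))"
    unfolding of_nat_mult[symmetric] by (rule arg_cong)
  then show ?thesis using assms(1) by (simp add: field_simps)
qed

text \<open>The permutations map positions to rows and columns, so their inverses give the time of a
  row or column; cells are compared lexicographically.\<close>

definition fill_before :: "(nat \<Rightarrow> nat) \<Rightarrow> (nat \<Rightarrow> nat) \<Rightarrow> nat \<times> nat \<Rightarrow> nat \<times> nat \<Rightarrow> bool" where
  "fill_before \<sigma> \<tau> y x \<longleftrightarrow> inv \<sigma> (fst y) < inv \<sigma> (fst x) \<or>
     inv \<sigma> (fst y) = inv \<sigma> (fst x) \<and> inv \<tau> (snd y) < inv \<tau> (snd x)"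

definition fill_order :: "nat \<Rightarrow> (nat \<Rightarrow> nat) \<Rightarrow> (nat \<Rightarrow> nat) \<Rightarrow> (nat \<times> nat) list" where
  "fill_order n \<sigma> \<tau> = map (map_prod \<sigma> \<tau>) (List.product [1..<Suc n] [1..<Suc n])"

lemma sorted_wrt_product:
  assumes "sorted_wrt P xs" "sorted_wrt Q ys"
  shows "sorted_wrt (\<lambda>u v. P (fst u) (fst v) \<or> fst u = fst v \<and> Q (snd u) (snd v)) (List.product xs ys)"
  using assms(1)
proof (induction xs)
  case (Cons x xs)
  have "sorted_wrt (\<lambda>u v. P (fst u) (fst v) \<or> fst u = fst v \<and> Q (snd u) (snd v)) (map (Pair x) ys)"
    unfolding sorted_wrt_map by (rule sorted_wrt_mono_rel[OF _ assms(2)]) simp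
  then show ?case using Cons by (auto simp: sorted_wrt_append)
qed simp

lemma fill_order:
  assumes "\<sigma> permutes {1..n}" "\<tau> permutes {1..n}"
  shows "set (fill_order n \<sigma> \<tau>) = cells n" "distinct (fill_order n \<sigma> \<tau>)"
    "sorted_wrt (fill_before \<sigma> \<tau>) (fill_order n \<sigma> \<tau>)"
proof -
  have "set (fill_order n \<sigma> \<tau>) = map_prod \<sigma> \<tau> ` ({1..n} \<times> {1..n})"
    by (simp add: fill_order_def atLeastLessThanSuc_atLeastAtMost del: upt_Suc)
  also have "\<dots> = (\<sigma> ` {1..n}) \<times> (\<tau> ` {1..n})" by (rule map_prod_surj_on[OF refl refl])
  also have "\<dots> = cells n" by (simp only: cells_def permutes_image[OF assms(1)] permutes_image[OF assms(2)])
  finally show "set (fill_order n \<sigma> \<tau>) = cells n" .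
  have "inj (map_prod \<sigma> \<tau>)" using assms permutes_inj by (blast intro: prod.inj_map)
  then show "distinct (fill_order n \<sigma> \<tau>)"
    unfolding fill_order_def distinct_map
    by (auto simp: distinct_product intro: inj_on_subset simp del: upt_Suc)
  have s: "sorted_wrt (<) [1..<Suc n]" by (rule sorted_wrt_upt)
  show "sorted_wrt (fill_before \<sigma> \<tau>) (fill_order n \<sigma> \<tau>)"
    unfolding fill_order_def sorted_wrt_map
    by (rule sorted_wrt_mono_rel[OF _ sorted_wrt_product[OF s s]])
       (simp add: fill_before_def permutes_inverses[OF assms(1)] permutes_inverses[OF assms(2)])
qed

section \<open>Average cost of the filling\<close>

lemma sum_ln_le:
  assumes "finite S" "\<And>i. i \<in> S \<Longrightarrow> 0 < x i"
  shows "(\<Sum>i\<in>S. ln (x i)) \<le> real (card S) * ln ((\<Sum>i\<in>S. x i) / real (card S))"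
proof (cases "S = {}")
  case False
  then have c: "0 < real (card S)" using assms(1) by (simp add: card_gt_0_iff)
  have "(\<Sum>i\<in>S. 1 / real (card S) * ln (x i)) \<le> ln (\<Sum>i\<in>S. (1 / real (card S)) *\<^sub>R x i)"
    by (intro concave_on_sum[OF _ _ ln_concave]) (use assms False c in auto)
  then show ?thesis using c by (simp add: field_simps flip: sum_divide_distrib)
qed simp

definition fill_cost :: "nat \<Rightarrow> (nat \<Rightarrow> nat \<Rightarrow> nat) \<Rightarrow> (nat \<times> nat) set \<Rightarrow> (nat \<Rightarrow> nat) \<Rightarrow> (nat \<Rightarrow> nat) \<Rightarrow> real" where
  "fill_cost n A Y \<sigma> \<tau> =
     (\<Sum>x\<in>cells n - Y. ln (choice_bound n A (Y \<union> {y \<in> cells n. fill_before \<sigma> \<tau> y x}) x))"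

text \<open>The triples competing for the cell \<open>(\<sigma> a, \<tau> b)\<close> at the time it is filled.\<close>

definition competitors :: "nat \<Rightarrow> (nat \<Rightarrow> nat \<Rightarrow> nat) \<Rightarrow> (nat \<times> nat) set \<Rightarrow> (nat \<Rightarrow> nat) \<Rightarrow> (nat \<Rightarrow> nat) \<Rightarrow>
    nat \<Rightarrow> nat \<Rightarrow> (nat \<times> nat \<times> nat) set" where
  "competitors n A Y \<sigma> \<tau> a b = {(r, c, c'). (r, c, c') \<in> triples n \<and> blockers n A (r, c, c') \<inter> Y = {} \<and>
     (\<sigma> a = r \<and> a < inv \<sigma> (symbol_row n A c (A r c'))) \<and> (\<tau> b = c \<and> b < inv \<tau> c')}"

lemma finite_competitors: "finite (competitors n A Y \<sigma> \<tau> a b)"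
  by (rule finite_subset[OF _ finite_triples[of n]]) (auto simp: competitors_def)

text \<open>The row by row order separates the constraints. The second blocker lies in the same row
  as the cell, so it is still empty only if its column comes later; the third lies in the same
  column, and its row must come later. Thus one condition involves only \<tau> and the other only
  \<sigma>.\<close>

lemma choice_bound_le_competitors:
  assumes A: "latin_array n A" and perm: "\<sigma> permutes {1..n}" "\<tau> permutes {1..n}"
  shows "choice_bound n A (Y \<union> {y \<in> cells n. fill_before \<sigma> \<tau> y (\<sigma> a, \<tau> b)}) (\<sigma> a, \<tau> b)
    \<le> 1 + real (card (competitors n A Y \<sigma> \<tau> a b))"
proof -
  let ?E = "{y \<in> cells n. fill_before \<sigma> \<tau> y (\<sigma> a, \<tau> b)}"
  let ?C = "{c'. (\<sigma> a, \<tau> b, c') \<in> triples n \<and> blockers n A (\<sigma> a, \<tau> b, c') \<inter> (Y \<union> ?E) = {}}"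
  have inv: "inv \<sigma> (\<sigma> a) = a" "inv \<tau> (\<tau> b) = b"
    using permutes_inverses[OF perm(1)] permutes_inverses[OF perm(2)] by auto
  have inj: "inj (inv \<sigma>)" "inj (inv \<tau>)" using perm permutes_inv permutes_inj by blast+
  have "(\<lambda>c'. (\<sigma> a, \<tau> b, c')) ` ?C \<subseteq> competitors n A Y \<sigma> \<tau> a b"
  proof (rule image_subsetI)
    fix c' assume c': "c' \<in> ?C"
    let ?r = "symbol_row n A (\<tau> b) (A (\<sigma> a) c')"
    have rc: "\<sigma> a \<in> {1..n}" "\<tau> b \<in> {1..n}" "c' \<in> {1..n}" "\<tau> b \<noteq> c'" using c' by (auto simp: triples_def)
    have r: "?r \<in> {1..n}" "?r \<noteq> \<sigma> a"
      using symbol_row(1)[OF A rc(2) latin_array_range[OF A rc(1,3)]] symbol_row_neq[OF A rc] by auto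
    have "(\<sigma> a, c') \<notin> ?E" "(?r, \<tau> b) \<notin> ?E" using c' unfolding blockers_def by auto
    then have "\<not> fill_before \<sigma> \<tau> (\<sigma> a, c') (\<sigma> a, \<tau> b)" "\<not> fill_before \<sigma> \<tau> (?r, \<tau> b) (\<sigma> a, \<tau> b)"
      using rc r by (auto simp: cells_def)
    then have "b \<le> inv \<tau> c'" "a \<le> inv \<sigma> ?r" by (auto simp: fill_before_def inv not_less)
    moreover have "inv \<tau> c' \<noteq> b" "inv \<sigma> ?r \<noteq> a" using inj inv rc r by (metis inj_eq)+
    ultimately show "(\<sigma> a, \<tau> b, c') \<in> competitors n A Y \<sigma> \<tau> a b"
      using c' unfolding competitors_def by auto
  qed
  then have "card ((\<lambda>c'. (\<sigma> a, \<tau> b, c')) ` ?C) \<le> card (competitors n A Y \<sigma> \<tau> a b)"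
    by (rule card_mono[OF finite_competitors])
  moreover have "card ((\<lambda>c'. (\<sigma> a, \<tau> b, c')) ` ?C) = card ?C" by (intro card_image inj_onI) auto
  ultimately show ?thesis unfolding choice_bound_def by simp
qed

text \<open>For a fixed triple the indicator is a product of a function of \<sigma> and a function
  of \<tau>, so the double sum factorizes. Each factor asks for one element in a given position and
  another one in a later position.\<close>

lemma sum_competitors:
  assumes A: "latin_array n A" and n: "2 \<le> n" and ab: "a \<in> {1..n}" "b \<in> {1..n}"
  shows "(\<Sum>\<sigma>\<in>perms n. \<Sum>\<tau>\<in>perms n. real (card (competitors n A Y \<sigma> \<tau> a b))) =
    (real (card (perms n)))\<^sup>2 * (real (n - a) * real (n - b) / (real n * real (n - 1))\<^sup>2) * open_triples n A Y"
proof -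
  let ?Z = "{z \<in> triples n. blockers n A z \<inter> Y = {}}"
  define f where "f \<sigma> = (\<lambda>(r, c, c'). of_bool (\<sigma> a = r \<and> a < inv \<sigma> (symbol_row n A c (A r c'))) :: real)" for \<sigma>
  define g where "g \<tau> = (\<lambda>(r :: nat, c :: nat, c' :: nat). of_bool (\<tau> b = c \<and> b < inv \<tau> c') :: real)" for \<tau>
  define q where "q = real (card (perms n)) / (real n * real (n - 1))"
  have fin: "finite ?Z" using finite_triples by simp
  have comp: "real (card (competitors n A Y \<sigma> \<tau> a b)) = (\<Sum>z\<in>?Z. f \<sigma> z * g \<tau> z)" for \<sigma> \<tau>
  proof -
    have "(\<Sum>z\<in>?Z. f \<sigma> z * g \<tau> z) = (\<Sum>z\<in>?Z. of_bool (z \<in> competitors n A Y \<sigma> \<tau> a b))"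
      by (rule sum.cong) (auto simp: f_def g_def competitors_def)
    also have "\<dots> = real (card (?Z \<inter> competitors n A Y \<sigma> \<tau> a b))" using fin by (simp add: Int_def)
    also have "?Z \<inter> competitors n A Y \<sigma> \<tau> a b = competitors n A Y \<sigma> \<tau> a b" by (auto simp: competitors_def)
    finally show ?thesis by simp
  qed
  have f: "(\<Sum>\<sigma>\<in>perms n. f \<sigma> z) = q * real (n - a)" if mem: "z \<in> ?Z" for z
  proof -
    obtain r c c' where z: "z = (r, c, c')" "r \<in> {1..n}" "c \<in> {1..n}" "c' \<in> {1..n}" "c \<noteq> c'"
      using mem by (cases z) (auto simp: triples_def)
    note s = symbol_row(1)[OF A z(3) latin_array_range[OF A z(2,4)]] symbol_row_neq[OF A z(2-5)]
    have "(\<Sum>\<sigma>\<in>perms n. f \<sigma> z) =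
        real (card {\<sigma> \<in> perms n. \<sigma> a = r \<and> a < inv \<sigma> (symbol_row n A c (A r c'))})"
      unfolding f_def z using finite_perms[of n] by (simp add: Int_def)
    then show ?thesis using card_perms_after[OF n ab(1) z(2) s(1)] s(2) by (simp add: q_def)
  qed
  have g: "(\<Sum>\<tau>\<in>perms n. g \<tau> z) = q * real (n - b)" if mem: "z \<in> ?Z" for z
  proof -
    obtain r c c' where z: "z = (r, c, c')" "c \<in> {1..n}" "c' \<in> {1..n}" "c \<noteq> c'"
      using mem by (cases z) (auto simp: triples_def)
    have "(\<Sum>\<tau>\<in>perms n. g \<tau> z) = real (card {\<tau> \<in> perms n. \<tau> b = c \<and> b < inv \<tau> c'})"
      unfolding g_def z using finite_perms[of n] by (simp add: Int_def)
    then show ?thesis using card_perms_after[OF n ab(2) z(2,3,4)] by (simp add: q_def)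
  qed
  have "(\<Sum>\<sigma>\<in>perms n. \<Sum>\<tau>\<in>perms n. real (card (competitors n A Y \<sigma> \<tau> a b))) =
    (\<Sum>\<sigma>\<in>perms n. \<Sum>z\<in>?Z. \<Sum>\<tau>\<in>perms n. f \<sigma> z * g \<tau> z)"
    unfolding comp by (intro sum.cong refl sum.swap)
  also have "\<dots> = (\<Sum>z\<in>?Z. \<Sum>\<sigma>\<in>perms n. \<Sum>\<tau>\<in>perms n. f \<sigma> z * g \<tau> z)" by (rule sum.swap)
  also have "\<dots> = (\<Sum>z\<in>?Z. (\<Sum>\<sigma>\<in>perms n. f \<sigma> z) * (\<Sum>\<tau>\<in>perms n. g \<tau> z))"
    by (simp only: sum_product)
  also have "\<dots> = (\<Sum>z\<in>?Z. q * real (n - a) * (q * real (n - b)))"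
    by (intro sum.cong refl arg_cong2[of _ _ _ _ "(*)"] f g)
  also have "\<dots> = (q * real (n - a)) * (q * real (n - b)) * open_triples n A Y"
    by (simp add: count_avoiding_def)
  finally show ?thesis by (simp add: q_def power2_eq_square)
qed

lemma sum_perms_cell:
  assumes n: "2 \<le> n" and ab: "a \<in> {1..n}" "b \<in> {1..n}" and Y: "Y \<subseteq> cells n"
  shows "(\<Sum>\<sigma>\<in>perms n. \<Sum>\<tau>\<in>perms n. of_bool ((\<sigma> a, \<tau> b) \<notin> Y)) =
    (real (card (perms n)) / real n)\<^sup>2 * real (n\<^sup>2 - card Y)"
proof -
  let ?P = "perms n"
  have mem: "(\<sigma> a, \<tau> b) \<in> cells n" if "\<sigma> \<in> ?P" "\<tau> \<in> ?P" for \<sigma> \<tau>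
    using that permutes_in_image[of \<sigma> "{1..n}" a] permutes_in_image[of \<tau> "{1..n}" b] ab by (auto simp: cells_def)
  have fin: "finite (cells n - Y)" using finite_cells by simp
  have "(\<Sum>\<sigma>\<in>?P. \<Sum>\<tau>\<in>?P. of_bool ((\<sigma> a, \<tau> b) \<notin> Y)) =
    (\<Sum>\<sigma>\<in>?P. \<Sum>\<tau>\<in>?P. \<Sum>x\<in>cells n - Y. of_bool (\<sigma> a = fst x) * of_bool (\<tau> b = snd x) :: real)"
  proof (intro sum.cong refl)
    fix \<sigma> \<tau> assume "\<sigma> \<in> ?P" "\<tau> \<in> ?P"
    note m = mem[OF this]
    have "(\<Sum>x\<in>cells n - Y. of_bool (\<sigma> a = fst x) * of_bool (\<tau> b = snd x) :: real) =
      (\<Sum>x\<in>cells n - Y. of_bool (x = (\<sigma> a, \<tau> b)))" by (intro sum.cong) auto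
    also have "\<dots> = of_bool ((\<sigma> a, \<tau> b) \<notin> Y)" using fin m by (simp add: of_bool_def)
    finally show "of_bool ((\<sigma> a, \<tau> b) \<notin> Y) = (\<Sum>x\<in>cells n - Y. of_bool (\<sigma> a = fst x) * of_bool (\<tau> b = snd x) :: real)" ..
  qed
  also have "\<dots> = (\<Sum>\<sigma>\<in>?P. \<Sum>x\<in>cells n - Y. \<Sum>\<tau>\<in>?P. of_bool (\<sigma> a = fst x) * of_bool (\<tau> b = snd x))"
    by (intro sum.cong refl sum.swap)
  also have "\<dots> = (\<Sum>x\<in>cells n - Y. \<Sum>\<sigma>\<in>?P. \<Sum>\<tau>\<in>?P. of_bool (\<sigma> a = fst x) * of_bool (\<tau> b = snd x))"
    by (rule sum.swap)
  also have "\<dots> = (\<Sum>x\<in>cells n - Y. (\<Sum>\<sigma>\<in>?P. of_bool (\<sigma> a = fst x)) * (\<Sum>\<tau>\<in>?P. of_bool (\<tau> b = snd x)))"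
    by (simp only: sum_product)
  also have "\<dots> = (\<Sum>x\<in>cells n - Y. (real (card ?P) / real n)\<^sup>2)"
  proof (rule sum.cong[OF refl])
    fix x assume "x \<in> cells n - Y"
    then have x: "fst x \<in> {1..n}" "snd x \<in> {1..n}" by (auto simp: cells_def)
    have "(\<Sum>\<sigma>\<in>?P. of_bool (\<sigma> a = fst x) :: real) = real (card {\<sigma> \<in> ?P. \<sigma> a = fst x})"
      "(\<Sum>\<tau>\<in>?P. of_bool (\<tau> b = snd x) :: real) = real (card {\<tau> \<in> ?P. \<tau> b = snd x})"
      using finite_perms[of n] by (simp_all add: Int_def)
    then show "(\<Sum>\<sigma>\<in>?P. of_bool (\<sigma> a = fst x)) * (\<Sum>\<tau>\<in>?P. of_bool (\<tau> b = snd x)) = (real (card ?P) / real n)\<^sup>2"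
      using card_perms_point[OF n ab(1) x(1)] card_perms_point[OF n ab(2) x(2)] by (simp add: power2_eq_square)
  qed
  also have "\<dots> = (real (card ?P) / real n)\<^sup>2 * real (n\<^sup>2 - card Y)"
    using Y finite_cells[of n] finite_subset[OF Y] by (simp add: card_Diff_subset card_cells)
  finally show ?thesis .
qed

text \<open>Q stands for the mean number of open triples per empty cell. Given that its cell stands
  at position (a, b), such a triple survives with probability
  \<open>(n - a) * (n - b) / (n - 1)^2\<close>; positions in the last row or column cost
  nothing.\<close>

definition fill_bound :: "nat \<Rightarrow> real \<Rightarrow> real" where
  "fill_bound n Q =
     (\<Sum>a\<in>{1..n}. \<Sum>b\<in>{1..n}. ln (1 + Q * (real (n - a) * real (n - b) / (real (n - 1))\<^sup>2)))"

text \<open>Indexing by positions (a, b) instead of cells makes the estimate independent of where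
  the empty cells are. For a fixed position Jensen's inequality is applied over all choices of
  \<sigma>, \<tau> and \<open>xs\<close> that put an empty cell there; these are a fraction
  \<open>(n^2 - m) / n^2\<close> of all.\<close>

lemma fill_cost_mean:
  assumes A: "latin_array n A" and n: "2 \<le> n" and m: "m < n\<^sup>2"
    and F: "F \<subseteq> distinct_lists (cells n) m" "F \<noteq> {}"
    and mean: "(\<Sum>xs\<in>F. open_triples n A (set xs)) \<le> real (card F) * B"
  shows "(\<Sum>\<sigma>\<in>perms n. \<Sum>\<tau>\<in>perms n. \<Sum>xs\<in>F. fill_cost n A (set xs) \<sigma> \<tau>) \<le>
    (real (card (perms n)))\<^sup>2 * real (card F) * (real (n\<^sup>2 - m) / real n ^ 2) *
    fill_bound n (B / real (n\<^sup>2 - m))"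
proof -
  let ?P = "perms n"
  define p where "p = real (card ?P)"
  define I where "I = ?P \<times> ?P \<times> F"
  have finF: "finite F" using F(1) finite_distinct_lists[OF finite_cells] finite_subset by blast
  have cF: "0 < real (card F)" using finF F(2) by (simp add: card_gt_0_iff)
  have p: "0 < p" unfolding p_def card_perms by simp
  have finI: "finite I" unfolding I_def using finite_perms finF by blast
  have flat: "(\<Sum>\<sigma>\<in>?P. \<Sum>\<tau>\<in>?P. \<Sum>xs\<in>F. h \<sigma> \<tau> xs) = (\<Sum>(\<sigma>, \<tau>, xs)\<in>I. h \<sigma> \<tau> xs)" for h :: "_ \<Rightarrow> _ \<Rightarrow> _ \<Rightarrow> real"
    unfolding I_def by (simp add: sum.cartesian_product)
  have xs: "card (set xs) = m" "set xs \<subseteq> cells n" if "xs \<in> F" for xs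
    using that F(1) by (auto simp: distinct_lists_def distinct_card)
  define J where "J a b = (\<lambda>(\<sigma>, \<tau>, xs). real (card (competitors n A (set xs) \<sigma> \<tau> a b)))" for a b
  define S where "S a b = {(\<sigma>, \<tau>, xs) \<in> I. (\<sigma> a, \<tau> b) \<notin> set xs}" for a b
  have cost: "fill_cost n A (set xs) \<sigma> \<tau> \<le>
      (\<Sum>a\<in>{1..n}. \<Sum>b\<in>{1..n}. of_bool ((\<sigma> a, \<tau> b) \<notin> set xs) * ln (1 + J a b (\<sigma>, \<tau>, xs)))"
    if "\<sigma> \<in> ?P" "\<tau> \<in> ?P" "xs \<in> F" for \<sigma> \<tau> xs
  proof -
    have perm: "\<sigma> permutes {1..n}" "\<tau> permutes {1..n}" using that by auto
    let ?h = "\<lambda>x. ln (choice_bound n A (set xs \<union> {y \<in> cells n. fill_before \<sigma> \<tau> y x}) x)"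
    have img: "map_prod \<sigma> \<tau> ` ({1..n} \<times> {1..n}) = cells n"
      unfolding map_prod_surj_on[OF refl refl] by (simp only: cells_def permutes_image[OF perm(1)] permutes_image[OF perm(2)])
    have inj: "inj_on (map_prod \<sigma> \<tau>) ({1..n} \<times> {1..n})"
      using prod.inj_map[OF permutes_inj[OF perm(1)] permutes_inj[OF perm(2)]] by (rule inj_on_subset) simp
    have re: "(\<Sum>x\<in>cells n. h x) = (\<Sum>x\<in>{1..n} \<times> {1..n}. h (map_prod \<sigma> \<tau> x))" for h :: "_ \<Rightarrow> real"
      using sum.reindex[OF inj, of h] unfolding img comp_def .
    have "fill_cost n A (set xs) \<sigma> \<tau> = (\<Sum>x\<in>cells n. of_bool (x \<notin> set xs) * ?h x)"
      unfolding fill_cost_def using finite_cells by (intro sum.mono_neutral_cong_left) auto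
    also have "\<dots> = (\<Sum>x\<in>{1..n} \<times> {1..n}. of_bool (map_prod \<sigma> \<tau> x \<notin> set xs) * ?h (map_prod \<sigma> \<tau> x))"
      by (rule re)
    also have "\<dots> = (\<Sum>a\<in>{1..n}. \<Sum>b\<in>{1..n}. of_bool ((\<sigma> a, \<tau> b) \<notin> set xs) * ?h (\<sigma> a, \<tau> b))"
      unfolding sum.cartesian_product by (rule sum.cong) auto
    also have "\<dots> \<le> (\<Sum>a\<in>{1..n}. \<Sum>b\<in>{1..n}. of_bool ((\<sigma> a, \<tau> b) \<notin> set xs) * ln (1 + J a b (\<sigma>, \<tau>, xs)))"
    proof (intro sum_mono mult_left_mono)
      fix a b
      have "choice_bound n A (set xs \<union> {y \<in> cells n. fill_before \<sigma> \<tau> y (\<sigma> a, \<tau> b)}) (\<sigma> a, \<tau> b) \<le> 1 + J a b (\<sigma>, \<tau>, xs)"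
        unfolding J_def using choice_bound_le_competitors[OF A perm] by simp
      then show "?h (\<sigma> a, \<tau> b) \<le> ln (1 + J a b (\<sigma>, \<tau>, xs))"
        by (intro ln_mono) (use choice_bound_ge_1 in \<open>auto intro: less_le_trans[OF zero_less_one]\<close>)
    qed simp
    finally show ?thesis .
  qed
  have cell: "(\<Sum>i\<in>S a b. ln (1 + J a b i)) \<le> p\<^sup>2 * real (card F) * (real (n\<^sup>2 - m) / real n ^ 2) *
      ln (1 + B / real (n\<^sup>2 - m) * (real (n - a) * real (n - b) / (real (n - 1))\<^sup>2))"
    if ab: "a \<in> {1..n}" "b \<in> {1..n}" for a b
  proof -
    define w where "w = real (n - a) * real (n - b) / (real (n - 1))\<^sup>2"
    have finS: "finite (S a b)" by (rule finite_subset[OF _ finI]) (auto simp: S_def)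
    have "real (card (S a b)) = (\<Sum>i\<in>I. of_bool (i \<in> S a b))"
      using finI by (simp add: S_def Int_def) (metis (no_types, lifting) Collect_cong case_prodE case_prodI2 Collect_mem_eq)
    also have "\<dots> = (\<Sum>(\<sigma>, \<tau>, xs)\<in>I. of_bool ((\<sigma> a, \<tau> b) \<notin> set xs))"
      by (rule sum.cong) (auto simp: S_def)
    also have "\<dots> = (\<Sum>\<sigma>\<in>?P. \<Sum>\<tau>\<in>?P. \<Sum>xs\<in>F. of_bool ((\<sigma> a, \<tau> b) \<notin> set xs))"
      unfolding flat ..
    also have "\<dots> = (\<Sum>\<sigma>\<in>?P. \<Sum>xs\<in>F. \<Sum>\<tau>\<in>?P. of_bool ((\<sigma> a, \<tau> b) \<notin> set xs))"
      by (intro sum.cong refl sum.swap)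
    also have "\<dots> = (\<Sum>xs\<in>F. \<Sum>\<sigma>\<in>?P. \<Sum>\<tau>\<in>?P. of_bool ((\<sigma> a, \<tau> b) \<notin> set xs))"
      by (rule sum.swap)
    also have "\<dots> = (\<Sum>xs\<in>F. (p / real n)\<^sup>2 * real (n\<^sup>2 - m))"
      unfolding p_def by (rule sum.cong[OF refl]) (use sum_perms_cell[OF n ab] xs in simp)
    finally have cS: "real (card (S a b)) = p\<^sup>2 * real (card F) * (real (n\<^sup>2 - m) / real n ^ 2)"
      by (simp add: power_divide)
    have cS0: "0 < real (card (S a b))" unfolding cS using p cF m n by simp
    \<comment> \<open>A position with a filled cell has no competitors, because the cell itself is a
      blocker, so nothing is lost here.\<close>
    have "(\<Sum>i\<in>S a b. J a b i) \<le> (\<Sum>i\<in>I. J a b i)"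
      using finI by (intro sum_mono2) (auto simp: S_def J_def)
    also have "\<dots> = (\<Sum>\<sigma>\<in>?P. \<Sum>\<tau>\<in>?P. \<Sum>xs\<in>F. J a b (\<sigma>, \<tau>, xs))" unfolding flat by simp
    also have "\<dots> = (\<Sum>\<sigma>\<in>?P. \<Sum>xs\<in>F. \<Sum>\<tau>\<in>?P. J a b (\<sigma>, \<tau>, xs))" by (intro sum.cong refl sum.swap)
    also have "\<dots> = (\<Sum>xs\<in>F. \<Sum>\<sigma>\<in>?P. \<Sum>\<tau>\<in>?P. J a b (\<sigma>, \<tau>, xs))" by (rule sum.swap)
    also have "\<dots> = (\<Sum>xs\<in>F. p\<^sup>2 * (real (n - a) * real (n - b) / (real n * real (n - 1))\<^sup>2) * open_triples n A (set xs))"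
      unfolding J_def prod.case p_def by (intro sum.cong refl sum_competitors[OF A n ab])
    also have "\<dots> = p\<^sup>2 * (w / real n ^ 2) * (\<Sum>xs\<in>F. open_triples n A (set xs))"
      unfolding w_def sum_distrib_left[symmetric] by (simp add: power_mult_distrib)
    also have "\<dots> \<le> p\<^sup>2 * (w / real n ^ 2) * (real (card F) * B)"
      using mean by (intro mult_left_mono) (auto simp: w_def)
    also have "\<dots> = real (card (S a b)) * (B / real (n\<^sup>2 - m) * w)"
      unfolding cS using m by simp
    finally have J: "(\<Sum>i\<in>S a b. J a b i) \<le> real (card (S a b)) * (B / real (n\<^sup>2 - m) * w)" .
    have "(\<Sum>i\<in>S a b. ln (1 + J a b i)) \<le>
      real (card (S a b)) * ln ((\<Sum>i\<in>S a b. 1 + J a b i) / real (card (S a b)))"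
      by (rule sum_ln_le[OF finS]) (auto simp: J_def add_pos_nonneg)
    also have "\<dots> \<le> real (card (S a b)) * ln (1 + B / real (n\<^sup>2 - m) * w)"
    proof (intro mult_left_mono ln_mono)
      have "0 \<le> (\<Sum>i\<in>S a b. J a b i)" by (rule sum_nonneg) (auto simp: J_def)
      then show "0 < (\<Sum>i\<in>S a b. 1 + J a b i) / real (card (S a b))"
        using cS0 by (simp add: sum.distrib add_pos_nonneg)
      show "(\<Sum>i\<in>S a b. 1 + J a b i) / real (card (S a b)) \<le> 1 + B / real (n\<^sup>2 - m) * w"
        using J cS0 by (simp add: sum.distrib pos_divide_le_eq algebra_simps)
    qed simp
    finally show ?thesis unfolding cS w_def .
  qed
  have "(\<Sum>\<sigma>\<in>?P. \<Sum>\<tau>\<in>?P. \<Sum>xs\<in>F. fill_cost n A (set xs) \<sigma> \<tau>) \<le>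
    (\<Sum>\<sigma>\<in>?P. \<Sum>\<tau>\<in>?P. \<Sum>xs\<in>F. \<Sum>a\<in>{1..n}. \<Sum>b\<in>{1..n}. of_bool ((\<sigma> a, \<tau> b) \<notin> set xs) * ln (1 + J a b (\<sigma>, \<tau>, xs)))"
    by (intro sum_mono cost)
  also have "\<dots> = (\<Sum>i\<in>I. \<Sum>a\<in>{1..n}. \<Sum>b\<in>{1..n}. of_bool (i \<in> S a b) * ln (1 + J a b i))"
    unfolding flat by (rule sum.cong) (auto simp: S_def)
  also have "\<dots> = (\<Sum>a\<in>{1..n}. \<Sum>i\<in>I. \<Sum>b\<in>{1..n}. of_bool (i \<in> S a b) * ln (1 + J a b i))"
    by (rule sum.swap)
  also have "\<dots> = (\<Sum>a\<in>{1..n}. \<Sum>b\<in>{1..n}. \<Sum>i\<in>I. of_bool (i \<in> S a b) * ln (1 + J a b i))"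
    by (intro sum.cong refl sum.swap)
  also have "\<dots> = (\<Sum>a\<in>{1..n}. \<Sum>b\<in>{1..n}. \<Sum>i\<in>S a b. ln (1 + J a b i))"
    using finI by (intro sum.cong refl sum.mono_neutral_cong_right) (auto simp: S_def)
  also have "\<dots> \<le> (\<Sum>a\<in>{1..n}. \<Sum>b\<in>{1..n}. p\<^sup>2 * real (card F) * (real (n\<^sup>2 - m) / real n ^ 2) *
      ln (1 + B / real (n\<^sup>2 - m) * (real (n - a) * real (n - b) / (real (n - 1))\<^sup>2)))"
    by (intro sum_mono cell)
  finally show ?thesis unfolding p_def sum_distrib_left[symmetric] fill_bound_def[symmetric] .
qed

section \<open>Comparing random Latin squares with the greedy process\<close>

text \<open>Probability that the greedy process adds these edges in this order, provided that every
  step is legal; \<open>greedy_seq\<close> records the legality.\<close>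

primrec greedy_weight :: "hypergraph \<Rightarrow> vertex set list \<Rightarrow> hypergraph \<Rightarrow> real" where
  "greedy_weight E [] Q = 1"
| "greedy_weight E (e # es) Q = greedy_weight E es (insert e Q) / real (card (available E Q))"

primrec greedy_seq :: "hypergraph \<Rightarrow> vertex set list \<Rightarrow> hypergraph \<Rightarrow> bool" where
  "greedy_seq E [] Q \<longleftrightarrow> True"
| "greedy_seq E (e # es) Q \<longleftrightarrow> e \<in> available E Q \<and> greedy_seq E es (insert e Q)"

lemma greedy_weight_nonneg: "0 \<le> greedy_weight E es Q"
  by (induction es arbitrary: Q) auto

lemma sum_greedy_weight_le:
  assumes "finite E" "finite F"
    and "\<And>es. es \<in> F \<Longrightarrow> length es = k \<and> greedy_seq E es Q \<and> Q \<union> set es \<in> U"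
  shows "(\<Sum>es\<in>F. greedy_weight E es Q) \<le> greedy_prob E U k Q"
  using assms(2,3)
proof (induction k arbitrary: F Q)
  case 0
  show ?case
  proof (cases "F = {}")
    case False
    then have "F = {[]}" using 0(2) by auto
    then show ?thesis using 0(2)[of "[]"] by simp
  qed simp
next
  case (Suc k)
  let ?A = "available E Q"
  have finA: "finite ?A" using assms(1) by (simp add: available_def)
  have cons: "\<exists>e es'. es = e # es' \<and> e \<in> ?A" if "es \<in> F" for es
    using Suc.prems(2)[OF that] by (cases es) auto
  have "(\<Sum>es\<in>F. greedy_weight E es Q) = (\<Sum>e\<in>?A. \<Sum>es | es \<in> F \<and> hd es = e. greedy_weight E es Q)"
    using finA Suc.prems(1) cons by (intro sum.group[symmetric]) force+
  also have "\<dots> \<le> (\<Sum>e\<in>?A. greedy_prob E U k (insert e Q) / real (card ?A))"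
  proof (rule sum_mono)
    fix e assume "e \<in> ?A"
    let ?F = "{es. e # es \<in> F}"
    have inj: "inj_on ((#) e) ?F" by simp
    have fin: "finite ?F" using finite_vimageI[OF Suc.prems(1), of "(#) e"] by (simp add: vimage_def)
    have "{es. es \<in> F \<and> hd es = e} = (#) e ` ?F" using cons by force
    then have "(\<Sum>es | es \<in> F \<and> hd es = e. greedy_weight E es Q) = (\<Sum>es\<in>?F. greedy_weight E (e # es) Q)"
      by (simp add: sum.reindex[OF inj])
    also have "\<dots> = (\<Sum>es\<in>?F. greedy_weight E es (insert e Q)) / real (card ?A)"
      by (simp add: sum_divide_distrib)
    also have "\<dots> \<le> greedy_prob E U k (insert e Q) / real (card ?A)"
    proof (intro divide_right_mono Suc.IH fin)
      fix es assume "es \<in> ?F"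
      then show "length es = k \<and> greedy_seq E es (insert e Q) \<and> insert e Q \<union> set es \<in> U"
        using Suc.prems(2)[of "e # es"] by simp
    qed simp
    finally show "(\<Sum>es | es \<in> F \<and> hd es = e. greedy_weight E es Q) \<le> greedy_prob E U k (insert e Q) / real (card ?A)" .
  qed
  finally show ?case by (simp add: sum_divide_distrib)
qed

definition greedy_cost :: "nat \<Rightarrow> (nat \<Rightarrow> nat \<Rightarrow> nat) \<Rightarrow> (nat \<times> nat) list \<Rightarrow> (nat \<times> nat) set \<Rightarrow> real" where
  "greedy_cost n A xs Y =
     (\<Sum>i<length xs. ln (real (n\<^sup>2 - card Y - i) + open_triples n A (Y \<union> set (take i xs))))"

lemma greedy_weight_ge:
  assumes A: "latin_array n A"
  shows "Y \<subseteq> cells n \<Longrightarrow> set xs \<subseteq> cells n - Y \<Longrightarrow> distinct xs \<Longrightarrow>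
    greedy_seq (complete_tripartite n) (map (cell_edge A) xs) (cell_edge A ` Y) \<and>
    exp (- greedy_cost n A xs Y) \<le> greedy_weight (complete_tripartite n) (map (cell_edge A) xs) (cell_edge A ` Y)"
proof (induction xs arbitrary: Y)
  case (Cons x xs)
  let ?E = "complete_tripartite n" and ?Y = "insert x Y"
  let ?av = "available ?E (cell_edge A ` Y)"
  define c where "c = real (n\<^sup>2 - card Y) + open_triples n A Y"
  have fY: "finite Y" using Cons.prems(1) finite_cells finite_subset by blast
  have x: "cell_edge A x \<in> ?av" using cell_edge_available[OF A Cons.prems(1)] Cons.prems(2) by simp
  have "finite ?av" using finite_complete_tripartite by (simp add: available_def)
  then have pos: "0 < real (card ?av)" using x by (auto simp: card_gt_0_iff)
  have le: "real (card ?av) \<le> c" unfolding c_def by (rule card_available_le[OF A Cons.prems(1)])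
  have IH: "greedy_seq ?E (map (cell_edge A) xs) (cell_edge A ` ?Y)"
    "exp (- greedy_cost n A xs ?Y) \<le> greedy_weight ?E (map (cell_edge A) xs) (cell_edge A ` ?Y)"
    using Cons.IH[of ?Y] Cons.prems by auto
  have "greedy_cost n A (x # xs) Y = ln c + greedy_cost n A xs ?Y"
  proof -
    have "card ?Y = Suc (card Y)" using Cons.prems(2) fY by simp
    then show ?thesis unfolding greedy_cost_def length_Cons sum.lessThan_Suc_shift by (simp add: c_def)
  qed
  then have "exp (- greedy_cost n A (x # xs) Y) = exp (- greedy_cost n A xs ?Y) / c"
    using pos le by (simp add: exp_diff exp_minus exp_add field_simps)
  also have "\<dots> \<le> greedy_weight ?E (map (cell_edge A) xs) (cell_edge A ` ?Y) / real (card ?av)"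
    by (rule frac_le[OF greedy_weight_nonneg IH(2) pos le])
  finally show ?case using IH(1) x by simp
qed (simp add: greedy_cost_def)

section \<open>The combined process\<close>

lemma sum_exp_ge:
  fixes h :: "'i \<Rightarrow> real"
  assumes "finite I" "(\<Sum>i\<in>I. h i) \<le> real (card I) * b"
  shows "real (card I) * exp (- b) \<le> (\<Sum>i\<in>I. exp (- h i))"
proof (cases "I = {}")
  case False
  then have c: "0 < real (card I)" using assms(1) by (simp add: card_gt_0_iff)
  have "exp (- b) \<le> exp (\<Sum>i\<in>I. (1 / real (card I)) *\<^sub>R - h i)"
    using assms(2) c by (simp add: sum_negf field_simps flip: sum_divide_distrib)
  also have "\<dots> \<le> (\<Sum>i\<in>I. 1 / real (card I) * exp (- h i))"
    by (rule convex_on_sum[OF _ _ exp_convex]) (use assms(1) False c in auto)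
  finally show ?thesis using c by (simp add: field_simps flip: sum_divide_distrib)
qed simp

text \<open>Bound for the mean cost when \<open>B i\<close> bounds the mean number of open triples
  after i steps; \<open>n^2 - i\<close> counts the remaining hyperedges of the square
  itself.\<close>

definition total_cost :: "nat \<Rightarrow> nat \<Rightarrow> (nat \<Rightarrow> real) \<Rightarrow> real" where
  "total_cost n m B = (\<Sum>i<m. ln (real (n\<^sup>2 - i) + B i)) + real (n\<^sup>2 - m) / real n ^ 2 *
     fill_bound n (B m / real (n\<^sup>2 - m))"

text \<open>Concavity of ln moves the averages inside every logarithm; convexity of exp then turns
  the bound for the mean cost into one for the mean probability.\<close>

lemma total_cost_ge_mean:
  assumes A: "latin_array n A" and n: "2 \<le> n" and m: "m < n\<^sup>2"
    and F: "F \<subseteq> distinct_lists (cells n) m" "F \<noteq> {}"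
    and mean: "\<And>i. i \<le> m \<Longrightarrow> (\<Sum>xs\<in>F. open_triples n A (set (take i xs))) \<le> real (card F) * B i"
  shows "(real (card (perms n)))\<^sup>2 * real (card F) * exp (- total_cost n m B) \<le>
    (\<Sum>\<sigma>\<in>perms n. \<Sum>\<tau>\<in>perms n. \<Sum>xs\<in>F. exp (- (greedy_cost n A xs {} + fill_cost n A (set xs) \<sigma> \<tau>)))"
proof -
  let ?P = "perms n"
  define I where "I = ?P \<times> ?P \<times> F"
  define h where "h = (\<lambda>(\<sigma>, \<tau>, xs). greedy_cost n A xs {} + fill_cost n A (set xs) \<sigma> \<tau>)"
  have finF: "finite F" using F(1) finite_distinct_lists[OF finite_cells] finite_subset by blast
  have cF: "0 < real (card F)" using finF F(2) by (simp add: card_gt_0_iff)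
  have finI: "finite I" unfolding I_def using finite_perms finF by blast
  have cI: "real (card I) = (real (card ?P))\<^sup>2 * real (card F)"
    unfolding I_def by (simp add: card_cartesian_product power2_eq_square)
  have flat: "(\<Sum>\<sigma>\<in>?P. \<Sum>\<tau>\<in>?P. \<Sum>xs\<in>F. g \<sigma> \<tau> xs) = (\<Sum>(\<sigma>, \<tau>, xs)\<in>I. g \<sigma> \<tau> xs)" for g :: "_ \<Rightarrow> _ \<Rightarrow> _ \<Rightarrow> real"
    unfolding I_def by (simp add: sum.cartesian_product)
  have len: "length xs = m" if "xs \<in> F" for xs using that F(1) by (auto simp: distinct_lists_def)
  define G where "G = (\<Sum>i<m. ln (real (n\<^sup>2 - i) + B i))"
  have greedy: "(\<Sum>xs\<in>F. greedy_cost n A xs {}) \<le> real (card F) * G"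
  proof -
    have "(\<Sum>xs\<in>F. greedy_cost n A xs {}) =
      (\<Sum>xs\<in>F. \<Sum>i<m. ln (real (n\<^sup>2 - i) + open_triples n A (set (take i xs))))"
      by (intro sum.cong) (simp_all add: greedy_cost_def len)
    also have "\<dots> = (\<Sum>i<m. \<Sum>xs\<in>F. ln (real (n\<^sup>2 - i) + open_triples n A (set (take i xs))))"
      by (rule sum.swap)
    also have "\<dots> \<le> (\<Sum>i<m. real (card F) * ln (real (n\<^sup>2 - i) + B i))"
    proof (rule sum_mono)
      fix i assume "i \<in> {..<m}"
      then have i: "i \<le> m" "0 < real (n\<^sup>2 - i)" using m by auto
      let ?x = "\<lambda>xs. real (n\<^sup>2 - i) + open_triples n A (set (take i xs))"
      have x: "0 < ?x xs" for xs using i(2) by (simp add: count_avoiding_def add_pos_nonneg)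
      have "(\<Sum>xs\<in>F. ln (?x xs)) \<le> real (card F) * ln ((\<Sum>xs\<in>F. ?x xs) / real (card F))"
        by (rule sum_ln_le[OF finF x])
      also have "\<dots> \<le> real (card F) * ln (real (n\<^sup>2 - i) + B i)"
      proof (intro mult_left_mono ln_mono)
        show "0 < (\<Sum>xs\<in>F. ?x xs) / real (card F)" using cF x by (intro divide_pos_pos sum_pos finF F(2))
        show "(\<Sum>xs\<in>F. ?x xs) / real (card F) \<le> real (n\<^sup>2 - i) + B i"
          using mean[OF i(1)] cF by (simp add: sum.distrib pos_divide_le_eq algebra_simps)
      qed simp
      finally show "(\<Sum>xs\<in>F. ln (?x xs)) \<le> real (card F) * ln (real (n\<^sup>2 - i) + B i)" .
    qed
    finally show ?thesis unfolding G_def by (simp add: sum_distrib_left)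
  qed
  have "(\<Sum>i\<in>I. h i) = (\<Sum>\<sigma>\<in>?P. \<Sum>\<tau>\<in>?P. \<Sum>xs\<in>F. greedy_cost n A xs {} + fill_cost n A (set xs) \<sigma> \<tau>)"
    unfolding flat h_def by simp
  also have "\<dots> = (real (card ?P))\<^sup>2 * (\<Sum>xs\<in>F. greedy_cost n A xs {}) +
      (\<Sum>\<sigma>\<in>?P. \<Sum>\<tau>\<in>?P. \<Sum>xs\<in>F. fill_cost n A (set xs) \<sigma> \<tau>)"
    by (simp add: sum.distrib power2_eq_square)
  also have "\<dots> \<le> (real (card ?P))\<^sup>2 * (real (card F) * G) + (real (card ?P))\<^sup>2 * real (card F) *
    (real (n\<^sup>2 - m) / real n ^ 2) * fill_bound n (B m / real (n\<^sup>2 - m))"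
  proof (intro add_mono mult_left_mono greedy)
    have "(\<Sum>xs\<in>F. open_triples n A (set xs)) = (\<Sum>xs\<in>F. open_triples n A (set (take m xs)))"
      by (intro sum.cong) (simp_all add: len)
    then have "(\<Sum>xs\<in>F. open_triples n A (set xs)) \<le> real (card F) * B m" using mean[of m] by simp
    then show "(\<Sum>\<sigma>\<in>?P. \<Sum>\<tau>\<in>?P. \<Sum>xs\<in>F. fill_cost n A (set xs) \<sigma> \<tau>) \<le>
      (real (card ?P))\<^sup>2 * real (card F) * (real (n\<^sup>2 - m) / real n ^ 2) * fill_bound n (B m / real (n\<^sup>2 - m))"
      by (rule fill_cost_mean[OF A n m F])
  qed simp
  also have "\<dots> = real (card I) * total_cost n m B"
    unfolding cI total_cost_def G_def[symmetric] by (simp only: distrib_left mult.assoc)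
  finally have "real (card I) * exp (- total_cost n m B) \<le> (\<Sum>i\<in>I. exp (- h i))"
    by (rule sum_exp_ge[OF finI])
  also have "\<dots> = (\<Sum>\<sigma>\<in>?P. \<Sum>\<tau>\<in>?P. \<Sum>xs\<in>F. exp (- (greedy_cost n A xs {} + fill_cost n A (set xs) \<sigma> \<tau>)))"
    unfolding flat h_def by (rule sum.cong) auto
  finally show ?thesis unfolding cI .
qed

text \<open>For fixed filling orders the pairs of a greedy run and a completing square are disjoint
  outcomes of one process. Several squares may share the same sequence of hyperedges; their
  completion probabilities add up to at most 1, and what remains is the probability of greedy runs
  ending in U.\<close>

lemma greedy_prob_ge_total_cost:
  assumes n: "2 \<le> n" and m: "m < n\<^sup>2" and T: "finite T"
    and arr: "\<And>L. L \<in> T \<Longrightarrow> latin_array n (arr L) \<and> L = array_hypergraph n (arr L)"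
    and F: "\<And>L. L \<in> T \<Longrightarrow> F L \<subseteq> distinct_lists (cells n) m"
      "\<And>L xs. L \<in> T \<Longrightarrow> xs \<in> F L \<Longrightarrow> cell_edge (arr L) ` set xs \<in> U"
      "\<And>L. L \<in> T \<Longrightarrow> k \<le> real (card (F L))" "0 < k"
    and mean: "\<And>L i. L \<in> T \<Longrightarrow> i \<le> m \<Longrightarrow>
      (\<Sum>xs\<in>F L. open_triples n (arr L) (set (take i xs))) \<le> real (card (F L)) * B i"
  shows "real (card T) * k * exp (- total_cost n m B) \<le> greedy_prob (complete_tripartite n) U m {}"
proof -
  let ?E = "complete_tripartite n" and ?P = "perms n"
  define p where "p = real (card ?P)"
  have p: "0 < p" unfolding p_def card_perms by simp
  define edges where "edges L xs = map (cell_edge (arr L)) xs" for L xs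
  define H where "H = (\<Union>L\<in>T. edges L ` F L)"
  have xs: "set xs \<subseteq> cells n" "distinct xs" "length xs = m" if "L \<in> T" "xs \<in> F L" for L xs
    using F(1)[OF that(1)] that(2) by (auto simp: distinct_lists_def)
  have finF: "finite (F L)" if "L \<in> T" for L
    using F(1)[OF that] finite_distinct_lists[OF finite_cells] finite_subset by blast
  have finH: "finite H" unfolding H_def using T finF by blast
  have seq: "length es = m \<and> greedy_seq ?E es {} \<and> {} \<union> set es \<in> U" if mem: "es \<in> H" for es
  proof -
    obtain L xs where L: "L \<in> T" "xs \<in> F L" "es = edges L xs" using mem unfolding H_def by blast
    have "greedy_seq ?E (map (cell_edge (arr L)) xs) (cell_edge (arr L) ` {})"
      using greedy_weight_ge[of n "arr L" "{}" xs] arr[OF L(1)] xs[OF L(1,2)] by simp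
    then show ?thesis using xs[OF L(1,2)] F(2)[OF L(1,2)] unfolding L(3) edges_def by simp
  qed
  let ?q = "\<lambda>\<sigma> \<tau> L es. fill_prob n (arr L) (fill_order n \<sigma> \<tau>) (set es)"
  let ?w = "\<lambda>es. greedy_weight ?E es {}"
  have inner: "(\<Sum>L\<in>T. \<Sum>xs\<in>F L. exp (- (greedy_cost n (arr L) xs {} + fill_cost n (arr L) (set xs) \<sigma> \<tau>)))
      \<le> greedy_prob ?E U m {}" if perm: "\<sigma> \<in> ?P" "\<tau> \<in> ?P" for \<sigma> \<tau>
  proof -
    have perm: "\<sigma> permutes {1..n}" "\<tau> permutes {1..n}" using perm by auto
    note ord = fill_order[OF perm]
    have asym: "\<not> fill_before \<sigma> \<tau> y x" if "fill_before \<sigma> \<tau> x y" for x y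
      using that by (auto simp: fill_before_def)
    have each: "exp (- (greedy_cost n (arr L) xs {} + fill_cost n (arr L) (set xs) \<sigma> \<tau>)) \<le>
        ?w (edges L xs) * ?q \<sigma> \<tau> L (edges L xs)" if L: "L \<in> T" "xs \<in> F L" for L xs
    proof -
      have A: "latin_array n (arr L)" using arr[OF L(1)] by simp
      have "exp (- greedy_cost n (arr L) xs {}) \<le> ?w (edges L xs)"
        using greedy_weight_ge[OF A, of "{}" xs] xs[OF L] by (simp add: edges_def)
      moreover have "exp (- fill_cost n (arr L) (set xs) \<sigma> \<tau>) \<le> ?q \<sigma> \<tau> L (edges L xs)"
        using fill_prob_ge[OF A asym xs(1)[OF L] _ ord(2,3)] unfolding ord(1) fill_cost_def edges_def by simp
      ultimately have "exp (- greedy_cost n (arr L) xs {}) * exp (- fill_cost n (arr L) (set xs) \<sigma> \<tau>) \<le>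
        ?w (edges L xs) * ?q \<sigma> \<tau> L (edges L xs)"
        by (rule mult_mono) (simp_all add: greedy_weight_nonneg)
      then show ?thesis by (simp add: exp_add[symmetric])
    qed
    have "(\<Sum>L\<in>T. \<Sum>xs\<in>F L. exp (- (greedy_cost n (arr L) xs {} + fill_cost n (arr L) (set xs) \<sigma> \<tau>)))
      \<le> (\<Sum>L\<in>T. \<Sum>xs\<in>F L. ?w (edges L xs) * ?q \<sigma> \<tau> L (edges L xs))"
      by (intro sum_mono each)
    also have "\<dots> = (\<Sum>L\<in>T. \<Sum>es\<in>edges L ` F L. ?w es * ?q \<sigma> \<tau> L es)"
    proof (rule sum.cong[OF refl])
      fix L
      have "inj (cell_edge (arr L))" by (rule injI) (simp add: cell_edge_eq_iff)
      then have "inj_on (edges L) (F L)" unfolding edges_def by (intro inj_onI) (simp add: inj_map_eq_map)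
      then show "(\<Sum>xs\<in>F L. ?w (edges L xs) * ?q \<sigma> \<tau> L (edges L xs)) = (\<Sum>es\<in>edges L ` F L. ?w es * ?q \<sigma> \<tau> L es)"
        by (simp add: sum.reindex)
    qed
    \<comment> \<open>Admitting every sequence of H that fits into L leaves a mere incidence
      condition, so that the sums can be exchanged.\<close>
    also have "\<dots> \<le> (\<Sum>L\<in>T. \<Sum>es | es \<in> H \<and> set es \<subseteq> L. ?w es * ?q \<sigma> \<tau> L es)"
    proof (intro sum_mono sum_mono2)
      fix L assume L: "L \<in> T"
      show "edges L ` F L \<subseteq> {es. es \<in> H \<and> set es \<subseteq> L}"
      proof
        fix es assume es: "es \<in> edges L ` F L"
        then have "set es \<subseteq> cell_edge (arr L) ` cells n" using xs(1)[OF L] unfolding edges_def by force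
        then show "es \<in> {es. es \<in> H \<and> set es \<subseteq> L}"
          using es L arr[OF L] array_hypergraph_eq[of n "arr L"] unfolding H_def by auto
      qed
    qed (use finH in \<open>auto intro!: mult_nonneg_nonneg greedy_weight_nonneg fill_prob_nonneg\<close>)
    also have "\<dots> = (\<Sum>es\<in>H. \<Sum>L | L \<in> T \<and> set es \<subseteq> L. ?w es * ?q \<sigma> \<tau> L es)"
      by (rule sum.swap_restrict[OF T finH])
    also have "\<dots> \<le> (\<Sum>es\<in>H. ?w es * 1)"
      unfolding sum_distrib_left[symmetric]
    proof (intro sum_mono mult_left_mono greedy_weight_nonneg)
      fix es
      show "(\<Sum>L | L \<in> T \<and> set es \<subseteq> L. ?q \<sigma> \<tau> L es) \<le> 1"
        by (rule sum_fill_prob_le_1) (use T arr ord(1) in auto)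
    qed
    also have "\<dots> \<le> greedy_prob ?E U m {}"
      using sum_greedy_weight_le[OF finite_complete_tripartite finH seq] by simp
    finally show ?thesis .
  qed
  have "p\<^sup>2 * (real (card T) * k * exp (- total_cost n m B)) = (\<Sum>L\<in>T. p\<^sup>2 * k * exp (- total_cost n m B))" by simp
  also have "\<dots> \<le> (\<Sum>L\<in>T. p\<^sup>2 * real (card (F L)) * exp (- total_cost n m B))"
    by (intro sum_mono mult_right_mono mult_left_mono F(3)) auto
  also have "\<dots> \<le> (\<Sum>L\<in>T. \<Sum>\<sigma>\<in>?P. \<Sum>\<tau>\<in>?P. \<Sum>xs\<in>F L.
      exp (- (greedy_cost n (arr L) xs {} + fill_cost n (arr L) (set xs) \<sigma> \<tau>)))"
    unfolding p_def
  proof (intro sum_mono total_cost_ge_mean n m F(1) mean)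
    fix L assume "L \<in> T"
    then show "latin_array n (arr L)" "F L \<noteq> {}" using arr F(3)[of L] F(4) by auto
  qed
  also have "\<dots> = (\<Sum>\<sigma>\<in>?P. \<Sum>L\<in>T. \<Sum>\<tau>\<in>?P. \<Sum>xs\<in>F L.
      exp (- (greedy_cost n (arr L) xs {} + fill_cost n (arr L) (set xs) \<sigma> \<tau>)))"
    by (rule sum.swap)
  also have "\<dots> = (\<Sum>\<sigma>\<in>?P. \<Sum>\<tau>\<in>?P. \<Sum>L\<in>T. \<Sum>xs\<in>F L.
      exp (- (greedy_cost n (arr L) xs {} + fill_cost n (arr L) (set xs) \<sigma> \<tau>)))"
    by (intro sum.cong refl sum.swap)
  also have "\<dots> \<le> (\<Sum>\<sigma>\<in>?P. \<Sum>\<tau>\<in>?P. greedy_prob ?E U m {})" by (intro sum_mono inner)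
  also have "\<dots> = p\<^sup>2 * greedy_prob ?E U m {}" by (simp add: p_def power2_eq_square)
  finally show ?thesis using p by (simp add: mult_le_cancel_left)
qed

section \<open>Asymptotics of the cost\<close>

lemma ln_falling: "k \<le> N \<Longrightarrow> ln (falling N k) = (\<Sum>j<k. ln (real (N - j)))"
  unfolding falling_def by (subst ln_prod) auto

lemma ln_falling_le:
  assumes "m < N"
  shows "ln (falling N m) \<le> real N * ln (real N) - real N + ln (real N) + 1
    - (real (N - m) * ln (real (N - m)) - real (N - m))"
proof -
  have "ln (falling N m) + ln (fact (N - m)) = ln (falling N m * fact (N - m))"
    using falling_pos[of m N] assms by (subst ln_mult) auto
  also have "\<dots> = ln (fact N)" using falling_eq_fact[of m N] assms by simp
  finally show ?thesis using ln_fact_upper[of N] ln_fact_lower[of "N - m"] assms by linarith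
qed

lemma harmonic_le: "1 \<le> k \<Longrightarrow> (\<Sum>j\<in>{1..k}. 1 / real j) \<le> 1 + ln (real k)"
proof (induction k rule: dec_induct)
  case (step k)
  have "ln (real k / real (Suc k)) \<le> real k / real (Suc k) - 1"
    using step by (intro ln_le_minus_one) simp
  also have "\<dots> = - 1 / real (Suc k)" by (simp add: field_simps)
  finally have "1 / real (Suc k) \<le> ln (real (Suc k)) - ln (real k)" using step by (simp add: ln_div)
  moreover have "(\<Sum>j\<in>{1..Suc k}. 1 / real j) = (\<Sum>j\<in>{1..k}. 1 / real j) + 1 / real (Suc k)" by simp
  ultimately show ?case using step.IH by linarith
qed simp

lemma ln_add_le:
  fixes x y :: real
  assumes "0 < x" "0 \<le> y"
  shows "ln (x + y) \<le> ln x + y / x"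
proof -
  have "0 < 1 + y / x" using assms by (simp add: add_pos_nonneg)
  then have "ln (x * (1 + y / x)) = ln x + ln (1 + y / x)" using assms(1) by (intro ln_mult_pos)
  moreover have "x * (1 + y / x) = x + y" using assms by (simp add: field_simps)
  ultimately show ?thesis using ln_add_one_self_le_self[of "y / x"] assms by simp
qed

text \<open>In \<open>ln (1 + y) \<le> ln y + 1 / y\<close> the terms \<open>1 / y\<close> add up to a multiple of the square of a
  harmonic number; this is the source of \<open>ln\<^sup>2 n\<close>.\<close>

lemma sum_ln_fill_le:
  assumes "1 \<le> K" "0 < Q"
  shows "(\<Sum>j\<in>{1..K}. \<Sum>k\<in>{1..K}. ln (1 + Q * (real j * real k / (real K)\<^sup>2))) \<le>
    (real K)\<^sup>2 * (ln Q - 2) + 2 * real K * (ln (real K) + 1) + (real K)\<^sup>2 / Q * (1 + ln (real K))\<^sup>2"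
proof -
  have K: "0 < real K" using assms by simp
  let ?H = "\<Sum>j\<in>{1..K}. 1 / real j"
  have pt: "ln (1 + Q * (real j * real k / (real K)\<^sup>2)) \<le>
      (ln Q - 2 * ln (real K)) + ln (real j) + ln (real k) + (real K)\<^sup>2 / Q * (1 / real j * (1 / real k))"
    if jk: "j \<in> {1..K}" "k \<in> {1..K}" for j k
  proof -
    define y where "y = Q * (real j * real k / (real K)\<^sup>2)"
    have p: "0 < real j" "0 < real k" using jk by auto
    have y: "0 < y" using K assms p unfolding y_def by simp
    have "ln (1 + y) \<le> ln y + 1 / y" using ln_add_le[of y 1] y by (simp add: add.commute)
    moreover have "ln y = ln Q - 2 * ln (real K) + ln (real j) + ln (real k)"
      unfolding y_def using K assms p by (simp add: ln_mult ln_div ln_realpow)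
    moreover have "1 / y = (real K)\<^sup>2 / Q * (1 / real j * (1 / real k))"
      unfolding y_def by simp
    ultimately show ?thesis unfolding y_def by linarith
  qed
  have lnf: "(\<Sum>j\<in>{1..K}. ln (real j)) = ln (fact K)"
    unfolding fact_prod of_nat_prod by (subst ln_prod) auto
  have "(\<Sum>j\<in>{1..K}. \<Sum>k\<in>{1..K}. ln (1 + Q * (real j * real k / (real K)\<^sup>2))) \<le>
    (\<Sum>j\<in>{1..K}. \<Sum>k\<in>{1..K}. (ln Q - 2 * ln (real K)) + ln (real j) + ln (real k)
      + (real K)\<^sup>2 / Q * (1 / real j * (1 / real k)))"
    by (intro sum_mono pt)
  also have "\<dots> = (real K)\<^sup>2 * (ln Q - 2 * ln (real K)) + 2 * (real K * ln (fact K))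
      + (real K)\<^sup>2 / Q * (?H * ?H)"
    unfolding sum.distrib sum_distrib_left[symmetric] sum_distrib_right[symmetric]
    by (simp add: lnf power2_eq_square flip: sum_distrib_left del: One_nat_def)
  also have "\<dots> \<le> (real K)\<^sup>2 * (ln Q - 2 * ln (real K))
      + 2 * (real K * (real K * ln (real K) - real K + ln (real K) + 1))
      + (real K)\<^sup>2 / Q * ((1 + ln (real K)) * (1 + ln (real K)))"
    using harmonic_le[OF assms(1)] ln_fact_upper[OF assms(1)] assms
    by (intro add_mono mult_left_mono mult_mono order.refl) (auto intro: sum_nonneg)
  also have "\<dots> = (real K)\<^sup>2 * (ln Q - 2) + 2 * real K * (ln (real K) + 1) + (real K)\<^sup>2 / Q * (1 + ln (real K))\<^sup>2"
    by (simp add: power2_eq_square algebra_simps)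
  finally show ?thesis .
qed

lemma sum_complement:
  fixes n :: nat
  assumes "1 \<le> n" "g 0 = (0 :: real)"
  shows "(\<Sum>a\<in>{1..n}. g (n - a)) = (\<Sum>j\<in>{1..n - 1}. g j)"
proof -
  have "(\<Sum>a\<in>{1..n}. g (n - a)) = (\<Sum>j<n. g j)"
    by (rule sum.reindex_bij_witness[of _ "\<lambda>j. n - j" "\<lambda>a. n - a"]) auto
  also have "\<dots> = (\<Sum>j\<in>{1..n - 1}. g j)"
    using assms by (intro sum.mono_neutral_right) (auto simp: not_le)
  finally show ?thesis .
qed

text \<open>In a greedy step with open fraction s there are about \<open>(n * s)^3\<close> choices,
  and at the switch an empty cell meets about \<open>n * t^2\<close> competitors, where t is the
  open fraction then. Both fractions stay above \<delta>, which keeps all corrections of lower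
  order.\<close>

lemma total_cost_le:
  fixes \<delta> \<kappa> :: real
  assumes n: "3 \<le> n" and m: "m < n\<^sup>2" and \<delta>: "0 < \<delta>" "\<delta> \<le> 1" "\<delta> * real (n\<^sup>2) \<le> real (n\<^sup>2 - m)" and \<kappa>: "0 \<le> \<kappa>"
  defines "B \<equiv> \<lambda>i. real (n\<^sup>2 * (n - 1)) * (real (n\<^sup>2 - i) / real (n\<^sup>2)) ^ 3 + \<kappa> * real (n\<^sup>2)"
  defines "C \<equiv> (1 + 2 * \<kappa>) / \<delta> ^ 3 + 4 * (1 - ln \<delta>) + 10 + 4 / \<delta>\<^sup>2"
  shows "total_cost n m B \<le> ln (falling (n\<^sup>2) m) + (real (n\<^sup>2) * ln (real n) - 2 * real (n\<^sup>2))
    + C * (real n * ln (real n) ^ 2)"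
proof -
  define N where "N = real (n\<^sup>2)"
  define l where "l = ln (real n)"
  define t where "t = real (n\<^sup>2 - m) / N"
  define f where "f = ln (falling (n\<^sup>2) m)"
  have n0: "0 < real n" "real n \<ge> 3" using n by auto
  have N: "0 < N" "N = real n * real n" using n0 by (auto simp: N_def power2_eq_square)
  have t: "\<delta> \<le> t" "t \<le> 1" "0 < t" "real (n\<^sup>2 - m) = t * N" "real m = N - t * N"
  proof -
    have tN: "t * N = real (n\<^sup>2 - m)" unfolding t_def using N by simp
    moreover have "real (n\<^sup>2 - m) = N - real m" unfolding N_def using m by (simp add: of_nat_diff)
    moreover have "\<delta> * N \<le> t * N" using \<delta>(3) tN unfolding N_def by simp
    then show "\<delta> \<le> t" using N(1) by simp
    then show "0 < t" using \<delta> by simp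
    have "t * N \<le> 1 * N" using tN unfolding N_def by simp
    then show "t \<le> 1" using N(1) by simp
    ultimately show "real (n\<^sup>2 - m) = t * N" "real m = N - t * N" by simp_all
  qed
  have lnN: "ln N = 2 * l" unfolding N(2) l_def using n0 by (simp add: ln_mult)
  have l: "1 \<le> l"
  proof -
    have "exp 1 \<le> real n" using e_less_272 n0 by linarith
    then show ?thesis unfolding l_def using n0 by (simp add: ln_ge_iff)
  qed
  have d3: "0 < \<delta> ^ 3" "\<delta> ^ 3 \<le> t ^ 3" using \<delta> t by (auto intro: power_mono)
  have greedy: "(\<Sum>i<m. ln (real (n\<^sup>2 - i) + B i)) \<le> 3 * f - 3 * real m * l + real n * ((1 + \<kappa>) / \<delta> ^ 3)"
  proof -
    \<comment> \<open>The main term \<open>(n * s)^3\<close> has order \<open>n^3\<close>, while the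
      square's own hyperedges and the deviation \<open>\<kappa> * n^2\<close> have order
      \<open>n^2\<close>. So each step costs an extra 1/n up to constants, and all steps together
      O(n).\<close>
    have pt: "ln (real (n\<^sup>2 - i) + B i) \<le> 3 * ln (real (n\<^sup>2 - i)) - 3 * l + (1 + \<kappa>) / (real n * \<delta> ^ 3)"
      if i: "i < m" for i
    proof -
      define s where "s = real (n\<^sup>2 - i) / N"
      have s: "t \<le> s" "s \<le> 1" using i m N unfolding s_def t_def
        by (auto simp: N_def intro!: divide_right_mono)
      have s0: "0 < s" using s t by linarith
      have "\<delta> ^ 3 \<le> s ^ 3" using s t \<delta> by (intro power_mono) auto
      have "real (n\<^sup>2 - i) + B i = s * N + real (n\<^sup>2 * (n - 1)) * s ^ 3 + \<kappa> * N"
        unfolding B_def s_def N_def[symmetric] using N by simp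
      also have "\<dots> \<le> 1 * N + real n ^ 3 * s ^ 3 + \<kappa> * N"
      proof (intro add_mono mult_right_mono order.refl s)
        have "real (n\<^sup>2 * (n - 1)) \<le> real (n ^ 3)" unfolding of_nat_le_iff by (simp add: power2_eq_square power3_eq_cube)
        then show "real (n\<^sup>2 * (n - 1)) \<le> real n ^ 3" by simp
      qed (use N s0 in auto)
      also have "\<dots> = (real n * s) ^ 3 + (1 + \<kappa>) * N" by (simp add: power_mult_distrib algebra_simps)
      finally have le: "real (n\<^sup>2 - i) + B i \<le> (real n * s) ^ 3 + (1 + \<kappa>) * N" .
      have pos: "0 < real (n\<^sup>2 - i) + B i"
        using i m \<kappa> unfolding B_def by (intro add_pos_nonneg add_nonneg_nonneg mult_nonneg_nonneg zero_le_power) auto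
      have "ln (real (n\<^sup>2 - i) + B i) \<le> ln ((real n * s) ^ 3 + (1 + \<kappa>) * N)"
        using le pos by (intro ln_mono) auto
      also have "\<dots> \<le> ln ((real n * s) ^ 3) + (1 + \<kappa>) * N / (real n * s) ^ 3"
        using n0 s0 \<kappa> N by (intro ln_add_le) auto
      also have "ln ((real n * s) ^ 3) = 3 * (l + ln s)"
        using n0 s0 by (simp add: ln_realpow ln_mult l_def)
      also have "ln s = ln (real (n\<^sup>2 - i)) - 2 * l"
        unfolding s_def lnN[symmetric] using i m N by (subst ln_div) auto
      also have "(1 + \<kappa>) * N / (real n * s) ^ 3 = (1 + \<kappa>) / (real n * s ^ 3)"
        using n0 s0 unfolding N(2) by (simp add: power3_eq_cube)
      also have "\<dots> \<le> (1 + \<kappa>) / (real n * \<delta> ^ 3)"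
        using \<open>\<delta> ^ 3 \<le> s ^ 3\<close> n0 \<kappa> d3 s0 by (intro divide_left_mono mult_left_mono) auto
      finally show ?thesis by (simp add: algebra_simps)
    qed
    have "(\<Sum>i<m. ln (real (n\<^sup>2 - i) + B i)) \<le>
      (\<Sum>i<m. 3 * ln (real (n\<^sup>2 - i)) - 3 * l + (1 + \<kappa>) / (real n * \<delta> ^ 3))"
      using pt by (intro sum_mono) auto
    also have "\<dots> = 3 * f - 3 * real m * l + real m * ((1 + \<kappa>) / (real n * \<delta> ^ 3))"
      unfolding f_def using m by (subst ln_falling) (auto simp: sum.distrib sum_subtractf sum_distrib_left)
    also have "real m * ((1 + \<kappa>) / (real n * \<delta> ^ 3)) \<le> N * ((1 + \<kappa>) / (real n * \<delta> ^ 3))"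
      using m \<kappa> n0 d3 unfolding N_def by (intro mult_right_mono) auto
    also have "\<dots> = real n * ((1 + \<kappa>) / \<delta> ^ 3)" unfolding N(2) using n0 by simp
    finally show ?thesis by simp
  qed
  define k where "k = n - 1"
  have k: "1 \<le> k" "real k = real n - 1" "0 < real k" "real k \<le> real n" using n unfolding k_def by auto
  define Q where "Q = B m / real (n\<^sup>2 - m)"
  have Qeq: "Q = real k * t\<^sup>2 + \<kappa> / t"
  proof -
    have "B m = (real k * t ^ 3 + \<kappa>) * N" 
    proof -
      have "real (n\<^sup>2 * (n - 1)) = N * real k" unfolding N_def k_def by simp
      then show ?thesis unfolding B_def t_def N_def[symmetric] by (simp add: algebra_simps)
    qed
    then have "Q = (real k * t ^ 3 + \<kappa>) / t" unfolding Q_def t(4) using N n0 by simp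
    then show ?thesis using t by (simp add: add_divide_distrib power2_eq_square power3_eq_cube)
  qed
  have Qlow: "real k * \<delta>\<^sup>2 \<le> Q"
  proof -
    have "real k * \<delta>\<^sup>2 \<le> real k * t\<^sup>2" using t \<delta> k by (intro mult_left_mono power_mono) auto
    then show ?thesis using Qeq \<kappa> t by (smt (verit) divide_nonneg_pos)
  qed
  have Q0: "0 < Q" using Qlow k \<delta> by (smt (verit) mult_pos_pos zero_less_power)
  have lnQ: "ln Q \<le> l + 2 * ln t + \<kappa> / (real n * \<delta> ^ 3)"
  proof -
    have "Q \<le> real n * t\<^sup>2 + \<kappa> / t" unfolding Qeq using k by (intro add_right_mono mult_right_mono) auto
    then have "ln Q \<le> ln (real n * t\<^sup>2 + \<kappa> / t)" using Q0 by (intro ln_mono) auto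
    also have "\<dots> \<le> ln (real n * t\<^sup>2) + \<kappa> / t / (real n * t\<^sup>2)" using n0 t \<kappa> by (intro ln_add_le) auto
    also have "ln (real n * t\<^sup>2) = l + 2 * ln t" using n0 t by (simp add: ln_mult ln_realpow l_def)
    also have "\<kappa> / t / (real n * t\<^sup>2) = \<kappa> / (real n * t ^ 3)" by (simp add: power2_eq_square power3_eq_cube)
    also have "\<dots> \<le> \<kappa> / (real n * \<delta> ^ 3)" using d3 n0 \<kappa> t by (intro divide_left_mono mult_left_mono) auto
    finally show ?thesis by simp
  qed
  have lnt: "ln \<delta> \<le> ln t" "ln t \<le> 0" using t \<delta> by auto
  have lk: "0 \<le> ln (real k)" "ln (real k) \<le> l" unfolding l_def using k by auto
  define S where "S = fill_bound n Q"
  have "S = (\<Sum>i\<in>{1..k}. \<Sum>j\<in>{1..k}. ln (1 + Q * (real i * real j / (real k)\<^sup>2)))"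
  proof -
    have inner: "(\<Sum>b\<in>{1..n}. ln (1 + Q * (real i * real (n - b) / (real (n - 1))\<^sup>2))) =
      (\<Sum>j\<in>{1..n - 1}. ln (1 + Q * (real i * real j / (real (n - 1))\<^sup>2)))" for i
      using n by (intro sum_complement[of n "\<lambda>j. ln (1 + Q * (real i * real j / (real (n - 1))\<^sup>2))"]) auto
    have "S = (\<Sum>a\<in>{1..n}. \<Sum>j\<in>{1..n - 1}. ln (1 + Q * (real (n - a) * real j / (real (n - 1))\<^sup>2)))"
      unfolding S_def fill_bound_def by (simp only: inner)
    also have "\<dots> = (\<Sum>i\<in>{1..n - 1}. \<Sum>j\<in>{1..n - 1}. ln (1 + Q * (real i * real j / (real (n - 1))\<^sup>2)))"
      using n by (intro sum_complement[of n "\<lambda>i. \<Sum>j\<in>{1..n - 1}. ln (1 + Q * (real i * real j / (real (n - 1))\<^sup>2))"]) auto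
    finally show ?thesis unfolding k_def .
  qed
  also have "\<dots> \<le> (real k)\<^sup>2 * (ln Q - 2) + 2 * real k * (ln (real k) + 1) + (real k)\<^sup>2 / Q * (1 + ln (real k))\<^sup>2"
    by (rule sum_ln_fill_le[OF k(1) Q0])
  also have "\<dots> \<le> N * (l + 2 * ln t - 2) + real n * (\<kappa> / \<delta> ^ 3 + 4 * (1 - ln \<delta>)) + 4 * (real n * l\<^sup>2)
      + 4 / \<delta>\<^sup>2 * (real n * l\<^sup>2)"
  proof -
    have "(real k)\<^sup>2 * (ln Q - 2) \<le> (real k)\<^sup>2 * (l + 2 * ln t - 2 + \<kappa> / (real n * \<delta> ^ 3))"
      using lnQ by (intro mult_left_mono) auto
    also have "\<dots> = (real k)\<^sup>2 * (l + 2 * ln t - 2) + (real k)\<^sup>2 * (\<kappa> / (real n * \<delta> ^ 3))" by (simp add: algebra_simps)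
    also have "(real k)\<^sup>2 * (\<kappa> / (real n * \<delta> ^ 3)) \<le> N * (\<kappa> / (real n * \<delta> ^ 3))"
      unfolding N(2) power2_eq_square using k \<kappa> n0 d3 by (intro mult_right_mono mult_mono) auto
    also have "\<dots> = real n * (\<kappa> / \<delta> ^ 3)" unfolding N(2) using n0 by simp
    \<comment> \<open>The filling sees \<open>(n - 1)^2\<close> relevant positions instead of
      \<open>n^2\<close>. The difference is of order n and is multiplied by a factor at most
      \<open>2 - 2 * ln \<delta>\<close>.\<close>
    also have "(real k)\<^sup>2 * (l + 2 * ln t - 2) \<le> N * (l + 2 * ln t - 2) + real n * (4 * (1 - ln \<delta>))"
    proof -
      have "(real k)\<^sup>2 = N - (2 * real n - 1)" unfolding k(2) N(2) by (simp add: power2_eq_square algebra_simps)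
      then have "(real k)\<^sup>2 * (l + 2 * ln t - 2) = (N - (2 * real n - 1)) * (l + 2 * ln t - 2)" by (rule arg_cong)
      also have "\<dots> = N * (l + 2 * ln t - 2) + (2 * real n - 1) * (2 - 2 * ln t - l)"
        by (simp add: algebra_simps)
      also have "(2 * real n - 1) * (2 - 2 * ln t - l) \<le> (2 * real n) * (2 - 2 * ln \<delta>)"
      proof -
        have "(2 * real n - 1) * (2 - 2 * ln t - l) \<le> (2 * real n - 1) * (2 - 2 * ln \<delta>)"
          using lnt l n0 by (intro mult_left_mono) auto
        also have "\<dots> \<le> (2 * real n) * (2 - 2 * ln \<delta>)"
          using lnt by (intro mult_right_mono) auto
        finally show ?thesis .
      qed
      finally show ?thesis by (simp add: algebra_simps)
    qed
    finally have one: "(real k)\<^sup>2 * (ln Q - 2) \<le> N * (l + 2 * ln t - 2) + real n * (4 * (1 - ln \<delta>)) + real n * (\<kappa> / \<delta> ^ 3)"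
      by simp
    have ll: "l \<le> l\<^sup>2" "1 \<le> l\<^sup>2" using l self_le_power[of l 2] one_le_power[of l 2] by auto
    have "2 * real k * (ln (real k) + 1) \<le> 2 * real n * (2 * l\<^sup>2)"
      using k lk ll by (intro mult_mono) auto
    then have two: "2 * real k * (ln (real k) + 1) \<le> 4 * (real n * l\<^sup>2)" by simp
    have "(real k)\<^sup>2 / Q \<le> (real k)\<^sup>2 / (real k * \<delta>\<^sup>2)"
      using Qlow Q0 k \<delta> by (intro divide_left_mono mult_pos_pos) auto
    also have "\<dots> = real k / \<delta>\<^sup>2" using k by (simp add: power2_eq_square)
    also have "\<dots> \<le> real n / \<delta>\<^sup>2" using k by (intro divide_right_mono) auto
    finally have "(real k)\<^sup>2 / Q \<le> real n / \<delta>\<^sup>2" .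
    moreover have "(1 + ln (real k))\<^sup>2 \<le> (2 * l)\<^sup>2" using lk l by (intro power_mono) auto
    ultimately have "(real k)\<^sup>2 / Q * (1 + ln (real k))\<^sup>2 \<le> real n / \<delta>\<^sup>2 * (2 * l)\<^sup>2"
      using n0 by (intro mult_mono) auto
    then have three: "(real k)\<^sup>2 / Q * (1 + ln (real k))\<^sup>2 \<le> 4 / \<delta>\<^sup>2 * (real n * l\<^sup>2)"
      by (simp add: power_mult_distrib mult_ac)
    show ?thesis using one two three by (simp add: algebra_simps)
  qed
  finally have S: "S \<le> N * (l + 2 * ln t - 2) + (real n * (\<kappa> / \<delta> ^ 3 + 4 * (1 - ln \<delta>)) + 4 * (real n * l\<^sup>2)
      + 4 / \<delta>\<^sup>2 * (real n * l\<^sup>2))" by simp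
  define R where "R = real n * (\<kappa> / \<delta> ^ 3 + 4 * (1 - ln \<delta>)) + 4 * (real n * l\<^sup>2) + 4 / \<delta>\<^sup>2 * (real n * l\<^sup>2)"
  have R0: "0 \<le> R" unfolding R_def using \<kappa> \<delta> lnt by (intro add_nonneg_nonneg mult_nonneg_nonneg) auto
  have "t * S \<le> t * (N * (l + 2 * ln t - 2)) + t * R"
    unfolding R_def distrib_left[symmetric] using S t by (intro mult_left_mono) auto
  also have "t * R \<le> R" using t R0 by (simp add: mult_left_le_one_le)
  finally have tS: "t * S \<le> t * (N * (l + 2 * ln t - 2)) + R" by simp
  have "real (n\<^sup>2 - m) / real n ^ 2 = t" by (simp add: t_def N_def)
  then have tc: "total_cost n m B = (\<Sum>i<m. ln (real (n\<^sup>2 - i) + B i)) + t * S"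
    unfolding total_cost_def S_def Q_def by simp
  have "f \<le> N * (2 * l) - N + 2 * l + 1 - (t * N * (ln t + 2 * l) - t * N)"
  proof -
    have "ln (t * N) = ln t + 2 * l" using ln_mult_pos[OF t(3) N(1)] lnN by simp
    then show ?thesis using ln_falling_le[OF m] unfolding f_def t(4) N_def[symmetric] lnN by simp
  qed
  \<comment> \<open>The dependence on t cancels: of the three copies of f from the greedy steps one
    is set aside for the number of sequences, and Stirling's formula for the other two removes all
    terms in t.\<close>
  then have "2 * f + t * (N * (l + 2 * ln t - 2)) - 3 * real m * l \<le> N * l - 2 * N + 4 * l + 2"
    unfolding t(5) by (simp add: algebra_simps)
  then have "total_cost n m B \<le> f + (N * l - 2 * N) + (4 * l + 2 + real n * ((1 + \<kappa>) / \<delta> ^ 3) + R)"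
    using greedy tS tc by linarith
  \<comment> \<open>The parts of C: the deviations in the greedy steps and in \<open>ln Q\<close>;
    the passage from \<open>(n - 1)^2\<close> to \<open>n^2\<close>; 10 = 4 + 4 + 2 from the
    remainders in Stirling's formula; and the squared harmonic sum, the only part of order n ln^2
    n.\<close>
  moreover have "4 * l + 2 + real n * ((1 + \<kappa>) / \<delta> ^ 3) + R \<le> C * (real n * l\<^sup>2)"
  proof -
    have ll: "l \<le> l\<^sup>2" "1 \<le> l\<^sup>2" using l self_le_power[of l 2] one_le_power[of l 2] by auto
    have nl: "real n * 1 \<le> real n * l\<^sup>2" "l \<le> real n * l\<^sup>2" "1 \<le> real n * l\<^sup>2"
      using ll n0 l by (auto intro: mult_left_mono order.trans[OF _ mult_right_mono[of 1 "real n" "l\<^sup>2"]])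
    have "0 \<le> (1 + \<kappa>) / \<delta> ^ 3 + (\<kappa> / \<delta> ^ 3 + 4 * (1 - ln \<delta>))"
      using \<kappa> d3 lnt \<delta> by (intro add_nonneg_nonneg) auto
    then have "real n * ((1 + \<kappa>) / \<delta> ^ 3 + (\<kappa> / \<delta> ^ 3 + 4 * (1 - ln \<delta>))) \<le>
      real n * l\<^sup>2 * ((1 + \<kappa>) / \<delta> ^ 3 + (\<kappa> / \<delta> ^ 3 + 4 * (1 - ln \<delta>)))"
      using nl by (intro mult_right_mono) auto
    moreover have "C * (real n * l\<^sup>2) = real n * l\<^sup>2 * ((1 + \<kappa>) / \<delta> ^ 3 + (\<kappa> / \<delta> ^ 3 + 4 * (1 - ln \<delta>)))
        + 10 * (real n * l\<^sup>2) + 4 / \<delta>\<^sup>2 * (real n * l\<^sup>2)"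
      unfolding C_def by (simp add: algebra_simps add_divide_distrib)
    ultimately show ?thesis using nl unfolding R_def by (simp add: algebra_simps)
  qed
  ultimately show ?thesis unfolding f_def N_def l_def by simp
qed

section \<open>Transfer to random hypergraphs\<close>

lemma card_distinct_lists_set:
  assumes "finite X"
  shows "card {xs \<in> distinct_lists X m. P (set xs)} = fact m * card {D. D \<subseteq> X \<and> card D = m \<and> P D}"
proof -
  let ?\<D> = "{D. D \<subseteq> X \<and> card D = m \<and> P D}"
  have fin: "finite ?\<D>" by (rule finite_subset[of _ "Pow X"]) (use assms in auto)
  have "{xs \<in> distinct_lists X m. P (set xs)} = (\<Union>D\<in>?\<D>. {xs \<in> distinct_lists X m. set xs = D})"
    by (auto simp: distinct_lists_def distinct_card)
  also have "card \<dots> = (\<Sum>D\<in>?\<D>. card {xs \<in> distinct_lists X m. set xs = D})"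
    using fin finite_distinct_lists[OF assms] by (intro card_UN_disjoint) auto
  also have "\<dots> = (\<Sum>D\<in>?\<D>. fact m)"
  proof (rule sum.cong[OF refl])
    fix D assume "D \<in> ?\<D>"
    then have D: "D \<subseteq> X" "card D = m" "finite D" using assms finite_subset by auto
    have "set xs = D" if "length xs = m" "distinct xs" "set xs \<subseteq> D" for xs
      using that D by (intro card_subset_eq) (auto simp: distinct_card)
    then have "{xs \<in> distinct_lists X m. set xs = D} = distinct_lists D m"
      using D by (auto simp: distinct_lists_def)
    then have "real (card {xs \<in> distinct_lists X m. set xs = D}) = real (fact m)"
      using card_distinct_lists[OF D(3), of m] falling_eq_fact[of m m] D by simp
    then show "card {xs \<in> distinct_lists X m. set xs = D} = fact m" by (simp only: of_nat_eq_iff)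
  qed
  finally show ?thesis by simp
qed

text \<open>Every m-subset has \<open>fact m\<close> orderings, so the density \<rho> passes from
  subsets of hyperedges to sequences of cells.\<close>

lemma inherited_lists:
  assumes inh: "inherited \<rho> m \<U> \<T>" and L: "L \<in> \<T>" "L = array_hypergraph n A" and m: "m \<le> n\<^sup>2"
  shows "\<rho> * real (card (distinct_lists (cells n) m)) \<le>
    real (card {xs \<in> distinct_lists (cells n) m. cell_edge A ` set xs \<in> \<U>})"
proof -
  let ?S = "{S. S \<subseteq> L \<and> card S = m}" and ?D = "{D. D \<subseteq> cells n \<and> card D = m}"
  let ?DU = "{D. D \<subseteq> cells n \<and> card D = m \<and> cell_edge A ` D \<in> \<U>}"
  have inj: "inj (cell_edge A)" by (rule injI) (simp add: cell_edge_eq_iff)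
  have card: "card (cell_edge A ` D) = card D" for D by (rule card_image) (rule inj_on_subset[OF inj], simp)
  have injD: "inj_on ((`) (cell_edge A)) X" for X by (rule inj_onI) (simp add: inj_image_eq_iff[OF inj])
  have S: "?S = (`) (cell_edge A) ` ?D" "?S \<inter> \<U> = (`) (cell_edge A) ` ?DU"
    unfolding L(2) array_hypergraph_eq by (auto simp: card subset_image_iff)
  have finD: "finite ?D" by (rule finite_subset[of _ "Pow (cells n)"]) (use finite_cells in auto)
  obtain D where "D \<subseteq> cells n" "card D = m" using obtain_subset_with_card_n[of m "cells n"] m card_cells by metis
  then have ne: "?D \<noteq> {}" by blast
  have cS: "card ?S = card ?D" "card (?S \<inter> \<U>) = card ?DU"
    unfolding S(2) by (unfold S(1), (rule card_image[OF injD])+)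
  have "\<rho> \<le> measure_pmf.prob (pmf_of_set ?S) \<U>" using inh L(1) unfolding inherited_def by blast
  also have "\<dots> = real (card ?DU) / real (card ?D)"
    unfolding cS[symmetric] by (rule measure_pmf_of_set) (use S(1) ne finD in auto)
  finally have "\<rho> * real (card ?D) \<le> real (card ?DU)"
    using ne finD by (simp add: pos_le_divide_eq card_gt_0_iff)
  then have "real (fact m) * (\<rho> * real (card ?D)) \<le> real (fact m) * real (card ?DU)"
    by (rule mult_left_mono) simp
  moreover have "card (distinct_lists (cells n) m) = fact m * card ?D"
    using card_distinct_lists_set[OF finite_cells, of n m "\<lambda>_. True"] by simp
  moreover have "card {xs \<in> distinct_lists (cells n) m. cell_edge A ` set xs \<in> \<U>} = fact m * card ?DU"
    by (rule card_distinct_lists_set[OF finite_cells])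
  ultimately show ?thesis by (simp add: algebra_simps)
qed

text \<open>Instance with \<open>K = 3 * n\<close> and deviation scale \<open>s = n^2\<close>,
  against a main term of order \<open>n^3\<close>. The variance bound is 9 + 24 = 33 times
  \<open>n^4\<close>.\<close>

lemma open_triples_mean:
  assumes A: "latin_array n A" and n: "3 \<le> n" and i: "i \<le> m" "m \<le> n\<^sup>2"
    and F: "F \<subseteq> distinct_lists (cells n) m"
      "\<rho> * real (card (distinct_lists (cells n) m)) \<le> real (card F)" "0 < \<rho>"
  shows "(\<Sum>xs\<in>F. open_triples n A (set (take i xs))) \<le> real (card F) *
    (real (n\<^sup>2 * (n - 1)) * (real (n\<^sup>2 - i) / real (n\<^sup>2)) ^ 3 + (1 + 33 / \<rho>) * real (n\<^sup>2))"
proof -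
  have "(3::nat)\<^sup>2 \<le> n\<^sup>2" using n by (rule power_mono) simp
  then have N: "6 \<le> card (cells n)" unfolding card_cells by simp
  have "real (n\<^sup>2 - i) = real (card (cells n)) - real i" using i by (simp add: card_cells of_nat_diff)
  moreover have "(\<Sum>xs\<in>F. open_triples n A (set (take i xs))) \<le> real (card F) *
    (real (card (triples n)) * ((real (card (cells n)) - real i) / real (card (cells n))) ^ 3 + (1 + 33 / \<rho>) * real (n\<^sup>2))"
  proof (rule count_avoiding_conditional_mean[OF finite_cells N finite_triples _ _ _ i(1) _ F])
    define k where "k = real n - 1"
    have k: "0 \<le> k" "k \<le> real n" "real (n - 1) = k" using n unfolding k_def by auto
    have "3 * real (3 * n) * real (card (triples n)) + 24 * (real (card (triples n)))\<^sup>2 / real (card (cells n)) =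
      9 * real n ^ 3 * k + 24 * real n ^ 2 * k\<^sup>2"
      unfolding card_triples card_cells of_nat_mult k(3) using n
      by (simp add: power2_eq_square power3_eq_cube)
    also have "\<dots> \<le> 9 * real n ^ 3 * real n + 24 * real n ^ 2 * (real n)\<^sup>2"
      using k by (intro add_mono mult_left_mono power_mono) auto
    also have "\<dots> = 33 * (real (n\<^sup>2))\<^sup>2" by (simp add: power2_eq_square power3_eq_cube)
    finally show "3 * real (3 * n) * real (card (triples n)) + 24 * (real (card (triples n)))\<^sup>2 / real (card (cells n))
      \<le> 33 * (real (n\<^sup>2))\<^sup>2" .
  qed (use blockers_subset[OF A] card_blocked_by_cell[OF A] i n in \<open>auto simp: card_cells\<close>)
  ultimately show ?thesis by (simp only: card_triples card_cells)
qed

text \<open>The number of sequences per square and the number of Latin squares cancel the main terms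
  of the cost. The constant 1/\<rho> is moved into the exponent, which is possible because
  \<open>n * ln n ^ 2 \<ge> 1\<close> for \<open>n \<ge> 3\<close>.\<close>

lemma prob_latin_le_greedy:
  fixes \<alpha> \<rho> :: real
  assumes "0 < \<alpha>" "\<alpha> < 1" "0 < \<rho>" "\<rho> < 1"
  shows "\<exists>C\<ge>0. \<forall>n\<ge>3. \<forall>\<T> \<U>. \<T> \<subseteq> latin_squares n \<and> inherited \<rho> (nat \<lfloor>\<alpha> * real n ^ 2\<rfloor>) \<U> \<T> \<longrightarrow>
    measure_pmf.prob (pmf_of_set (latin_squares n)) \<T> \<le> exp (C * (real n * ln (real n) ^ 2)) *
      greedy_prob (complete_tripartite n) \<U> (nat \<lfloor>\<alpha> * real n ^ 2\<rfloor>) {}"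
proof -
  define \<delta> where "\<delta> = 1 - \<alpha>"
  define \<kappa> where "\<kappa> = 1 + 33 / \<rho>"
  define C where "C = (1 + 2 * \<kappa>) / \<delta> ^ 3 + 4 * (1 - ln \<delta>) + 10 + 4 / \<delta>\<^sup>2"
  have \<delta>: "0 < \<delta>" "\<delta> \<le> 1" and \<kappa>: "0 \<le> \<kappa>" using assms by (auto simp: \<delta>_def \<kappa>_def)
  have "ln \<delta> \<le> 0" using \<delta> by simp
  then have "0 \<le> 4 * (1 - ln \<delta>)" by simp
  then have C0: "0 \<le> C" unfolding C_def using \<delta> \<kappa> by (intro add_nonneg_nonneg divide_nonneg_nonneg) auto
  show ?thesis
  proof (intro exI[of _ "C + 1 / \<rho>"] conjI allI impI)
    show "0 \<le> C + 1 / \<rho>" using C0 assms by simp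
    fix n :: nat and \<T> \<U> :: "hypergraph set"
    assume n: "3 \<le> n" and TU: "\<T> \<subseteq> latin_squares n \<and> inherited \<rho> (nat \<lfloor>\<alpha> * real n ^ 2\<rfloor>) \<U> \<T>"
    define m where "m = nat \<lfloor>\<alpha> * real n ^ 2\<rfloor>"
    define g where "g = greedy_prob (complete_tripartite n) \<U> m {}"
    define x where "x = real n * ln (real n) ^ 2"
    have T: "\<T> \<subseteq> latin_squares n" and inh: "inherited \<rho> m \<U> \<T>" using TU by (auto simp: m_def)
    have n2: "0 < real n ^ 2" using n by simp
    have m\<alpha>: "real m \<le> \<alpha> * real n ^ 2" using assms unfolding m_def by (simp add: of_nat_nat)
    also have "\<dots> < 1 * real n ^ 2" using assms(2) n2 by (rule mult_strict_right_mono)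
    finally have m: "m < n\<^sup>2" by (simp flip: of_nat_power)
    have \<delta>m: "\<delta> * real (n\<^sup>2) \<le> real (n\<^sup>2 - m)"
      using m\<alpha> m unfolding \<delta>_def by (simp add: of_nat_diff algebra_simps)
    have finT: "finite \<T>" using T finite_latin_squares finite_subset by blast
    have "\<forall>L\<in>\<T>. \<exists>A. latin_array n A \<and> L = array_hypergraph n A" using T unfolding latin_squares_def by blast
    then obtain arr where arr: "\<And>L. L \<in> \<T> \<Longrightarrow> latin_array n (arr L) \<and> L = array_hypergraph n (arr L)" by metis
    define F where "F L = {xs \<in> distinct_lists (cells n) m. cell_edge (arr L) ` set xs \<in> \<U>}" for L
    define B where "B i = real (n\<^sup>2 * (n - 1)) * (real (n\<^sup>2 - i) / real (n\<^sup>2)) ^ 3 + \<kappa> * real (n\<^sup>2)" for i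
    have dl: "real (card (distinct_lists (cells n) m)) = falling (n\<^sup>2) m"
      using card_distinct_lists[OF finite_cells, of n m] by (simp add: card_cells)
    have cF: "\<rho> * falling (n\<^sup>2) m \<le> real (card (F L))" if L: "L \<in> \<T>" for L
      unfolding F_def dl[symmetric] using inherited_lists[OF inh L _ less_imp_le[OF m]] arr[OF L] by blast
    have fpos: "0 < falling (n\<^sup>2) m" using m by (intro falling_pos) simp
    have le: "real (card \<T>) * (\<rho> * falling (n\<^sup>2) m) * exp (- total_cost n m B) \<le> g"
      unfolding g_def
    proof (rule greedy_prob_ge_total_cost[where arr = arr and F = F])
      fix L i assume L: "L \<in> \<T>" "i \<le> m"
      show "(\<Sum>xs\<in>F L. open_triples n (arr L) (set (take i xs))) \<le> real (card (F L)) * B i"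
        unfolding B_def \<kappa>_def
        by (rule open_triples_mean[where m = m])
           (use arr[OF L(1)] n L(2) m cF[OF L(1)] dl assms in \<open>auto simp: F_def\<close>)
    qed (use n m finT arr cF fpos assms in \<open>auto simp: F_def\<close>)
    have pos: "0 < real (card (latin_squares n))" and card:
      "real n ^ 2 * ln (real n) - 2 * real n ^ 2 \<le> ln (real (card (latin_squares n)))"
      using ln_card_latin_squares_ge[of n] n by auto
    have "total_cost n m B \<le> ln (falling (n\<^sup>2) m) + (real (n\<^sup>2) * ln (real n) - 2 * real (n\<^sup>2)) + C * x"
      unfolding B_def C_def x_def by (rule total_cost_le[OF n m \<delta> \<delta>m \<kappa>])
    also have "\<dots> \<le> ln (falling (n\<^sup>2) m) + ln (real (card (latin_squares n))) + C * x"
      using card by simp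
    finally have "exp (- (ln (falling (n\<^sup>2) m) + ln (real (card (latin_squares n))) + C * x)) \<le> exp (- total_cost n m B)"
      by simp
    then have "real (card \<T>) * (\<rho> * falling (n\<^sup>2) m) *
        exp (- (ln (falling (n\<^sup>2) m) + ln (real (card (latin_squares n))) + C * x)) \<le> g"
      using le assms fpos by (intro order.trans[OF mult_left_mono le]) auto
    moreover have "exp (- (ln (falling (n\<^sup>2) m) + ln (real (card (latin_squares n))) + C * x)) =
        1 / (falling (n\<^sup>2) m * real (card (latin_squares n)) * exp (C * x))"
      unfolding exp_minus exp_add using fpos pos by (simp add: inverse_eq_divide)
    ultimately have "real (card \<T>) * (\<rho> * falling (n\<^sup>2) m) *
        (1 / (falling (n\<^sup>2) m * real (card (latin_squares n)) * exp (C * x))) \<le> g" by (simp only:)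
    then have "\<rho> * (real (card \<T>) / real (card (latin_squares n))) \<le> g * exp (C * x)"
      using fpos pos by (simp add: field_simps)
    moreover have "measure_pmf.prob (pmf_of_set (latin_squares n)) \<T> = real (card \<T>) / real (card (latin_squares n))"
    proof -
      have "latin_squares n \<inter> \<T> = \<T>" using T by blast
      moreover have "latin_squares n \<noteq> {}" using pos by auto
      ultimately show ?thesis using measure_pmf_of_set[OF _ finite_latin_squares] by metis
    qed
    ultimately have "measure_pmf.prob (pmf_of_set (latin_squares n)) \<T> \<le> 1 / \<rho> * (g * exp (C * x))"
      using assms by (simp add: field_simps)
    also have "\<dots> \<le> exp (1 / \<rho> * x) * (g * exp (C * x))"
    proof (rule mult_right_mono)
      have "exp 1 \<le> real n" using e_less_272 n by linarith
      then have "1 \<le> ln (real n)" using n by (simp add: ln_ge_iff)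
      then have "1 * 1 \<le> x" unfolding x_def using n by (intro mult_mono one_le_power) auto
      then have "1 / \<rho> * 1 \<le> 1 / \<rho> * x" using assms by (intro mult_left_mono) auto
      then show "1 / \<rho> \<le> exp (1 / \<rho> * x)" using exp_ge_add_one_self[of "1 / \<rho> * x"] by linarith
      show "0 \<le> g * exp (C * x)" unfolding g_def by (simp add: greedy_prob_nonneg)
    qed
    also have "\<dots> = exp ((C + 1 / \<rho>) * x) * g" by (simp add: exp_add[symmetric] algebra_simps)
    finally show "measure_pmf.prob (pmf_of_set (latin_squares n)) \<T> \<le>
      exp ((C + 1 / \<rho>) * (real n * ln (real n) ^ 2)) * greedy_prob (complete_tripartite n) \<U> (nat \<lfloor>\<alpha> * real n ^ 2\<rfloor>) {}"
      unfolding g_def x_def m_def .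
  qed
qed

section \<open>Decreasing and increasing properties\<close>

lemma latin_decreasing:
  fixes \<alpha> \<rho> :: real
  assumes "0 < \<alpha>" "\<alpha> < 1" "0 < \<rho>" "\<rho> < 1"
  shows "\<exists>C::real. \<forall>\<^sub>F n in sequentially. \<forall>\<T> \<U>.
     \<T> \<subseteq> latin_squares n \<and> \<U> \<subseteq> Pow (complete_tripartite n) \<and>
     inherited \<rho> (nat \<lfloor>\<alpha> * real n ^ 2\<rfloor>) \<U> \<T> \<and> monotone_decreasing \<U> \<longrightarrow>
     measure_pmf.prob (pmf_of_set (latin_squares n)) \<T>
       \<le> exp (C * (real n * ln (real n) ^ 2)) *
         measure_pmf.prob (random_hypergraph n (\<alpha> / real n)) {G. delete_conflicts G \<in> \<U>}"
proof -
  obtain C where C: "0 \<le> C" "\<And>n \<T> \<U>. 3 \<le> n \<Longrightarrow> \<T> \<subseteq> latin_squares n \<Longrightarrow>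
      inherited \<rho> (nat \<lfloor>\<alpha> * real n ^ 2\<rfloor>) \<U> \<T> \<Longrightarrow>
      measure_pmf.prob (pmf_of_set (latin_squares n)) \<T> \<le> exp (C * (real n * ln (real n) ^ 2)) *
      greedy_prob (complete_tripartite n) \<U> (nat \<lfloor>\<alpha> * real n ^ 2\<rfloor>) {}"
    using prob_latin_le_greedy[OF assms] by blast
  have "\<forall>\<^sub>F n in sequentially. 1 \<le> \<alpha> * real n ^ 2"
    using assms(1) by real_asymp
  moreover have "\<forall>\<^sub>F n in sequentially. 6 * ln (real n) + 4 \<le> real n * ln (real n) ^ 2"
    by real_asymp
  ultimately have ev: "\<forall>\<^sub>F n in sequentially. 3 \<le> n \<and> 1 \<le> \<alpha> * real n ^ 2 \<and> 6 * ln (real n) + 4 \<le> real n * ln (real n) ^ 2"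
    using eventually_ge_at_top[of 3] by eventually_elim simp
  show ?thesis
  proof (rule exI[of _ "C + 1"], rule eventually_mono[OF ev], intro allI impI)
    fix n :: nat and \<T> \<U> :: "hypergraph set"
    assume n: "3 \<le> n \<and> 1 \<le> \<alpha> * real n ^ 2 \<and> 6 * ln (real n) + 4 \<le> real n * ln (real n) ^ 2"
      and TU: "\<T> \<subseteq> latin_squares n \<and> \<U> \<subseteq> Pow (complete_tripartite n) \<and>
        inherited \<rho> (nat \<lfloor>\<alpha> * real n ^ 2\<rfloor>) \<U> \<T> \<and> monotone_decreasing \<U>"
    define x where "x = real n * ln (real n) ^ 2"
    define P where "P = measure_pmf.prob (random_hypergraph n (\<alpha> / real n)) {G. delete_conflicts G \<in> \<U>}"
    let ?g = "greedy_prob (complete_tripartite n) \<U> (nat \<lfloor>\<alpha> * real n ^ 2\<rfloor>) {}"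
    have "exp (- x) * ?g \<le> exp (- 6 * ln (real n) - 4) * ?g"
      using n unfolding x_def by (intro mult_right_mono greedy_prob_nonneg) simp
    also have "\<dots> \<le> P" unfolding P_def by (rule greedy_prob_le_decreasing) (use assms n TU in auto)
    finally have "?g \<le> exp x * P" by (simp add: exp_minus field_simps)
    then have "exp (C * x) * ?g \<le> exp (C * x) * (exp x * P)" by (intro mult_left_mono) auto
    also have "\<dots> = exp ((C + 1) * x) * P" by (simp add: exp_add distrib_right)
    finally have "exp (C * x) * ?g \<le> exp ((C + 1) * x) * P" .
    moreover have "measure_pmf.prob (pmf_of_set (latin_squares n)) \<T> \<le> exp (C * x) * ?g"
      unfolding x_def by (rule C(2)) (use n TU in auto)
    ultimately have "measure_pmf.prob (pmf_of_set (latin_squares n)) \<T> \<le> exp ((C + 1) * x) * P"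
      by (rule order_trans[rotated])
    then show "measure_pmf.prob (pmf_of_set (latin_squares n)) \<T> \<le> exp ((C + 1) * (real n * ln (real n) ^ 2)) *
         measure_pmf.prob (random_hypergraph n (\<alpha> / real n)) {G. delete_conflicts G \<in> \<U>}"
      unfolding x_def P_def .
  qed
qed

lemma latin_increasing:
  fixes \<alpha> \<rho> \<gamma> :: real
  assumes "0 < \<alpha>" "\<alpha> < 1" "0 < \<rho>" "\<rho> < 1" "0 < \<gamma>" "\<alpha> < \<gamma> / (8 * (1 + \<gamma>))"
  shows "\<exists>C c :: real. 0 < c \<and> (\<forall>\<^sub>F n in sequentially. \<forall>\<T> \<U>.
     \<T> \<subseteq> latin_squares n \<and> \<U> \<subseteq> Pow (complete_tripartite n) \<and>
     inherited \<rho> (nat \<lfloor>\<alpha> * real n ^ 2\<rfloor>) \<U> \<T> \<and> monotone_increasing n \<U> \<longrightarrow>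
     measure_pmf.prob (pmf_of_set (latin_squares n)) \<T>
       \<le> exp (C * (real n * ln (real n) ^ 2)) *
         measure_pmf.prob (random_hypergraph n ((1 + \<gamma>) * \<alpha> / real n)) \<U> + exp (- c * real n ^ 2))"
proof -
  obtain C where C: "0 \<le> C" "\<And>n \<T> \<U>. 3 \<le> n \<Longrightarrow> \<T> \<subseteq> latin_squares n \<Longrightarrow>
      inherited \<rho> (nat \<lfloor>\<alpha> * real n ^ 2\<rfloor>) \<U> \<T> \<Longrightarrow>
      measure_pmf.prob (pmf_of_set (latin_squares n)) \<T> \<le> exp (C * (real n * ln (real n) ^ 2)) *
      greedy_prob (complete_tripartite n) \<U> (nat \<lfloor>\<alpha> * real n ^ 2\<rfloor>) {}"
    using prob_latin_le_greedy[OF assms(1-4)] by blast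
  \<comment> \<open>The rate from the coupling for increasing properties. The factor
    \<open>exp (C * (n * ln n ^ 2))\<close> also multiplies the error term, so half of c is given up
    to absorb it.\<close>
  define c where "c = \<alpha> * (\<gamma> / 4 * (3 * \<gamma> / 8 / (1 + \<gamma> / 4)))"
  have c: "0 < c" unfolding c_def using assms by (intro mult_pos_pos divide_pos_pos) auto
  have "\<forall>\<^sub>F n in sequentially. C * (real n * ln (real n) ^ 2) \<le> c / 2 * real n ^ 2"
  proof -
    have "((\<lambda>n. real n * ln (real n) ^ 2 / real n ^ 2) \<longlongrightarrow> 0) sequentially" by real_asymp
    then have "((\<lambda>n. C * (real n * ln (real n) ^ 2 / real n ^ 2)) \<longlongrightarrow> C * 0) sequentially"
      by (rule tendsto_mult_left)
    then have "\<forall>\<^sub>F n in sequentially. C * (real n * ln (real n) ^ 2 / real n ^ 2) < c / 2"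
      by (rule order_tendstoD(2)) (use c in simp)
    then show ?thesis using eventually_gt_at_top[of 0]
    proof eventually_elim
      case (elim n)
      then have "C * (real n * ln (real n) ^ 2 / real n ^ 2) * real n ^ 2 \<le> c / 2 * real n ^ 2"
        by (intro mult_right_mono) auto
      then show ?case using elim by simp
    qed
  qed
  moreover have "\<forall>\<^sub>F n in sequentially. (1 + \<gamma>) * \<alpha> \<le> real n" by real_asymp
  ultimately have ev: "\<forall>\<^sub>F n in sequentially. 3 \<le> n \<and> (1 + \<gamma>) * \<alpha> \<le> real n \<and>
      C * (real n * ln (real n) ^ 2) \<le> c / 2 * real n ^ 2"
    using eventually_ge_at_top[of 3] by eventually_elim simp
  show ?thesis
  proof (rule exI[of _ C], rule exI[of _ "c / 2"], rule conjI, use c in simp,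
      rule eventually_mono[OF ev], intro allI impI)
    fix n :: nat and \<T> \<U> :: "hypergraph set"
    assume n: "3 \<le> n \<and> (1 + \<gamma>) * \<alpha> \<le> real n \<and> C * (real n * ln (real n) ^ 2) \<le> c / 2 * real n ^ 2"
      and TU: "\<T> \<subseteq> latin_squares n \<and> \<U> \<subseteq> Pow (complete_tripartite n) \<and>
        inherited \<rho> (nat \<lfloor>\<alpha> * real n ^ 2\<rfloor>) \<U> \<T> \<and> monotone_increasing n \<U>"
    define x where "x = C * (real n * ln (real n) ^ 2)"
    define P where "P = measure_pmf.prob (random_hypergraph n ((1 + \<gamma>) * \<alpha> / real n)) \<U>"
    let ?g = "greedy_prob (complete_tripartite n) \<U> (nat \<lfloor>\<alpha> * real n ^ 2\<rfloor>) {}"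
    have m: "real (nat \<lfloor>\<alpha> * real n ^ 2\<rfloor>) \<le> \<alpha> * real n ^ 2" using assms by (simp add: of_nat_nat)
    have "?g \<le> P + exp (- c * real n ^ 2)"
      unfolding P_def c_def by (rule greedy_prob_le_increasing) (use assms n m TU in auto)
    then have "exp x * ?g \<le> exp x * (P + exp (- c * real n ^ 2))" by (intro mult_left_mono) auto
    also have "\<dots> = exp x * P + exp (x - c * real n ^ 2)" by (simp add: distrib_left exp_add[symmetric])
    also have "exp (x - c * real n ^ 2) \<le> exp (- (c / 2) * real n ^ 2)" using n by (simp add: x_def)
    finally have "exp x * ?g \<le> exp x * P + exp (- (c / 2) * real n ^ 2)" by simp
    moreover have "measure_pmf.prob (pmf_of_set (latin_squares n)) \<T> \<le> exp x * ?g"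
      unfolding x_def by (rule C(2)) (use n TU in auto)
    ultimately show "measure_pmf.prob (pmf_of_set (latin_squares n)) \<T> \<le> exp (C * (real n * ln (real n) ^ 2)) *
         measure_pmf.prob (random_hypergraph n ((1 + \<gamma>) * \<alpha> / real n)) \<U> + exp (- (c / 2) * real n ^ 2)"
      unfolding x_def P_def by (rule order_trans[rotated])
  qed
qed

theorem corollary5p5:
  "(\<forall>\<alpha> \<rho> :: real. 0 < \<alpha> \<and> \<alpha> < 1 \<and> 0 < \<rho> \<and> \<rho> < 1 \<longrightarrow>
      (\<exists>C::real. \<forall>\<^sub>F n in sequentially. \<forall>\<T> \<U>.
         \<T> \<subseteq> latin_squares n \<and> \<U> \<subseteq> Pow (complete_tripartite n) \<and>
         inherited \<rho> (nat \<lfloor>\<alpha> * real n ^ 2\<rfloor>) \<U> \<T> \<and> monotone_decreasing \<U> \<longrightarrow>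
         measure_pmf.prob (pmf_of_set (latin_squares n)) \<T>
           \<le> exp (C * (real n * ln (real n) ^ 2)) *
             measure_pmf.prob (random_hypergraph n (\<alpha> / real n))
               {G. delete_conflicts G \<in> \<U>}))
   \<and>
   (\<forall>\<gamma>::real. 0 < \<gamma> \<longrightarrow>
      (\<exists>\<alpha>\<^sub>0::real. 0 < \<alpha>\<^sub>0 \<and>
      (\<forall>\<alpha> \<rho> :: real. 0 < \<alpha> \<and> \<alpha> < 1 \<and> \<alpha> < \<alpha>\<^sub>0 \<and> 0 < \<rho> \<and> \<rho> < 1 \<longrightarrow>
        (\<exists>C c :: real. 0 < c \<and> (\<forall>\<^sub>F n in sequentially. \<forall>\<T> \<U>.
           \<T> \<subseteq> latin_squares n \<and> \<U> \<subseteq> Pow (complete_tripartite n) \<and>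
           inherited \<rho> (nat \<lfloor>\<alpha> * real n ^ 2\<rfloor>) \<U> \<T> \<and> monotone_increasing n \<U> \<longrightarrow>
           measure_pmf.prob (pmf_of_set (latin_squares n)) \<T>
             \<le> exp (C * (real n * ln (real n) ^ 2)) *
               measure_pmf.prob (random_hypergraph n ((1 + \<gamma>) * \<alpha> / real n)) \<U>
               + exp (- c * real n ^ 2))))))"
proof (intro conjI allI impI, goal_cases)
  case (1 \<alpha> \<rho>)
  then show ?case by (intro latin_decreasing) auto
next
  case (2 \<gamma>)
  then show ?case
    by (intro exI[of _ "\<gamma> / (8 * (1 + \<gamma>))"] conjI allI impI latin_increasing) auto
qed

end
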